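(* Let $\mathcal M^\sigma$ be the free $\mathbb Z[x,x^{-1}]$-module with basis $\{M^\sigma_\tau:\tau\in\mathcal K^J\}$. (a) There is a unique $\mathcal H$-module structure on $\mathcal M^\sigma$ with, for all $s\in S$ and $\tau\in\mathcal K^J$: $H_sM^\sigma_\tau=M^\sigma_{s\tau}$ if $s\in\mathrm{Asc}^<(\tau;\sigma)$; $H_sM^\sigma_\tau=M^\sigma_{s\tau}+(x-x^{-1})M^\sigma_\tau$ if $s\in\mathrm{Des}^<(\tau;\sigma)$; $H_sM^\sigma_\tau=-x^{-1}M^\sigma_\tau$ if $s\in\mathrm{Asc}^=(\tau;\sigma)$; $H_sM^\sigma_\tau=xM^\sigma_\tau$ if $s\in\mathrm{Des}^=(\tau;\sigma)$. (b) There is a unique $\mathcal H$-compatible bar operator $M\mapsto\overline M$ on $\mathcal M^\sigma$ fixing $M^\sigma_\tau$ for every $\tau\in\mathcal K^J$ with $\mathrm{Des}^<(\tau;\sigma)=\varnothing$; it is an involution and satisfies $\overline{M^\sigma_\tau}\in M^\sigma_\tau+\sum_{\upsilon\prec\tau}\mathbb Z[x,x^{-1}]M^\sigma_\upsilon$ for all $\tau$. (c) $\mathcal M^\sigma$ has a unique basis $\{\underline M^\sigma_\tau:\tau\in\mathcal K^J\}$ with $\overline{\underline M^\sigma_\tau}=\underline M^\sigma_\tau\in M^\sigma_\tau+\sum_{\upsilon\prec\tau}x^{-1}\mathbb Z[x^{-1}]M^\sigma_\upsilon$ for all $\tau\in\mathcal K^J$.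
   Context: Let $(W,S)$ be a finite Coxeter system with length $\ell$, Bruhat order $\le$, reflections $T=\{wsw^{-1}:w\in W,s\in S\}$. $\mathrm{Aut}(W,S)$: automorphisms $\varphi$ of $W$ with $\varphi(S)=S$; $W^+=W\rtimes\mathrm{Aut}(W,S)$ with $(v,\alpha)(w,\beta)=(v\,\alpha(w),\alpha\beta)$, $\ell(w,\varphi)=\ell(w)$, $w\equiv(w,1)$. $z\in W^+$ is a perfect involution if $z^2=1$ and $(zt)^4=1$ for all $t\in T$. Fix $J\subseteq S$: $W_J=\langle J\rangle$; $\mathscr I_J$ = perfect involutions of $(W_J)^+=W_J\rtimes\mathrm{Aut}(W_J,J)$, with $W_J$ acting by $v:(y,\theta)\mapsto(v\,y\,\theta(v)^{-1},\theta)$; $z$ is $W_J$-minimal if $\ell(szs)\ge\ell(z)$ for all $s\in J$ (unique in each $W_J$-class). $W^J=\{w:\ell(ws)>\ell(w)\ \forall s\in J\}$, $\mathcal K^J=W^J\times\mathscr I_J$, $\mathrm{ht}(w,z)=\ell(w)+\tfrac12(\ell(z)-\ell(z_{\min}))$ with $z_{\min}$ the $W_J$-minimal conjugate of $z$. For $s\in S$, $\tau=(w,z)$: $s\tau=(sw,z)$ if $sw\in W^J$, else $s\tau=(w,tzt)$ with $t=w^{-1}sw\in J$; this is a $W$-action. Quasiparabolic Bruhat order on $\mathscr I_J$: transitive closure of $z<tzt$ for reflections $t$ of $W_J$ with $\ell(z)<\ell(tzt)$. Partial order $\prec$ on $\mathcal K^J$: $(w,z)\prec(w',z')$ iff same $W$-orbit,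 $\mathrm{ht}(w,z)<\mathrm{ht}(w',z')$, and either $w<w'$ (Bruhat) or $w=w'$ and $z<z'$ (quasiparabolic Bruhat). Fix a homomorphism $\sigma:W_J\to\{\pm1\}$; for $\tau=(w,z)$: $\mathrm{Asc}^<(\tau;\sigma)=\{s:\mathrm{ht}(s\tau)>\mathrm{ht}(\tau)\}$, $\mathrm{Des}^<(\tau;\sigma)=\{s:\mathrm{ht}(s\tau)<\mathrm{ht}(\tau)\}$, $\mathrm{Asc}^=(\tau;\sigma)=\{s:\mathrm{ht}(s\tau)=\mathrm{ht}(\tau),\ \sigma(w^{-1}sw)=-1\}$, $\mathrm{Des}^=(\tau;\sigma)=\{s:\mathrm{ht}(s\tau)=\mathrm{ht}(\tau),\ \sigma(w^{-1}sw)=1\}$ (when $\mathrm{ht}(s\tau)=\mathrm{ht}(\tau)$, $w^{-1}sw\in J$). $\mathcal H$: the Iwahori–Hecke algebra of $(W,S)$, free over $\mathbb Z[x,x^{-1}]$ with basis $H_w$, $H_sH_w=H_{sw}$ if $\ell(sw)>\ell(w)$, $H_{sw}+(x-x^{-1})H_w$ otherwise. Antilinear means $\phi(pa)=\bar p\phi(a)$ with $\bar{\ }:x\mapsto x^{-1}$. The bar operator of $\mathcal H$ is the antilinear ring involution with $\overline{H_w}=(H_{w^{-1}})^{-1}$; an $\mathcal H$-compatible bar operator on an $\mathcal H$-module is an antilinear map with $\overline{HA}=\overline H\,\overline A$. *)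

theory Defs
  imports Complex_Main "HOL-Algebra.Group" "HOL-Algebra.Generated_Groups" "HOL-Library.Poly_Mapping"
begin

definition wprod :: "'a monoid \<Rightarrow> 'a list \<Rightarrow> 'a" where
  "wprod W ws = foldr (\<lambda>a b. a \<otimes>\<^bsub>W\<^esub> b) ws \<one>\<^bsub>W\<^esub>"

definition gord :: "'a monoid \<Rightarrow> 'a \<Rightarrow> nat" where
  "gord W g = (LEAST n. 0 < n \<and> g [^]\<^bsub>W\<^esub> n = \<one>\<^bsub>W\<^esub>)"

fun altw :: "'a \<Rightarrow> 'a \<Rightarrow> nat \<Rightarrow> 'a list" where
  "altw s t 0 = []"
| "altw s t (Suc n) = s # altw t s n"

inductive cox_eq :: "'a monoid \<Rightarrow> 'a set \<Rightarrow> 'a list \<Rightarrow> 'a list \<Rightarrow> bool"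
  for W S where
  cox_refl: "cox_eq W S u u"
| cox_sym: "cox_eq W S u v \<Longrightarrow> cox_eq W S v u"
| cox_trans: "cox_eq W S u v \<Longrightarrow> cox_eq W S v w \<Longrightarrow> cox_eq W S u w"
| cox_sq: "s \<in> S \<Longrightarrow> set u \<subseteq> S \<Longrightarrow> set v \<subseteq> S \<Longrightarrow> cox_eq W S (u @ [s, s] @ v) (u @ v)"
| cox_braid: "s \<in> S \<Longrightarrow> t \<in> S \<Longrightarrow> set u \<subseteq> S \<Longrightarrow> set v \<subseteq> S \<Longrightarrow>
     cox_eq W S (u @ altw s t (2 * gord W (s \<otimes>\<^bsub>W\<^esub> t)) @ v) (u @ v)"

text \<open>(W,S) is a Coxeter system: W is generated by the involutions S and every relation
  among the generators follows from the Coxeter relations (i.e. W has the Coxeter presentation).\<close>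
definition coxeter_system :: "'a monoid \<Rightarrow> 'a set \<Rightarrow> bool" where
  "coxeter_system W S \<longleftrightarrow> group W \<and> S \<subseteq> carrier W \<and> \<one>\<^bsub>W\<^esub> \<notin> S
     \<and> (\<forall>s\<in>S. s \<otimes>\<^bsub>W\<^esub> s = \<one>\<^bsub>W\<^esub>)
     \<and> generate W S = carrier W
     \<and> (\<forall>ws. set ws \<subseteq> S \<and> wprod W ws = \<one>\<^bsub>W\<^esub> \<longrightarrow> cox_eq W S ws [])"

definition lenS :: "'a monoid \<Rightarrow> 'a set \<Rightarrow> 'a \<Rightarrow> nat" where
  "lenS W S w = (LEAST n. \<exists>ws. set ws \<subseteq> S \<and> length ws = n \<and> wprod W ws = w)"

definition reflsW :: "'a monoid \<Rightarrow> 'a set \<Rightarrow> 'a set" where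
  "reflsW W S = {w \<otimes>\<^bsub>W\<^esub> s \<otimes>\<^bsub>W\<^esub> inv\<^bsub>W\<^esub> w | w s. w \<in> carrier W \<and> s \<in> S}"

definition bruhat_less :: "'a monoid \<Rightarrow> 'a set \<Rightarrow> 'a \<Rightarrow> 'a \<Rightarrow> bool" where
  "bruhat_less W S u w \<longleftrightarrow> (u, w) \<in> trancl
     {(v, v \<otimes>\<^bsub>W\<^esub> t) | v t. v \<in> carrier W \<and> t \<in> reflsW W S
        \<and> lenS W S v < lenS W S (v \<otimes>\<^bsub>W\<^esub> t)}"

definition WJ :: "'a monoid \<Rightarrow> 'a set \<Rightarrow> 'a set" where
  "WJ W J = generate W J"

text \<open>Aut(W_J,J); automorphisms are represented as functions that are the identity off W_J.\<close>
definition autJ :: "'a monoid \<Rightarrow> 'a set \<Rightarrow> ('a \<Rightarrow> 'a) set" where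
  "autJ W J = {\<theta>. bij_betw \<theta> (WJ W J) (WJ W J)
      \<and> (\<forall>u\<in>WJ W J. \<forall>v\<in>WJ W J. \<theta> (u \<otimes>\<^bsub>W\<^esub> v) = \<theta> u \<otimes>\<^bsub>W\<^esub> \<theta> v)
      \<and> \<theta> ` J = J \<and> (\<forall>x. x \<notin> WJ W J \<longrightarrow> \<theta> x = x)}"

text \<open>multiplication in the semidirect product (W_J)^+ = W_J \<rtimes> Aut(W_J,J)\<close>
definition pmult :: "'a monoid \<Rightarrow> 'a \<times> ('a \<Rightarrow> 'a) \<Rightarrow> 'a \<times> ('a \<Rightarrow> 'a) \<Rightarrow> 'a \<times> ('a \<Rightarrow> 'a)" where
  "pmult W p q = (fst p \<otimes>\<^bsub>W\<^esub> snd p (fst q), snd p \<circ> snd q)"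

definition pone :: "'a monoid \<Rightarrow> 'a \<times> ('a \<Rightarrow> 'a)" where
  "pone W = (\<one>\<^bsub>W\<^esub>, id)"

definition reflsJ :: "'a monoid \<Rightarrow> 'a set \<Rightarrow> 'a set" where
  "reflsJ W J = {w \<otimes>\<^bsub>W\<^esub> s \<otimes>\<^bsub>W\<^esub> inv\<^bsub>W\<^esub> w | w s. w \<in> WJ W J \<and> s \<in> J}"

definition perfect_invs :: "'a monoid \<Rightarrow> 'a set \<Rightarrow> ('a \<times> ('a \<Rightarrow> 'a)) set" where
  "perfect_invs W J = {z. fst z \<in> WJ W J \<and> snd z \<in> autJ W J \<and> pmult W z z = pone W
      \<and> (\<forall>t\<in>reflsJ W J. let zt = pmult W z (t, id) in
            pmult W (pmult W zt zt) (pmult W zt zt) = pone W)}"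

definition zlen :: "'a monoid \<Rightarrow> 'a set \<Rightarrow> 'a \<times> ('a \<Rightarrow> 'a) \<Rightarrow> nat" where
  "zlen W J z = lenS W J (fst z)"

definition conjJ :: "'a monoid \<Rightarrow> 'a \<Rightarrow> 'a \<times> ('a \<Rightarrow> 'a) \<Rightarrow> 'a \<times> ('a \<Rightarrow> 'a)" where
  "conjJ W t z = pmult W (pmult W (t, id) z) (t, id)"

definition wact :: "'a monoid \<Rightarrow> 'a \<Rightarrow> 'a \<times> ('a \<Rightarrow> 'a) \<Rightarrow> 'a \<times> ('a \<Rightarrow> 'a)" where
  "wact W v z = (v \<otimes>\<^bsub>W\<^esub> fst z \<otimes>\<^bsub>W\<^esub> inv\<^bsub>W\<^esub> (snd z v), snd z)"

definition minimalJ :: "'a monoid \<Rightarrow> 'a set \<Rightarrow> 'a \<times> ('a \<Rightarrow> 'a) \<Rightarrow> bool" where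
  "minimalJ W J z \<longleftrightarrow> (\<forall>s\<in>J. zlen W J (conjJ W s z) \<ge> zlen W J z)"

definition zmin :: "'a monoid \<Rightarrow> 'a set \<Rightarrow> 'a \<times> ('a \<Rightarrow> 'a) \<Rightarrow> 'a \<times> ('a \<Rightarrow> 'a)" where
  "zmin W J z = (THE z'. (\<exists>v\<in>WJ W J. z' = wact W v z) \<and> minimalJ W J z')"

definition WupJ :: "'a monoid \<Rightarrow> 'a set \<Rightarrow> 'a set \<Rightarrow> 'a set" where
  "WupJ W S J = {w \<in> carrier W. \<forall>s\<in>J. lenS W S (w \<otimes>\<^bsub>W\<^esub> s) > lenS W S w}"

type_synonym 'a kelt = "'a \<times> ('a \<times> ('a \<Rightarrow> 'a))"

definition KJ :: "'a monoid \<Rightarrow> 'a set \<Rightarrow> 'a set \<Rightarrow> 'a kelt set" where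
  "KJ W S J = WupJ W S J \<times> perfect_invs W J"

definition ht :: "'a monoid \<Rightarrow> 'a set \<Rightarrow> 'a set \<Rightarrow> 'a kelt \<Rightarrow> real" where
  "ht W S J \<tau> = real (lenS W S (fst \<tau>))
      + (real (zlen W J (snd \<tau>)) - real (zlen W J (zmin W J (snd \<tau>)))) / 2"

definition sact :: "'a monoid \<Rightarrow> 'a set \<Rightarrow> 'a set \<Rightarrow> 'a \<Rightarrow> 'a kelt \<Rightarrow> 'a kelt" where
  "sact W S J s \<tau> = (if s \<otimes>\<^bsub>W\<^esub> fst \<tau> \<in> WupJ W S J then (s \<otimes>\<^bsub>W\<^esub> fst \<tau>, snd \<tau>)
      else (fst \<tau>, conjJ W (inv\<^bsub>W\<^esub> (fst \<tau>) \<otimes>\<^bsub>W\<^esub> s \<otimes>\<^bsub>W\<^esub> fst \<tau>) (snd \<tau>)))"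

text \<open>same orbit of the W-action (W is generated by S)\<close>
definition same_orbit :: "'a monoid \<Rightarrow> 'a set \<Rightarrow> 'a set \<Rightarrow> 'a kelt \<Rightarrow> 'a kelt \<Rightarrow> bool" where
  "same_orbit W S J \<tau> \<tau>' \<longleftrightarrow> (\<tau>, \<tau>') \<in> rtrancl {(\<upsilon>, sact W S J s \<upsilon>) | s \<upsilon>. s \<in> S \<and> \<upsilon> \<in> KJ W S J}"

definition qp_less :: "'a monoid \<Rightarrow> 'a set \<Rightarrow> 'a \<times> ('a \<Rightarrow> 'a) \<Rightarrow> 'a \<times> ('a \<Rightarrow> 'a) \<Rightarrow> bool" where
  "qp_less W J z z' \<longleftrightarrow> (z, z') \<in> trancl
     {(y, conjJ W t y) | y t. y \<in> perfect_invs W J \<and> t \<in> reflsJ W J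
        \<and> zlen W J y < zlen W J (conjJ W t y)}"

definition precK :: "'a monoid \<Rightarrow> 'a set \<Rightarrow> 'a set \<Rightarrow> 'a kelt \<Rightarrow> 'a kelt \<Rightarrow> bool" where
  "precK W S J \<tau> \<tau>' \<longleftrightarrow> \<tau> \<in> KJ W S J \<and> \<tau>' \<in> KJ W S J \<and> same_orbit W S J \<tau> \<tau>'
     \<and> ht W S J \<tau> < ht W S J \<tau>'
     \<and> (bruhat_less W S (fst \<tau>) (fst \<tau>') \<or> (fst \<tau> = fst \<tau>' \<and> qp_less W J (snd \<tau>) (snd \<tau>')))"

definition AscL :: "'a monoid \<Rightarrow> 'a set \<Rightarrow> 'a set \<Rightarrow> 'a kelt \<Rightarrow> 'a set" where
  "AscL W S J \<tau> = {s \<in> S. ht W S J (sact W S J s \<tau>) > ht W S J \<tau>}"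

definition DesL :: "'a monoid \<Rightarrow> 'a set \<Rightarrow> 'a set \<Rightarrow> 'a kelt \<Rightarrow> 'a set" where
  "DesL W S J \<tau> = {s \<in> S. ht W S J (sact W S J s \<tau>) < ht W S J \<tau>}"

definition AscE :: "'a monoid \<Rightarrow> 'a set \<Rightarrow> 'a set \<Rightarrow> ('a \<Rightarrow> int) \<Rightarrow> 'a kelt \<Rightarrow> 'a set" where
  "AscE W S J \<sigma> \<tau> = {s \<in> S. ht W S J (sact W S J s \<tau>) = ht W S J \<tau>
      \<and> \<sigma> (inv\<^bsub>W\<^esub> (fst \<tau>) \<otimes>\<^bsub>W\<^esub> s \<otimes>\<^bsub>W\<^esub> fst \<tau>) = -1}"

definition DesE :: "'a monoid \<Rightarrow> 'a set \<Rightarrow> 'a set \<Rightarrow> ('a \<Rightarrow> int) \<Rightarrow> 'a kelt \<Rightarrow> 'a set" where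
  "DesE W S J \<sigma> \<tau> = {s \<in> S. ht W S J (sact W S J s \<tau>) = ht W S J \<tau>
      \<and> \<sigma> (inv\<^bsub>W\<^esub> (fst \<tau>) \<otimes>\<^bsub>W\<^esub> s \<otimes>\<^bsub>W\<^esub> fst \<tau>) = 1}"

section \<open>Laurent polynomials Z[x,x^-1] as the group ring of int over int\<close>

type_synonym laurent = "int \<Rightarrow>\<^sub>0 int"

definition xL :: laurent where "xL = Poly_Mapping.single 1 1"
definition xinv :: laurent where "xinv = Poly_Mapping.single (-1) 1"

definition barL :: "laurent \<Rightarrow> laurent" where
  "barL p = (\<Sum>n\<in>Poly_Mapping.keys p. Poly_Mapping.single (- n) (Poly_Mapping.lookup p n))"

text \<open>vector operations on free modules, elements represented as coefficient functions\<close>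
definition vadd :: "('i \<Rightarrow> laurent) \<Rightarrow> ('i \<Rightarrow> laurent) \<Rightarrow> 'i \<Rightarrow> laurent" where
  "vadd f g = (\<lambda>i. f i + g i)"
definition sc :: "laurent \<Rightarrow> ('i \<Rightarrow> laurent) \<Rightarrow> 'i \<Rightarrow> laurent" where
  "sc p f = (\<lambda>i. p * f i)"
definition bvec :: "'i \<Rightarrow> 'i \<Rightarrow> laurent" where
  "bvec j = (\<lambda>i. if i = j then 1 else 0)"

definition heckeH :: "'a monoid \<Rightarrow> ('a \<Rightarrow> laurent) set" where
  "heckeH W = {h. \<forall>v. v \<notin> carrier W \<longrightarrow> h v = 0}"

text \<open>left multiplication by H_s: H_s H_w = H_{sw} if l(sw) > l(w), else H_{sw} + (x - x^-1) H_w\<close>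
definition Ls :: "'a monoid \<Rightarrow> 'a set \<Rightarrow> 'a \<Rightarrow> ('a \<Rightarrow> laurent) \<Rightarrow> 'a \<Rightarrow> laurent" where
  "Ls W S s h = (\<lambda>v. if v \<in> carrier W then
      h (s \<otimes>\<^bsub>W\<^esub> v) + (if lenS W S (s \<otimes>\<^bsub>W\<^esub> v) < lenS W S v then (xL - xinv) * h v else 0)
    else 0)"

definition redword :: "'a monoid \<Rightarrow> 'a set \<Rightarrow> 'a \<Rightarrow> 'a list" where
  "redword W S w = (SOME ws. set ws \<subseteq> S \<and> wprod W ws = w \<and> length ws = lenS W S w)"

text \<open>left multiplication by H_w = H_{s1} ... H_{sk} for a reduced word\<close>
definition Lw :: "'a monoid \<Rightarrow> 'a set \<Rightarrow> 'a \<Rightarrow> ('a \<Rightarrow> laurent) \<Rightarrow> 'a \<Rightarrow> laurent" where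
  "Lw W S w h = foldr (Ls W S) (redword W S w) h"

definition hmult :: "'a monoid \<Rightarrow> 'a set \<Rightarrow> ('a \<Rightarrow> laurent) \<Rightarrow> ('a \<Rightarrow> laurent) \<Rightarrow> 'a \<Rightarrow> laurent" where
  "hmult W S a b = (\<lambda>v. \<Sum>w\<in>carrier W. a w * Lw W S w b v)"

definition hone :: "'a monoid \<Rightarrow> 'a \<Rightarrow> laurent" where
  "hone W = bvec \<one>\<^bsub>W\<^esub>"

definition hinv :: "'a monoid \<Rightarrow> 'a set \<Rightarrow> ('a \<Rightarrow> laurent) \<Rightarrow> 'a \<Rightarrow> laurent" where
  "hinv W S a = (THE b. b \<in> heckeH W \<and> hmult W S a b = hone W \<and> hmult W S b a = hone W)"

definition barH :: "'a monoid \<Rightarrow> 'a set \<Rightarrow> ('a \<Rightarrow> laurent) \<Rightarrow> 'a \<Rightarrow> laurent" where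
  "barH W S h = (\<lambda>v. \<Sum>w\<in>carrier W. barL (h w) * hinv W S (bvec (inv\<^bsub>W\<^esub> w)) v)"

definition Mcar :: "'a monoid \<Rightarrow> 'a set \<Rightarrow> 'a set \<Rightarrow> ('a kelt \<Rightarrow> laurent) set" where
  "Mcar W S J = {m. \<forall>\<tau>. \<tau> \<notin> KJ W S J \<longrightarrow> m \<tau> = 0}"

definition is_hmodule :: "'a monoid \<Rightarrow> 'a set \<Rightarrow> 'a set
    \<Rightarrow> (('a \<Rightarrow> laurent) \<Rightarrow> ('a kelt \<Rightarrow> laurent) \<Rightarrow> ('a kelt \<Rightarrow> laurent)) \<Rightarrow> bool" where
  "is_hmodule W S J act \<longleftrightarrow>
     (\<forall>h\<in>heckeH W. \<forall>m\<in>Mcar W S J. act h m \<in> Mcar W S J)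
   \<and> (\<forall>h1\<in>heckeH W. \<forall>h2\<in>heckeH W. \<forall>m\<in>Mcar W S J. act (vadd h1 h2) m = vadd (act h1 m) (act h2 m))
   \<and> (\<forall>h\<in>heckeH W. \<forall>m1\<in>Mcar W S J. \<forall>m2\<in>Mcar W S J. act h (vadd m1 m2) = vadd (act h m1) (act h m2))
   \<and> (\<forall>p. \<forall>h\<in>heckeH W. \<forall>m\<in>Mcar W S J. act (sc p h) m = sc p (act h m))
   \<and> (\<forall>p. \<forall>h\<in>heckeH W. \<forall>m\<in>Mcar W S J. act h (sc p m) = sc p (act h m))
   \<and> (\<forall>a\<in>heckeH W. \<forall>b\<in>heckeH W. \<forall>m\<in>Mcar W S J. act (hmult W S a b) m = act a (act b m))
   \<and> (\<forall>m\<in>Mcar W S J. act (hone W) m = m)"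

definition action_rules :: "'a monoid \<Rightarrow> 'a set \<Rightarrow> 'a set \<Rightarrow> ('a \<Rightarrow> int)
    \<Rightarrow> (('a \<Rightarrow> laurent) \<Rightarrow> ('a kelt \<Rightarrow> laurent) \<Rightarrow> ('a kelt \<Rightarrow> laurent)) \<Rightarrow> bool" where
  "action_rules W S J \<sigma> act \<longleftrightarrow> (\<forall>s\<in>S. \<forall>\<tau>\<in>KJ W S J.
       (s \<in> AscL W S J \<tau> \<longrightarrow> act (bvec s) (bvec \<tau>) = bvec (sact W S J s \<tau>))
     \<and> (s \<in> DesL W S J \<tau> \<longrightarrow> act (bvec s) (bvec \<tau>) = vadd (bvec (sact W S J s \<tau>)) (sc (xL - xinv) (bvec \<tau>)))
     \<and> (s \<in> AscE W S J \<sigma> \<tau> \<longrightarrow> act (bvec s) (bvec \<tau>) = sc (- xinv) (bvec \<tau>))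
     \<and> (s \<in> DesE W S J \<sigma> \<tau> \<longrightarrow> act (bvec s) (bvec \<tau>) = sc xL (bvec \<tau>)))"

definition compat_bar :: "'a monoid \<Rightarrow> 'a set \<Rightarrow> 'a set
    \<Rightarrow> (('a \<Rightarrow> laurent) \<Rightarrow> ('a kelt \<Rightarrow> laurent) \<Rightarrow> ('a kelt \<Rightarrow> laurent))
    \<Rightarrow> (('a kelt \<Rightarrow> laurent) \<Rightarrow> ('a kelt \<Rightarrow> laurent)) \<Rightarrow> bool" where
  "compat_bar W S J act \<phi> \<longleftrightarrow>
     (\<forall>m\<in>Mcar W S J. \<phi> m \<in> Mcar W S J)
   \<and> (\<forall>m1\<in>Mcar W S J. \<forall>m2\<in>Mcar W S J. \<phi> (vadd m1 m2) = vadd (\<phi> m1) (\<phi> m2))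
   \<and> (\<forall>p. \<forall>m\<in>Mcar W S J. \<phi> (sc p m) = sc (barL p) (\<phi> m))
   \<and> (\<forall>h\<in>heckeH W. \<forall>m\<in>Mcar W S J. \<phi> (act h m) = act (barH W S h) (\<phi> m))"

definition fixes_minimal :: "'a monoid \<Rightarrow> 'a set \<Rightarrow> 'a set
    \<Rightarrow> (('a kelt \<Rightarrow> laurent) \<Rightarrow> ('a kelt \<Rightarrow> laurent)) \<Rightarrow> bool" where
  "fixes_minimal W S J \<phi> \<longleftrightarrow> (\<forall>\<tau>\<in>KJ W S J. DesL W S J \<tau> = {} \<longrightarrow> \<phi> (bvec \<tau>) = bvec \<tau>)"

definition is_basis :: "'a monoid \<Rightarrow> 'a set \<Rightarrow> 'a set \<Rightarrow> ('a kelt \<Rightarrow> 'a kelt \<Rightarrow> laurent) \<Rightarrow> bool" where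
  "is_basis W S J C \<longleftrightarrow> (\<forall>\<tau>\<in>KJ W S J. C \<tau> \<in> Mcar W S J)
     \<and> (\<forall>m\<in>Mcar W S J. \<exists>!c. (\<forall>\<tau>. \<tau> \<notin> KJ W S J \<longrightarrow> c \<tau> = 0)
                            \<and> m = (\<lambda>\<upsilon>. \<Sum>\<tau>\<in>KJ W S J. c \<tau> * C \<tau> \<upsilon>))"

definition canonical :: "'a monoid \<Rightarrow> 'a set \<Rightarrow> 'a set
    \<Rightarrow> (('a kelt \<Rightarrow> laurent) \<Rightarrow> ('a kelt \<Rightarrow> laurent)) \<Rightarrow> ('a kelt \<Rightarrow> 'a kelt \<Rightarrow> laurent) \<Rightarrow> bool" where
  "canonical W S J \<phi> C \<longleftrightarrow> (\<forall>\<tau>\<in>KJ W S J. \<phi> (C \<tau>) = C \<tau> \<and> C \<tau> \<tau> = 1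
     \<and> (\<forall>\<upsilon>. \<upsilon> \<noteq> \<tau> \<and> C \<tau> \<upsilon> \<noteq> 0 \<longrightarrow> precK W S J \<upsilon> \<tau> \<and> Poly_Mapping.keys (C \<tau> \<upsilon>) \<subseteq> {n. n < 0}))"

end

theory Submission
  imports Defs "HOL-Library.Function_Algebras" "HOL-Algebra.Multiplicative_Group"
begin

text \<open>
  The left inversions \<open>linv w t \<longleftrightarrow> \<ell>(tw) < \<ell>(w)\<close> satisfy a cocycle identity, and from it a
  perfect involution \<open>z = (y, \<theta>)\<close> inherits everything that is needed: since \<open>ztz\<close> commutes with \<open>t\<close>,
  either \<open>tzt = z\<close> or \<open>\<ell>(tzt) - \<ell>(z)\<close> has the sign predicted by \<open>linv y t\<close>. Hence the perfect
  involutions of \<open>W_J\<close> form a quasiparabolic set in the sense of Rains and Vazirani.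

  Because of the quadratic relation a braid relation need only be checked at the minimal element of
  each dihedral orbit, where an argument of Kilmoyer type on \<open>P \<inter> zPz\<close>, for the dihedral
  parabolic \<open>P\<close>, leaves only a few shapes of orbit. This gives the module for \<open>W_J\<close>; the module
  on \<open>\<K>^J\<close> is induced from it.

  The bar operator has a closed form: up to a unit depending only on the orbit,
  \<open>M_(w, z) \<mapsto> bar H_(wy) \<cdot> M_(1, z')\<close> with \<open>z' = (y\<^sup>-\<^sup>1, \<theta>)\<close>. Compatibility with \<open>H_s\<close> is then a
  computation with lengths, and on a minimal \<open>z\<close> the element \<open>y\<close> is a product of generators fixing \<open>z\<close>.
  Triangularity follows from the lifting property of the two Bruhat orders.
\<close>

section \<open>Words and inversions\<close>

text \<open>Perfection enters through one fact. As \<open>z^2 = 1\<close>,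
  \<open>(zt)^2 = (ztz) t\<close>, so \<open>(zt)^4 = 1\<close> says that the reflections
  \<open>ztz\<close> and \<open>t\<close> commute. Distinct commuting reflections are never
  inversions of each other, so in \<open>tzt = (ztz) t z\<close> both factors change the length in
  the same direction. Two well-definedness problems remain. For the braid relations, the stabiliser
  of \<open>z\<close> in a dihedral \<open>P\<close> lies in \<open>P \<inter> zPz\<close>; once
  \<open>y\<close> is minimal in \<open>P y\<close>, any element of this intersection besides one
  and the two generators forces conjugation by \<open>z\<close> to permute the generators. This is
  what limits the shapes of the orbits. The bar operator is forced along ascents,
  \<open>bar M_(s\<tau>) = bar H_s bar M_\<tau>\<close>, but as a definition this recursion depends
  on a path. The closed form contains no path: when \<open>szs\<close> is longer than
  \<open>z\<close>, \<open>y\<close> becomes \<open>s y b\<close> with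
  \<open>b = \<theta>(s)\<close>. The left letter contributes \<open>bar H_s\<close>; the right one
  is absorbed, because \<open>z'\<close> becomes \<open>b z' b\<close> and
  \<open>M_(1, b z' b) = H_b M_(1, z')\<close>, on which \<open>bar H_b\<close>, the inverse of
  \<open>H_b\<close>, acts.\<close>

locale coxeter =
  fixes W :: "'a monoid" (structure) and S :: "'a set"
  assumes coxeter: "coxeter_system W S"
    and finite_carrier: "finite (carrier W)"

sublocale coxeter \<subseteq> group W
  using coxeter by (simp add: coxeter_system_def)

text \<open>For \<open>s1, ..., sk\<close> the i-th entry is
  \<open>s1 ... s(i-1) si s(i-1) ... s1\<close>, the reflection whose left multiplication deletes
  the i-th letter. Entries may repeat when the word is not reduced.\<close>

primrec refl_list :: "'a monoid \<Rightarrow> 'a list \<Rightarrow> 'a list" where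
  "refl_list W [] = []"
| "refl_list W (s # ws) = s # map (\<lambda>t. s \<otimes>\<^bsub>W\<^esub> t \<otimes>\<^bsub>W\<^esub> s) (refl_list W ws)"

lemma length_altw [simp]: "length (altw s t n) = n"
  by (induct s t n rule: altw.induct) auto

lemma set_altw: "set (altw s t n) \<subseteq> {s, t}"
  by (induct s t n rule: altw.induct) auto

lemma altw_append_last: "altw s t (Suc n) = altw s t n @ [if even n then s else t]"
  by (induct s t n rule: altw.induct) auto

lemma altw_eq_rev: "altw s t n = rev (if even n then altw t s n else altw s t n)"
proof (induct s t n rule: altw.induct)
  case (2 s t n)
  have "rev (altw s t (Suc n)) = s # rev (altw s t n)" if "even n"
    using that by (subst altw_append_last) simp
  moreover have "rev (altw t s (Suc n)) = s # rev (altw t s n)" if "odd n"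
    using that by (subst altw_append_last) simp
  moreover have "altw s t (Suc n) = s # altw t s n" by simp
  ultimately show ?case
    using 2 by (cases "even n") (metis even_Suc)+
qed simp

lemma altw_add: "altw s t (m + n) = altw s t m @ (if even m then altw s t n else altw t s n)"
  by (induct s t m rule: altw.induct) auto

lemma count_list_map_inverse:
  assumes "\<And>x. x \<in> A \<Longrightarrow> g (f x) = x" "set xs \<subseteq> A" "f (g a) = a" "g a \<in> A"
  shows "count_list (map f xs) a = count_list xs (g a)"
  using assms(2)
proof (induct xs)
  case (Cons x xs)
  have "f x = a \<longleftrightarrow> x = g a"
    using assms Cons.prems by auto
  then show ?case using Cons by auto
qed simp

context coxeter
begin

abbreviation len where "len \<equiv> lenS W S"
abbreviation refls where "refls \<equiv> reflsW W S"
abbreviation linv where "linv w t \<equiv> len (t \<otimes> w) < len w"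

lemma gens_closed [simp]: "s \<in> S \<Longrightarrow> s \<in> carrier W"
  using coxeter by (auto simp: coxeter_system_def)

lemma word_closed: "set ws \<subseteq> S \<Longrightarrow> set ws \<subseteq> carrier W"
  by auto

lemma gen_sq [simp]: "s \<in> S \<Longrightarrow> s \<otimes> s = \<one>"
  using coxeter by (auto simp: coxeter_system_def)

lemma gen_ne_one: "s \<in> S \<Longrightarrow> s \<noteq> \<one>"
  using coxeter by (auto simp: coxeter_system_def)

lemma gen_inv [simp]: "s \<in> S \<Longrightarrow> inv s = s"
  by (simp add: inv_equality)

lemma gen_cancel [simp]: "s \<in> S \<Longrightarrow> x \<in> carrier W \<Longrightarrow> s \<otimes> (s \<otimes> x) = x"
  by (simp add: m_assoc [symmetric])

lemma inv_cancel_left [simp]: "\<lbrakk>g \<in> carrier W; x \<in> carrier W\<rbrakk> \<Longrightarrow> inv g \<otimes> (g \<otimes> x) = x"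
  by (simp add: m_assoc [symmetric])

lemma inv_cancel_right [simp]: "\<lbrakk>g \<in> carrier W; x \<in> carrier W\<rbrakk> \<Longrightarrow> g \<otimes> (inv g \<otimes> x) = x"
  by (simp add: m_assoc [symmetric])

lemma wprod_Nil [simp]: "wprod W [] = \<one>"
  by (simp add: wprod_def)

lemma wprod_Cons [simp]: "wprod W (a # ws) = a \<otimes> wprod W ws"
  by (simp add: wprod_def)

lemma wprod_closed [simp]: "set ws \<subseteq> carrier W \<Longrightarrow> wprod W ws \<in> carrier W"
  by (induct ws) auto

lemma wprod_closedS [simp]: "set ws \<subseteq> S \<Longrightarrow> wprod W ws \<in> carrier W"
  using word_closed by auto

lemma wprod_append [simp]:
  "\<lbrakk>set u \<subseteq> carrier W; set v \<subseteq> carrier W\<rbrakk> \<Longrightarrow> wprod W (u @ v) = wprod W u \<otimes> wprod W v"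
  by (induct u) (auto simp: m_assoc)

lemma wprod_appendS [simp]:
  "\<lbrakk>set u \<subseteq> S; set v \<subseteq> S\<rbrakk> \<Longrightarrow> wprod W (u @ v) = wprod W u \<otimes> wprod W v"
  using word_closed by auto

lemma wprod_rev: "set ws \<subseteq> S \<Longrightarrow> wprod W (rev ws) = inv (wprod W ws)"
  by (induct ws) (auto simp: inv_mult_group)

lemma words_generate:
  assumes "K \<subseteq> S" "w \<in> generate W K"
  shows "\<exists>ws. set ws \<subseteq> K \<and> wprod W ws = w"
  using assms(2)
proof induct
  case one
  then show ?case by (rule exI [of _ "[]"]) simp
next
  case (incl h)
  then show ?case using assms by (intro exI [of _ "[h]"]) auto
next
  case (inv h)
  then show ?case using assms by (intro exI [of _ "[h]"]) (auto simp: subset_iff)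
next
  case (eng h1 h2)
  then obtain u v where "set u \<subseteq> K" "wprod W u = h1" "set v \<subseteq> K" "wprod W v = h2"
    by auto
  then show ?case using assms by (intro exI [of _ "u @ v"]) auto
qed

lemma wprod_generate: "\<lbrakk>K \<subseteq> S; set ws \<subseteq> K\<rbrakk> \<Longrightarrow> wprod W ws \<in> generate W K"
  by (induct ws) (auto intro: generate.one generate.eng generate.incl)

lemma word_exists: "w \<in> carrier W \<Longrightarrow> \<exists>ws. set ws \<subseteq> S \<and> wprod W ws = w"
  using words_generate [of S w] coxeter by (simp add: coxeter_system_def)

lemma wprod_cox_eq: "\<lbrakk>set ws \<subseteq> S; wprod W ws = \<one>\<rbrakk> \<Longrightarrow> cox_eq W S ws []"
  using coxeter by (simp add: coxeter_system_def)

lemma reduced_word_exists: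
  assumes "w \<in> carrier W"
  shows "\<exists>ws. set ws \<subseteq> S \<and> length ws = len w \<and> wprod W ws = w"
  unfolding lenS_def
  by (rule LeastI_ex) (use word_exists [OF assms] in blast)

lemma len_le: "set ws \<subseteq> S \<Longrightarrow> len (wprod W ws) \<le> length ws"
  unfolding lenS_def by (rule Least_le) auto

lemma len_one [simp]: "len \<one> = 0"
  using len_le [of "[]"] by simp

lemma len_eq_0: "w \<in> carrier W \<Longrightarrow> len w = 0 \<longleftrightarrow> w = \<one>"
  using reduced_word_exists by fastforce

lemma len_gen [simp]: "s \<in> S \<Longrightarrow> len s = 1"
  using len_le [of "[s]"] len_eq_0 [of s] gen_ne_one [of s] by auto

lemma len_inv [simp]:
  assumes "w \<in> carrier W" shows "len (inv w) = len w"
proof -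
  have *: "len (inv w) \<le> len w" if w: "w \<in> carrier W" for w
  proof -
    obtain ws where "set ws \<subseteq> S" "length ws = len w" "wprod W ws = w"
      using reduced_word_exists [OF w] by blast
    then show ?thesis using len_le [of "rev ws"] by (simp add: wprod_rev)
  qed
  show ?thesis using * [OF assms] * [of "inv w"] assms by simp
qed

lemma len_mult_le:
  assumes "u \<in> carrier W" "v \<in> carrier W" shows "len (u \<otimes> v) \<le> len u + len v"
proof -
  obtain x y where "set x \<subseteq> S" "length x = len u" "wprod W x = u"
     "set y \<subseteq> S" "length y = len v" "wprod W y = v"
    using reduced_word_exists assms by meson
  then show ?thesis using len_le [of "x @ y"] by simp
qed

lemma pow_swap:
  assumes "s \<in> S" "t \<in> S"
  shows "s \<otimes> (t \<otimes> s) [^] (n::nat) = (s \<otimes> t) [^] n \<otimes> s"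
proof (induct n)
  case (Suc n)
  have "s \<otimes> (t \<otimes> s) [^] Suc n = (s \<otimes> (t \<otimes> s) [^] n) \<otimes> (t \<otimes> s)"
    using assms by (simp add: m_assoc)
  also have "\<dots> = (s \<otimes> t) [^] Suc n \<otimes> s"
    using assms by (simp add: Suc m_assoc)
  finally show ?case .
qed (use assms in simp)

section \<open>Inversion sequences and their parity\<close>

lemma refl_list_closed: "set ws \<subseteq> S \<Longrightarrow> set (refl_list W ws) \<subseteq> carrier W"
  by (induct ws) auto

lemma refl_list_append:
  assumes "set u \<subseteq> S" "set v \<subseteq> S"
  shows "refl_list W (u @ v) =
    refl_list W u @ map (\<lambda>t. wprod W u \<otimes> t \<otimes> inv (wprod W u)) (refl_list W v)"
  using assms
proof (induct u)
  case Nil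
  then show ?case using refl_list_closed [of v] by (auto simp: map_idI subset_iff)
next
  case (Cons a u)
  then show ?case using refl_list_closed [of v]
    by (auto simp: m_assoc inv_mult_group subset_iff)
qed

lemma refl_list_altw:
  "\<lbrakk>s \<in> S; t \<in> S\<rbrakk> \<Longrightarrow> refl_list W (altw s t n) = map (\<lambda>i. (s \<otimes> t) [^] i \<otimes> s) [0..<n]"
proof (induct s t n rule: altw.induct)
  case (2 s t n)
  have *: "s \<otimes> ((t \<otimes> s) [^] i \<otimes> t) \<otimes> s = (s \<otimes> t) [^] Suc i \<otimes> s" for i
  proof -
    have "s \<otimes> ((t \<otimes> s) [^] i \<otimes> t) \<otimes> s = (s \<otimes> (t \<otimes> s) [^] i) \<otimes> t \<otimes> s"
      using 2 by (simp add: m_assoc)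
    then show ?thesis using 2 by (simp add: pow_swap m_assoc)
  qed
  have "[0..<Suc n] = 0 # map Suc [0..<n]"
    by (simp add: map_Suc_upt upt_conv_Cons)
  then show ?case using 2 by (simp add: * o_def)
qed simp

text \<open>Finiteness of the group supplies a positive exponent, so the \<open>LEAST\<close> in
  \<open>gord\<close> is attained.\<close>

lemma gord_props:
  assumes "g \<in> carrier W" shows "0 < gord W g \<and> g [^] gord W g = \<one>"
  unfolding gord_def
proof (rule LeastI_ex)
  show "\<exists>n::nat. 0 < n \<and> g [^] n = \<one>"
    using finite_carrier assms ord_ge_1 [of g] pow_ord_eq_1 [of g] by (intro exI [of _ "ord g"]) auto
qed

text \<open>Multiplicities change under the Coxeter relations, parities do not. This is the sign in
  the classical action of a Coxeter group on signed reflections.\<close>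

abbreviation rpar where "rpar ws t \<equiv> odd (count_list (refl_list W ws) t)"

lemma rpar_append:
  assumes "set u \<subseteq> S" "set v \<subseteq> S" "t \<in> carrier W"
  shows "rpar (u @ v) t \<longleftrightarrow> rpar u t \<noteq> rpar v (inv (wprod W u) \<otimes> t \<otimes> wprod W u)"
proof -
  let ?g = "wprod W u"
  have "count_list (map (\<lambda>t. ?g \<otimes> t \<otimes> inv ?g) (refl_list W v)) t =
      count_list (refl_list W v) (inv ?g \<otimes> t \<otimes> ?g)"
    by (rule count_list_map_inverse [where A = "carrier W"])
      (use assms refl_list_closed in \<open>auto simp: m_assoc\<close>)
  then show ?thesis
    using assms by (simp add: refl_list_append)
qed

text \<open>The inversion sequence is \<open>(st)^i s\<close> for \<open>i < 2m\<close>; since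
  \<open>(st)^m = 1\<close> it runs through the same \<open>m\<close> entries twice.\<close>

lemma rpar_braid:
  assumes "s \<in> S" "t \<in> S"
  shows "\<not> rpar (altw s t (2 * gord W (s \<otimes> t))) r"
proof -
  define m where "m = gord W (s \<otimes> t)"
  have m: "(s \<otimes> t) [^] m = \<one>"
    using gord_props [of "s \<otimes> t"] assms by (simp add: m_def)
  have "[0..<2 * m] = [0..<m] @ map (\<lambda>i. i + m) [0..<m]"
    by (simp add: map_add_upt upt_add_eq_append [symmetric] mult_2)
  moreover have "(s \<otimes> t) [^] (i + m) = (s \<otimes> t) [^] i" for i
    using m assms by (simp add: nat_pow_mult [symmetric])
  ultimately have "refl_list W (altw s t (2 * m)) =
     map (\<lambda>i. (s \<otimes> t) [^] i \<otimes> s) [0..<m] @ map (\<lambda>i. (s \<otimes> t) [^] i \<otimes> s) [0..<m]"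
    by (simp add: refl_list_altw [OF assms] o_def)
  then show ?thesis by (simp add: m_def)
qed

lemma wprod_altw_even:
  "\<lbrakk>s \<in> S; t \<in> S\<rbrakk> \<Longrightarrow> wprod W (altw s t (2 * n)) = (s \<otimes> t) [^] n"
proof (induct n)
  case (Suc n)
  have "altw s t (2 * Suc n) = s # t # altw s t (2 * n)" by simp
  then have "wprod W (altw s t (2 * Suc n)) = (s \<otimes> t) \<otimes> (s \<otimes> t) [^] n"
    using Suc by (simp add: m_assoc)
  then show ?case
    using Suc by (simp add: nat_pow_Suc2 [symmetric])
qed simp

lemma set_altw_S: "\<lbrakk>s \<in> S; t \<in> S\<rbrakk> \<Longrightarrow> set (altw s t n) \<subseteq> S"
  using set_altw [of s t n] by auto

text \<open>\<open>cox_refl\<close> admits words with letters outside \<open>S\<close>, so the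
  induction has to carry membership in \<open>S\<close> together with product and parity.\<close>

lemma cox_eq_rpar:
  assumes "cox_eq W S u v"
  shows "(set u \<subseteq> S \<longleftrightarrow> set v \<subseteq> S) \<and>
    (set u \<subseteq> S \<longrightarrow> wprod W u = wprod W v \<and> (\<forall>r\<in>carrier W. rpar u r \<longleftrightarrow> rpar v r))"
  using assms
proof induct
  case (cox_sq s u v)
  have *: "rpar ([s, s] @ v) x = rpar v x" if "x \<in> carrier W" for x
    using cox_sq that by (subst rpar_append) (auto simp: m_assoc)
  have "rpar (u @ [s, s] @ v) r = rpar (u @ v) r" if "r \<in> carrier W" for r
    using cox_sq that * by (simp add: rpar_append del: append_Cons append_assoc)
  then show ?case using cox_sq by simp
next
  case (cox_braid s t u v)
  let ?b = "altw s t (2 * gord W (s \<otimes> t))"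
  have b: "set ?b \<subseteq> S" "wprod W ?b = \<one>"
    using cox_braid gord_props [of "s \<otimes> t"] set_altw_S by (auto simp: wprod_altw_even)
  moreover have "rpar (u @ ?b @ v) r = rpar (u @ v) r" if "r \<in> carrier W" for r
  proof -
    have "rpar (?b @ v) x = rpar v x" if "x \<in> carrier W" for x
      using b cox_braid that rpar_braid by (subst rpar_append) auto
    then show ?thesis
      using b cox_braid that by (simp add: rpar_append del: append_assoc)
  qed
  ultimately show ?case using cox_braid by simp
qed auto

text \<open>The place where completeness of the Coxeter relations enters: \<open>u\<close> and
  \<open>v\<close>, each followed by \<open>rev v\<close>, have product one, hence reduce to the
  empty word and have even parity. Splitting off \<open>rev v\<close> leaves equal parities.\<close>

lemma rpar_wprod:
  assumes "set u \<subseteq> S" "set v \<subseteq> S" "wprod W u = wprod W v" "r \<in> carrier W"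
  shows "rpar u r \<longleftrightarrow> rpar v r"
proof -
  have *: "rpar x r \<longleftrightarrow> rpar (rev v) (inv (wprod W x) \<otimes> r \<otimes> wprod W x)"
    if x: "set x \<subseteq> S" "wprod W x = wprod W v" for x
  proof -
    have "cox_eq W S (x @ rev v) []"
      using x assms by (intro wprod_cox_eq) (auto simp: wprod_rev)
    from cox_eq_rpar [OF this] have "\<not> rpar (x @ rev v) r"
      using assms x by auto
    then show ?thesis using x assms by (simp add: rpar_append)
  qed
  show ?thesis using * [of u] * [of v] assms by simp
qed

lemma reflI: "\<lbrakk>w \<in> carrier W; s \<in> S\<rbrakk> \<Longrightarrow> w \<otimes> s \<otimes> inv w \<in> refls"
  by (auto simp: reflsW_def)

lemma reflE:
  assumes "t \<in> refls"
  obtains w s where "w \<in> carrier W" "s \<in> S" "t = w \<otimes> s \<otimes> inv w"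
  using assms by (auto simp: reflsW_def)

lemma refl_sq [simp]: "t \<in> refls \<Longrightarrow> t \<otimes> t = \<one>"
  by (auto simp: reflsW_def m_assoc)

lemma refl_closed [simp]: "t \<in> refls \<Longrightarrow> t \<in> carrier W"
  by (auto simp: reflsW_def)

lemma refl_cancel [simp]: "t \<in> refls \<Longrightarrow> x \<in> carrier W \<Longrightarrow> t \<otimes> (t \<otimes> x) = x"
  by (simp add: m_assoc [symmetric])

lemma refl_inv [simp]: "t \<in> refls \<Longrightarrow> inv t = t"
  by (simp add: inv_equality)

lemma gen_refl [simp]: "s \<in> S \<Longrightarrow> s \<in> refls"
  unfolding reflsW_def by (rule CollectI, rule exI [of _ \<one>], rule exI [of _ s]) auto

lemma refl_conj:
  assumes "t \<in> refls" "g \<in> carrier W" shows "g \<otimes> t \<otimes> inv g \<in> refls"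
proof -
  obtain w s where "w \<in> carrier W" "s \<in> S" "t = w \<otimes> s \<otimes> inv w"
    using assms(1) by (rule reflE)
  then show ?thesis using assms reflI [of "g \<otimes> w" s] by (simp add: m_assoc inv_mult_group)
qed

lemma refl_conj': "\<lbrakk>t \<in> refls; g \<in> carrier W\<rbrakk> \<Longrightarrow> inv g \<otimes> t \<otimes> g \<in> refls"
  using refl_conj [of t "inv g"] by simp

text \<open>The shorter word uses only letters of \<open>ws\<close>; this is what makes deletion
  available inside parabolic subgroups.\<close>

lemma deletion:
  assumes "set ws \<subseteq> S" "t \<in> set (refl_list W ws)"
  shows "\<exists>us. set us \<subseteq> set ws \<and> length us < length ws \<and> wprod W us = t \<otimes> wprod W ws"
  using assms
proof (induct ws arbitrary: t)
  case (Cons s ws)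
  show ?case
  proof (cases "t = s")
    case True
    then show ?thesis using Cons by (intro exI [of _ ws]) auto
  next
    case False
    then obtain r where r: "r \<in> set (refl_list W ws)" "t = s \<otimes> r \<otimes> s"
      using Cons by auto
    then obtain us where us: "set us \<subseteq> set ws" "length us < length ws"
        "wprod W us = r \<otimes> wprod W ws"
      using Cons.hyps [OF _ r(1)] Cons.prems by (metis insert_subset list.simps(15))
    have "r \<in> carrier W" using r refl_list_closed [of ws] Cons by auto
    then show ?thesis using us r Cons
      by (intro exI [of _ "s # us"]) (auto simp: m_assoc)
  qed
qed simp

lemma rpar_deletion:
  assumes "set ws \<subseteq> S" "rpar ws t"
  shows "t \<in> set (refl_list W ws)"
  using assms by (metis count_notin even_zero)

text \<open>A palindrome \<open>us, s, rev us\<close> represents \<open>t\<close>. Without its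
  middle letter it represents one and has even parity; the middle letter flips the parity at
  \<open>t\<close>.\<close>

lemma rpar_refl:
  assumes "t \<in> refls" "set ws \<subseteq> S" "wprod W ws = t"
  shows "rpar ws t"
proof -
  obtain u s where u: "u \<in> carrier W" "s \<in> S" "t = u \<otimes> s \<otimes> inv u"
    using assms by (auto elim: reflE)
  obtain us where us: "set us \<subseteq> S" "wprod W us = u"
    using word_exists u by blast
  have "\<not> rpar (us @ rev us) t"
    using rpar_wprod [of "us @ rev us" "[]" t] us u(1) assms by (simp add: wprod_rev)
  moreover have "rpar (us @ [s] @ rev us) t \<longleftrightarrow> \<not> rpar (us @ rev us) t"
  proof -
    have "inv u \<otimes> t \<otimes> u = s" using u by (simp add: m_assoc)
    then show ?thesis using u us assms
      by (simp add: rpar_append wprod_rev m_assoc del: append_Cons)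
  qed
  moreover have "rpar ws t = rpar (us @ [s] @ rev us) t"
    using u us assms by (intro rpar_wprod) (auto simp: wprod_rev m_assoc)
  ultimately show ?thesis by simp
qed

text \<open>An odd entry can be deleted from a reduced word. Conversely, if \<open>t\<close> is even
  for \<open>w\<close> then it is odd for \<open>t w\<close>, because it is odd for \<open>t\<close>
  itself; so \<open>w\<close> is shorter than \<open>t w\<close>.\<close>

lemma linv_rpar:
  assumes "t \<in> refls" "set ws \<subseteq> S"
  shows "linv (wprod W ws) t \<longleftrightarrow> rpar ws t"
proof -
  have *: "len (t \<otimes> wprod W ws) < len (wprod W ws)"
    if "rpar ws t" "set ws \<subseteq> S" for ws
  proof -
    obtain vs where vs: "set vs \<subseteq> S" "length vs = len (wprod W ws)" "wprod W vs = wprod W ws"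
      using reduced_word_exists [of "wprod W ws"] \<open>set ws \<subseteq> S\<close> by auto
    then have "rpar vs t" using rpar_wprod [of vs ws t] that assms by simp
    then obtain us where "set us \<subseteq> set vs" "length us < length vs" "wprod W us = t \<otimes> wprod W vs"
      using deletion [OF vs(1)] rpar_deletion vs by blast
    then show ?thesis using vs len_le [of us] by (metis order_trans order_le_less_trans)
  qed
  show ?thesis
  proof
    assume l: "linv (wprod W ws) t"
    obtain ts where ts: "set ts \<subseteq> S" "wprod W ts = t"
      using word_exists [of t] assms by auto
    show "rpar ws t"
    proof (rule ccontr)
      assume "\<not> rpar ws t"
      moreover have "rpar ts t" using rpar_refl [OF assms(1) ts] .
      ultimately have "rpar (ts @ ws) t"
        using ts assms by (simp add: rpar_append m_assoc)
      then have "len (t \<otimes> (t \<otimes> wprod W ws)) < len (t \<otimes> wprod W ws)"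
        using * [of "ts @ ws"] ts assms by simp
      then show False using l assms by simp
    qed
  next
    assume "rpar ws t"
    then show "linv (wprod W ws) t" using * assms(2) by blast
  qed
qed

text \<open>With \<open>N(w)\<close> the set of left inversions, \<open>N(uv)\<close> is the
  symmetric difference of \<open>N(u)\<close> and \<open>u N(v) u^-1\<close>. Most length
  comparisons below are instances of this.\<close>

lemma linv_mult:
  assumes "t \<in> refls" "u \<in> carrier W" "v \<in> carrier W"
  shows "linv (u \<otimes> v) t \<longleftrightarrow> linv u t \<noteq> linv v (inv u \<otimes> t \<otimes> u)"
proof -
  obtain x y where x: "set x \<subseteq> S" "wprod W x = u" "set y \<subseteq> S" "wprod W y = v"
    using word_exists [OF assms(2)] word_exists [OF assms(3)] by blast
  have "linv (u \<otimes> v) t \<longleftrightarrow> rpar (x @ y) t"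
    using linv_rpar [of t "x @ y"] x assms by simp
  moreover have "linv v (inv u \<otimes> t \<otimes> u) \<longleftrightarrow> rpar y (inv u \<otimes> t \<otimes> u)"
    using linv_rpar [of "inv u \<otimes> t \<otimes> u" y] x assms refl_conj' by simp
  ultimately show ?thesis
    using x assms linv_rpar [of t x] by (simp add: rpar_append)
qed

lemma linv_gen:
  assumes "t \<in> refls" "s \<in> S" shows "linv s t \<longleftrightarrow> t = s"
  using linv_rpar [of t "[s]"] assms by auto

lemma len_refl_neq:
  assumes "t \<in> refls" "w \<in> carrier W" shows "len (t \<otimes> w) \<noteq> len w"
proof -
  obtain ts where ts: "set ts \<subseteq> S" "wprod W ts = t"
    using word_exists [of t] assms by auto
  then have "linv t t"
    using rpar_refl [OF assms(1) ts] linv_rpar [OF assms(1) ts(1)] by simp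
  then have "linv (t \<otimes> w) t \<longleftrightarrow> \<not> linv w t"
    using linv_mult [of t t w] assms by (simp add: m_assoc)
  then show ?thesis using assms by auto
qed

lemma len_gen_mult:
  assumes "s \<in> S" "w \<in> carrier W"
  shows "len (s \<otimes> w) = (if linv w s then len w - 1 else len w + 1)"
    and "linv w s \<Longrightarrow> 0 < len w"
proof -
  have "len (s \<otimes> w) \<le> 1 + len w" "len w \<le> 1 + len (s \<otimes> w)"
    using len_mult_le [of s w] len_mult_le [of s "s \<otimes> w"] assms by auto
  then show "len (s \<otimes> w) = (if linv w s then len w - 1 else len w + 1)"
    using len_refl_neq [of s w] assms by auto
qed auto

text \<open>The cocycle identity for \<open>w\<close> times its inverse, as one has no
  inversions.\<close>

lemma linv_inv:
  assumes "t \<in> refls" "w \<in> carrier W"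
  shows "linv (inv w) (inv w \<otimes> t \<otimes> w) \<longleftrightarrow> linv w t"
  using linv_mult [of t w "inv w"] assms by simp

end

section \<open>Parabolic subgroups and reduced words\<close>

context coxeter
begin

lemma WJ_word: "\<lbrakk>K \<subseteq> S; v \<in> WJ W K\<rbrakk> \<Longrightarrow> \<exists>ws. set ws \<subseteq> K \<and> wprod W ws = v"
  unfolding WJ_def by (rule words_generate)

lemma wprod_WJ: "\<lbrakk>K \<subseteq> S; set ws \<subseteq> K\<rbrakk> \<Longrightarrow> wprod W ws \<in> WJ W K"
  unfolding WJ_def by (rule wprod_generate)

lemma WJ_subgroup: "K \<subseteq> S \<Longrightarrow> subgroup (WJ W K) W"
  unfolding WJ_def by (rule generate_is_subgroup) auto

lemma WJ_closed: "\<lbrakk>K \<subseteq> S; v \<in> WJ W K\<rbrakk> \<Longrightarrow> v \<in> carrier W"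
  using subgroup.subset [OF WJ_subgroup] by blast

lemma WJ_mult: "\<lbrakk>K \<subseteq> S; u \<in> WJ W K; v \<in> WJ W K\<rbrakk> \<Longrightarrow> u \<otimes> v \<in> WJ W K"
  using subgroup.m_closed [OF WJ_subgroup] by blast

lemma WJ_inv: "\<lbrakk>K \<subseteq> S; v \<in> WJ W K\<rbrakk> \<Longrightarrow> inv v \<in> WJ W K"
  using subgroup.m_inv_closed [OF WJ_subgroup] by blast

lemma WJ_one: "\<one> \<in> WJ W K"
  unfolding WJ_def by (rule generate.one)

lemma WJ_gen: "s \<in> K \<Longrightarrow> s \<in> WJ W K"
  unfolding WJ_def by (rule generate.incl)

lemma WJ_mono: "K \<subseteq> L \<Longrightarrow> WJ W K \<subseteq> WJ W L"
  unfolding WJ_def by (rule mono_generate)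

lemma reflsJ_I: "\<lbrakk>w \<in> WJ W K; s \<in> K\<rbrakk> \<Longrightarrow> w \<otimes> s \<otimes> inv w \<in> reflsJ W K"
  by (auto simp: reflsJ_def)

lemma reflsJ_E:
  assumes "t \<in> reflsJ W K"
  obtains w s where "w \<in> WJ W K" "s \<in> K" "t = w \<otimes> s \<otimes> inv w"
  using assms by (auto simp: reflsJ_def)

lemma reflsJ_refls: "\<lbrakk>K \<subseteq> S; t \<in> reflsJ W K\<rbrakk> \<Longrightarrow> t \<in> refls"
  by (erule reflsJ_E) (metis WJ_closed reflI subsetD)

lemma reflsJ_WJ: "\<lbrakk>K \<subseteq> S; t \<in> reflsJ W K\<rbrakk> \<Longrightarrow> t \<in> WJ W K"
  by (erule reflsJ_E) (simp add: WJ_mult WJ_inv WJ_gen)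

lemma reflsJ_gen: "\<lbrakk>K \<subseteq> S; s \<in> K\<rbrakk> \<Longrightarrow> s \<in> reflsJ W K"
  using reflsJ_I [OF WJ_one, of s K] by (simp add: subset_iff)

lemma reflsJ_conj:
  assumes K: "K \<subseteq> S" and t: "t \<in> reflsJ W K" and g: "g \<in> WJ W K"
  shows "g \<otimes> t \<otimes> inv g \<in> reflsJ W K"
proof -
  obtain w s where w: "w \<in> WJ W K" "s \<in> K" "t = w \<otimes> s \<otimes> inv w"
    using t by (rule reflsJ_E)
  have "g \<in> carrier W" "w \<in> carrier W" "s \<in> carrier W"
    using w g K WJ_closed by auto
  then have "g \<otimes> t \<otimes> inv g = (g \<otimes> w) \<otimes> s \<otimes> inv (g \<otimes> w)"
    using w by (simp add: m_assoc inv_mult_group)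
  then show ?thesis using reflsJ_I [of "g \<otimes> w" K s] w g K WJ_mult by simp
qed

lemma reflsJ_conj_gen:
  "\<lbrakk>K \<subseteq> S; t \<in> reflsJ W K; s \<in> K\<rbrakk> \<Longrightarrow> s \<otimes> t \<otimes> s \<in> reflsJ W K"
  using reflsJ_conj [of K t s] by (simp add: WJ_gen subset_iff)

lemma refl_list_reflsJ:
  assumes "K \<subseteq> S" "set ws \<subseteq> K" shows "set (refl_list W ws) \<subseteq> reflsJ W K"
  using assms(2)
proof (induct ws)
  case (Cons a ws)
  then show ?case using assms(1) reflsJ_gen reflsJ_conj_gen by auto
qed simp

lemma linv_reflsJ:
  assumes K: "K \<subseteq> S" and v: "v \<in> WJ W K" and t: "t \<in> refls" "linv v t"
  shows "t \<in> reflsJ W K"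
proof -
  obtain ws where ws: "set ws \<subseteq> K" "wprod W ws = v"
    using WJ_word [OF K v] by blast
  then have wsS: "set ws \<subseteq> S" using K by blast
  then have "rpar ws t" using linv_rpar [OF t(1) wsS] t ws by simp
  then show ?thesis
    using rpar_deletion [OF wsS] refl_list_reflsJ [OF K ws(1)] by blast
qed

text \<open>Take a shortest word over \<open>K\<close>. If it were not reduced, some letter would be
  a descent of its tail, and deletion would give a shorter word still over \<open>K\<close>. Hence
  the lengths with respect to \<open>K\<close> and \<open>S\<close> agree.\<close>

lemma reduced_WJ_word:
  assumes K: "K \<subseteq> S" and v: "v \<in> WJ W K"
  shows "\<exists>ws. set ws \<subseteq> K \<and> length ws = len v \<and> wprod W ws = v"
proof -
  obtain ws where ws: "set ws \<subseteq> K" "wprod W ws = v"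
      "\<And>us. \<lbrakk>set us \<subseteq> K; wprod W us = v\<rbrakk> \<Longrightarrow> length ws \<le> length us"
  proof -
    obtain us where "set us \<subseteq> K \<and> wprod W us = v" using WJ_word [OF K v] by blast
    from ex_has_least_nat [of "\<lambda>ws. set ws \<subseteq> K \<and> wprod W ws = v", OF this, of length]
    show ?thesis using that by blast
  qed
  have "length ws = len (wprod W ws)"
    if "set ws \<subseteq> K" "\<And>us. \<lbrakk>set us \<subseteq> K; wprod W us = wprod W ws\<rbrakk> \<Longrightarrow> length ws \<le> length us" for ws
    using that
  proof (induct ws)
    case (Cons s ws)
    have s: "s \<in> S" "set ws \<subseteq> S" "set ws \<subseteq> K" "s \<in> K" using Cons.prems K by auto
    have IH: "length ws = len (wprod W ws)"
    proof (rule Cons.hyps)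
      show "set ws \<subseteq> K" by (rule s)
      show "length ws \<le> length us" if "set us \<subseteq> K" "wprod W us = wprod W ws" for us
        using Cons.prems(2) [of "s # us"] that s by simp
    qed
    show ?case
    proof (cases "linv (wprod W ws) s")
      case True
      then have "s \<in> set (refl_list W ws)"
        using linv_rpar [of s ws] rpar_deletion s by simp
      then obtain us where us: "set us \<subseteq> set ws" "length us < length ws"
          "wprod W us = s \<otimes> wprod W ws"
        using deletion [OF s(2)] by blast
      then have "length (s # ws) \<le> length us"
        using Cons.prems(2) [of us] s by auto
      then show ?thesis using us by simp
    next
      case False
      then show ?thesis using IH len_gen_mult(1) [of s "wprod W ws"] s by simp
    qed
  qed simp
  then show ?thesis using ws by metis
qed

lemma lenS_WJ:
  assumes K: "K \<subseteq> S" and v: "v \<in> WJ W K"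
  shows "lenS W K v = len v"
  unfolding lenS_def [of W K]
proof (rule Least_equality)
  show "\<exists>ws. set ws \<subseteq> K \<and> length ws = len v \<and> wprod W ws = v"
    using reduced_WJ_word [OF K v] .
  show "len v \<le> n" if "\<exists>ws. set ws \<subseteq> K \<and> length ws = n \<and> wprod W ws = v" for n
    using that K len_le by (metis order_trans)
qed

lemma descent_exists:
  assumes K: "K \<subseteq> S" and v: "v \<in> WJ W K" "v \<noteq> \<one>"
  shows "\<exists>s\<in>K. linv v s"
proof -
  obtain ws where ws: "set ws \<subseteq> K" "length ws = len v" "wprod W ws = v"
    using reduced_WJ_word [OF K v(1)] by blast
  then obtain s us where "ws = s # us" using v(2) by (cases ws) auto
  then have s: "s \<in> K" "s \<in> S" "set us \<subseteq> S" "v = s \<otimes> wprod W us" "length us < len v"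
    using ws K by auto
  then have "s \<otimes> v = wprod W us" by simp
  then have "linv v s" using len_le [OF s(3)] s(5) by simp
  then show ?thesis using s by blast
qed

section \<open>Minimal representatives of the cosets \<open>W_K x\<close>\<close>

definition left_min :: "'a set \<Rightarrow> 'a \<Rightarrow> bool" where
  "left_min K x \<longleftrightarrow> x \<in> carrier W \<and> (\<forall>s\<in>K. \<not> linv x s)"

text \<open>Conjugation by \<open>v\<close> permutes the reflections of \<open>W_K\<close>, so the
  contribution of \<open>x\<close> to the cocycle vanishes.\<close>

lemma linv_WJ_mult:
  assumes "K \<subseteq> S" "v \<in> WJ W K" "x \<in> carrier W" "\<forall>t\<in>reflsJ W K. \<not> linv x t" "t \<in> reflsJ W K"
  shows "linv (v \<otimes> x) t \<longleftrightarrow> linv v t"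
proof -
  have "inv v \<otimes> t \<otimes> v \<in> reflsJ W K"
    using reflsJ_conj [of K t "inv v"] assms WJ_inv WJ_closed by auto
  then show ?thesis
    using linv_mult [of t v x] assms reflsJ_refls WJ_closed by auto
qed

lemma left_min_decomp:
  assumes K: "K \<subseteq> S" and x: "x \<in> carrier W"
  shows "\<exists>v\<in>WJ W K. \<exists>x0\<in>carrier W. x = v \<otimes> x0 \<and> (\<forall>t\<in>reflsJ W K. \<not> linv x0 t)"
proof -
  obtain v where v: "v \<in> WJ W K" "\<And>u. u \<in> WJ W K \<Longrightarrow> len (v \<otimes> x) \<le> len (u \<otimes> x)"
    using ex_has_least_nat [of "\<lambda>v. v \<in> WJ W K", OF WJ_one, of "\<lambda>v. len (v \<otimes> x)"] by blast
  have vc: "v \<in> carrier W" using v K WJ_closed by blast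
  have "\<not> linv (v \<otimes> x) t" if t: "t \<in> reflsJ W K" for t
  proof -
    have "t \<otimes> v \<in> WJ W K" using t v K WJ_mult reflsJ_WJ by blast
    then have "len (v \<otimes> x) \<le> len (t \<otimes> v \<otimes> x)" by (rule v)
    moreover have "t \<in> carrier W" using t K reflsJ_refls by simp
    ultimately show ?thesis using vc x by (simp add: m_assoc)
  qed
  moreover have "x = inv v \<otimes> (v \<otimes> x)" using vc x by simp
  ultimately show ?thesis using v K WJ_inv vc x by (meson m_closed)
qed

text \<open>Write \<open>x = v x0\<close> with \<open>x0\<close> free of inversions in
  \<open>W_K\<close>. The descents of \<open>v\<close> in \<open>K\<close> are those of
  \<open>x\<close>; there are none, so \<open>v\<close> is one.\<close>

lemma left_min_reflsJ:
  assumes K: "K \<subseteq> S" and x: "left_min K x" and t: "t \<in> reflsJ W K"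
  shows "\<not> linv x t"
proof -
  obtain v x0 where v: "v \<in> WJ W K" "x0 \<in> carrier W" "x = v \<otimes> x0" "\<forall>t\<in>reflsJ W K. \<not> linv x0 t"
    using left_min_decomp [OF K] x unfolding left_min_def by blast
  have "\<not> linv v s" if "s \<in> K" for s
    using linv_WJ_mult [OF K v(1,2,4) reflsJ_gen [OF K that]] v(3) x that
    by (simp add: left_min_def)
  then have "v = \<one>" using descent_exists [OF K v(1)] by blast
  then show ?thesis using v t by simp
qed

lemma linv_left_min_mult:
  assumes "K \<subseteq> S" "v \<in> WJ W K" "left_min K x" "t \<in> reflsJ W K"
  shows "linv (v \<otimes> x) t \<longleftrightarrow> linv v t"
  using linv_WJ_mult [OF assms(1,2) _ _ assms(4), of x] left_min_reflsJ [OF assms(1,3)] assms(3)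
  by (simp add: left_min_def)

text \<open>Each letter of a reduced word of \<open>v\<close> remains an ascent when
  \<open>x\<close> is appended on the right.\<close>

lemma len_left_min_mult:
  assumes K: "K \<subseteq> S" and v: "v \<in> WJ W K" and x: "left_min K x"
  shows "len (v \<otimes> x) = len v + len x"
proof -
  have xc: "x \<in> carrier W" using x by (simp add: left_min_def)
  have "len (wprod W ws \<otimes> x) = len (wprod W ws) + len x"
    if "set ws \<subseteq> K" "length ws = len (wprod W ws)" for ws
    using that
  proof (induct ws)
    case (Cons s ws)
    have s: "s \<in> S" "s \<in> K" "set ws \<subseteq> S" "set ws \<subseteq> K" using Cons.prems K by auto
    let ?w = "wprod W ws"
    have w: "?w \<in> carrier W" "?w \<in> WJ W K" using s K wprod_WJ by auto
    have n: "\<not> linv ?w s" "len ?w = length ws"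
      using Cons.prems(2) len_le [OF s(3)] len_gen_mult(1) [of s ?w] s w by (auto split: if_splits)
    then have "\<not> linv (?w \<otimes> x) s"
      using linv_left_min_mult [OF K w(2) x reflsJ_gen [OF K s(2)]] by simp
    then show ?case
      using n Cons.hyps s w xc len_gen_mult(1) [of s "?w \<otimes> x"] len_gen_mult(1) [of s ?w]
      by (simp add: m_assoc)
  qed (use xc in simp)
  then show ?thesis using reduced_WJ_word [OF K v] by metis
qed

lemma left_min_exists:
  assumes K: "K \<subseteq> S" and x: "x \<in> carrier W"
  obtains v x0 where "v \<in> WJ W K" "left_min K x0" "x = v \<otimes> x0"
  using left_min_decomp [OF K x] reflsJ_gen [OF K] unfolding left_min_def by metis

lemma left_min_unique:
  assumes K: "K \<subseteq> S" and "v \<in> WJ W K" "left_min K x" "u \<in> WJ W K" "left_min K y"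
    "v \<otimes> x = u \<otimes> y"
  shows "v = u" "x = y"
proof -
  have c: "v \<in> carrier W" "u \<in> carrier W" "x \<in> carrier W" "y \<in> carrier W"
    using assms WJ_closed by (auto simp: left_min_def)
  have "x = (inv v \<otimes> u) \<otimes> y"
    using assms(6) c by (metis inv_cancel_left inv_closed m_assoc)
  moreover have uv: "inv v \<otimes> u \<in> WJ W K" using assms WJ_inv WJ_mult by blast
  ultimately have "\<not> linv (inv v \<otimes> u) s" if "s \<in> K" for s
    using linv_left_min_mult [OF K uv assms(5) reflsJ_gen [OF K that]] assms(3) that
    by (simp add: left_min_def)
  then have "inv v \<otimes> u = \<one>" using descent_exists [OF K uv] by blast
  then show "v = u" using c by (metis inv_cancel_right r_one)
  then show "x = y" using assms(6) c by simp
qed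

section \<open>Dihedral subgroups and independence of reduced words\<close>

lemma alternating_word:
  assumes "set ws \<subseteq> {s, t}" "\<And>u v a. ws \<noteq> u @ [a, a] @ v"
  shows "ws = altw s t (length ws) \<or> ws = altw t s (length ws)"
  using assms
proof (induct ws)
  case (Cons a ws)
  have IH: "ws = altw s t (length ws) \<or> ws = altw t s (length ws)"
    using Cons.prems(2) [of "a # _"] Cons.prems(1) by (intro Cons.hyps) auto
  show ?case
  proof (cases ws)
    case (Cons b us)
    then have "a \<noteq> b" using Cons.prems(2) [of "[]" a us] by auto
    then show ?thesis using IH Cons Cons.prems(1) by auto
  qed (use Cons.prems in auto)
qed simp

lemma reduced_no_square:
  assumes "set ws \<subseteq> S" "length ws = len (wprod W ws)"
  shows "ws \<noteq> u @ [a, a] @ v"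
proof
  assume ws: "ws = u @ [a, a] @ v"
  then have s: "set u \<subseteq> S" "set v \<subseteq> S" "a \<in> S" using assms by auto
  then have "wprod W ws = wprod W (u @ v)" using ws by simp
  then have "len (wprod W ws) \<le> length (u @ v)" using len_le [of "u @ v"] s by simp
  then show False using assms(2) ws by simp
qed

lemma reduced_Cons:
  assumes "set (s # ws) \<subseteq> S" "length (s # ws) = len (wprod W (s # ws))"
  shows "length ws = len (wprod W ws)" "\<not> linv (wprod W ws) s"
proof -
  have s: "s \<in> S" "set ws \<subseteq> S" using assms by auto
  show "length ws = len (wprod W ws)" "\<not> linv (wprod W ws) s"
    using assms(2) len_le [OF s(2)] len_gen_mult(1) [of s "wprod W ws"] s by (auto split: if_splits)
qed

lemma reduced_append:
  assumes "set (u @ v) \<subseteq> S" "length (u @ v) = len (wprod W (u @ v))"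
  shows "length u = len (wprod W u)" "length v = len (wprod W v)"
proof -
  have s: "set u \<subseteq> S" "set v \<subseteq> S" using assms by auto
  have "len (wprod W (u @ v)) \<le> len (wprod W u) + len (wprod W v)"
    using len_mult_le [of "wprod W u" "wprod W v"] s by simp
  then show "length u = len (wprod W u)" "length v = len (wprod W v)"
    using len_le [OF s(1)] len_le [OF s(2)] assms(2) by auto
qed

lemma descent_word:
  assumes K: "K \<subseteq> S" and v: "v \<in> WJ W K" and s: "s \<in> K" "linv v s"
  shows "\<exists>ws. set ws \<subseteq> K \<and> wprod W (s # ws) = v \<and> length (s # ws) = len v"
proof -
  have sS: "s \<in> S" and vc: "v \<in> carrier W" using s K v WJ_closed by auto
  have "s \<otimes> v \<in> WJ W K" using K v s WJ_mult WJ_gen by blast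
  then obtain ws where "set ws \<subseteq> K" "length ws = len (s \<otimes> v)" "wprod W ws = s \<otimes> v"
    using reduced_WJ_word [OF K] by blast
  then show ?thesis
    using len_gen_mult [OF sS vc] s(2) sS vc by (intro exI [of _ ws]) auto
qed

text \<open>So the two alternating products of length \<open>n\<close> coincide exactly when
  \<open>(st)^n = 1\<close>.\<close>

lemma wprod_altw_mult_inv:
  "\<lbrakk>s \<in> S; t \<in> S\<rbrakk> \<Longrightarrow> wprod W (altw s t n) \<otimes> inv (wprod W (altw t s n)) = (s \<otimes> t) [^] n"
proof (induct n arbitrary: s t)
  case (Suc n)
  let ?a = "wprod W (altw s t n)" and ?b = "wprod W (altw t s n)"
  have c: "?a \<in> carrier W" "?b \<in> carrier W" using Suc.prems set_altw_S by simp_all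
  have "wprod W (altw s t (Suc n)) \<otimes> inv (wprod W (altw t s (Suc n)))
      = s \<otimes> (?b \<otimes> inv ?a) \<otimes> t"
    using Suc.prems c by (simp add: m_assoc inv_mult_group)
  also have "\<dots> = s \<otimes> (t \<otimes> s) [^] n \<otimes> t"
    using Suc by simp
  also have "\<dots> = (s \<otimes> t) [^] Suc n"
    using Suc.prems by (simp add: pow_swap m_assoc)
  finally show ?case .
qed simp

lemma altw_gord:
  assumes "s \<in> S" "t \<in> S"
  shows "wprod W (altw s t (gord W (s \<otimes> t))) = wprod W (altw t s (gord W (s \<otimes> t)))"
proof -
  let ?a = "wprod W (altw s t (gord W (s \<otimes> t)))" and ?b = "wprod W (altw t s (gord W (s \<otimes> t)))"
  have c: "?a \<in> carrier W" "?b \<in> carrier W" using assms set_altw_S by simp_all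
  have "?a \<otimes> inv ?b = \<one>"
    using wprod_altw_mult_inv [OF assms] gord_props [of "s \<otimes> t"] assms by simp
  then show ?thesis using c by (metis inv_closed inv_equality inv_inv)
qed

text \<open>Reduced words in two letters alternate, and here both letters can come first, so the two
  alternating products of length \<open>n = len v\<close> agree and \<open>m \<le> n\<close>. An
  alternating word of length \<open>m + 1\<close> collapses to length \<open>m - 1\<close> by the
  braid relation, so \<open>n \<le> m\<close>.\<close>

lemma dihedral_longest:
  assumes st: "s \<in> S" "t \<in> S" "s \<noteq> t" and v: "v \<in> WJ W {s, t}" "linv v s" "linv v t"
  shows "len v = gord W (s \<otimes> t)" "v = wprod W (altw s t (gord W (s \<otimes> t)))"
proof -
  let ?m = "gord W (s \<otimes> t)"
  let ?n = "len v"
  have K: "{s, t} \<subseteq> S" using st by simp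
  have key: "v = wprod W (altw a b ?n)" if ab: "{a, b} = {s, t}" "a \<noteq> b" "linv v a" for a b
  proof -
    obtain ws where ws: "set ws \<subseteq> {s, t}" "wprod W (a # ws) = v" "length (a # ws) = len v"
      using descent_word [OF K v(1), of a] ab by blast
    have sub: "set (a # ws) \<subseteq> S" "set (a # ws) \<subseteq> {a, b}" using ws ab K by auto
    have "a # ws = altw a b (length (a # ws)) \<or> a # ws = altw b a (length (a # ws))"
      using reduced_no_square [OF sub(1)] ws by (intro alternating_word [OF sub(2)]) simp
    then have "a # ws = altw a b (length (a # ws))" using ab by auto
    then show ?thesis using ws by metis
  qed
  have a: "v = wprod W (altw s t ?n)" and b: "v = wprod W (altw t s ?n)"
    using key [of s t] key [of t s] v st by (simp_all add: insert_commute)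
  have vc: "v \<in> carrier W" using v K WJ_closed by blast
  have "(s \<otimes> t) [^] ?n = \<one>"
    using wprod_altw_mult_inv [OF st(1,2), of ?n] a b vc by simp
  moreover have "0 < ?n" using v(2) by simp
  ultimately have ge: "?m \<le> ?n"
    unfolding gord_def by (intro Least_le) simp
  have "?n \<le> ?m"
  proof (rule ccontr)
    assume "\<not> ?n \<le> ?m"
    then obtain d where d: "?n = Suc ?m + d" using le_Suc_ex [of "Suc ?m" ?n] by auto
    let ?x = "altw s t (Suc ?m)"
    have sub: "set (altw s t ?n) \<subseteq> S" using set_altw_S st by simp
    obtain y where y: "altw s t ?n = ?x @ y" using d altw_add [of s t "Suc ?m" d] by metis
    have x: "length ?x = len (wprod W ?x)"
    proof (rule reduced_append(1))
      show "set (?x @ y) \<subseteq> S" using sub y by metis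
      show "length (?x @ y) = len (wprod W (?x @ y))"
        unfolding y [symmetric] a [symmetric] by simp
    qed
    obtain k where k: "?m = Suc k" using gord_props [of "s \<otimes> t"] st by (cases ?m) auto
    have "wprod W ?x = s \<otimes> wprod W (altw s t ?m)"
      using altw_gord [OF st(1,2)] by simp
    also have "\<dots> = wprod W (altw t s k)"
      using k st set_altw_S by simp
    finally have "len (wprod W ?x) \<le> k"
      using len_le [of "altw t s k"] st set_altw_S by simp
    then show False using x k by simp
  qed
  then show "len v = gord W (s \<otimes> t)" using ge by simp
  then show "v = wprod W (altw s t (gord W (s \<otimes> t)))" using a by simp
qed

lemma altw_WJ: "\<lbrakk>s \<in> S; t \<in> S\<rbrakk> \<Longrightarrow> wprod W (altw s t n) \<in> WJ W {s, t}"
  using wprod_WJ [of "{s, t}" "altw s t n"] set_altw [of s t n] by simp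

text \<open>If prolonging by \<open>a\<close> failed to lengthen, the shorter alternating product
  would have both generators as descents and therefore length \<open>m\<close> already.\<close>

lemma len_altw:
  assumes "s \<in> S" "t \<in> S" "s \<noteq> t" "n \<le> gord W (s \<otimes> t)"
  shows "len (wprod W (altw s t n)) = n"
proof -
  have "n \<le> gord W (s \<otimes> t) \<Longrightarrow> len (wprod W (altw s t n)) = n \<and> len (wprod W (altw t s n)) = n"
  proof (induct n)
    case (Suc n)
    have *: "len (wprod W (altw a b (Suc n))) = Suc n"
      if ab: "a \<in> S" "b \<in> S" "a \<noteq> b" "{a, b} = {s, t}" "n < gord W (s \<otimes> t)"
        "len (wprod W (altw b a n)) = n" for a b
    proof (rule ccontr)
      let ?w = "wprod W (altw b a n)"
      have w: "?w \<in> carrier W" "?w \<in> WJ W {a, b}"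
        using ab set_altw_S altw_WJ [of b a n] by (simp_all add: insert_commute)
      assume "\<not> ?thesis"
      then have d: "linv ?w a" using len_gen_mult(1) [of a ?w] ab w by (auto split: if_splits)
      then obtain k where k: "n = Suc k" using ab(6) by (cases n) auto
      have "b \<otimes> ?w = wprod W (altw a b k)" using k ab set_altw_S by simp
      then have "linv ?w b" using len_le [of "altw a b k"] ab k set_altw_S by simp
      then have x: "len ?w = gord W (s \<otimes> t)"
        using dihedral_longest(1) [of s t ?w] w(2) d ab assms
        by (metis (full_types) doubleton_eq_iff)
      show False using x ab by simp
    qed
    show ?case using * [of s t] * [of t s] Suc assms by (simp add: insert_commute)
  qed simp
  then show ?thesis using assms by blast
qed

text \<open>Matsumoto's theorem for operators, with braid relations on a stable set
  \<open>V\<close>. If the first letters \<open>s\<close>, \<open>t\<close> differ, both are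
  descents, and the element is \<open>p x\<close> with \<open>p\<close> longest in the dihedral
  group. The two words are linked through the two alternating words of \<open>p\<close>, each
  sharing a first letter with one of them.\<close>

lemma matsumoto:
  fixes T :: "'a \<Rightarrow> 'v \<Rightarrow> 'v"
  assumes K: "K \<subseteq> S"
    and stable: "\<And>s v. \<lbrakk>s \<in> K; v \<in> V\<rbrakk> \<Longrightarrow> T s v \<in> V"
    and braid: "\<And>s t v. \<lbrakk>s \<in> K; t \<in> K; s \<noteq> t; v \<in> V\<rbrakk> \<Longrightarrow>
      foldr T (altw s t (gord W (s \<otimes> t))) v = foldr T (altw t s (gord W (s \<otimes> t))) v"
    and "set us \<subseteq> K" "set ws \<subseteq> K" "wprod W us = wprod W ws"
      "length us = len (wprod W us)" "length ws = len (wprod W ws)" "v \<in> V"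
  shows "foldr T us v = foldr T ws v"
  using assms(4-9)
proof (induct "length us" arbitrary: us ws v)
  case 0
  then show ?case by simp
next
  case (Suc n)
  have stab: "foldr T xs v \<in> V" if "set xs \<subseteq> K" "v \<in> V" for xs v
    using that by (induct xs) (auto intro: stable)
  obtain s us' where us: "us = s # us'" using Suc.hyps(2) by (cases us) auto
  obtain t ws' where ws: "ws = t # ws'" using Suc.hyps(2) Suc.prems(3-5) by (cases ws) auto
  have in_S: "set us \<subseteq> S" "set ws \<subseteq> S" "s \<in> S" "t \<in> S" "set us' \<subseteq> S" "set ws' \<subseteq> S"
    "s \<in> K" "t \<in> K" "set us' \<subseteq> K" "set ws' \<subseteq> K"
    using Suc.prems K us ws by auto
  have same: "foldr T (a # x) v = foldr T (a # y) v"
    if "length x = n" "set (a # x) \<subseteq> K" "set (a # y) \<subseteq> K" "wprod W (a # x) = wprod W (a # y)"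
       "length (a # x) = len (wprod W (a # x))" "length (a # y) = len (wprod W (a # y))" "v \<in> V"
    for a x y v
  proof -
    have aS: "a \<in> S" "set x \<subseteq> S" "set y \<subseteq> S" "set (a # x) \<subseteq> S" "set (a # y) \<subseteq> S"
      using that K by auto
    have "wprod W x = wprod W y" using that(4) aS by simp
    then have "foldr T x v = foldr T y v"
      using Suc.hyps(1) [of x y v] reduced_Cons(1) [OF aS(4) that(5)] reduced_Cons(1) [OF aS(5) that(6)] that
      by simp
    then show ?thesis by simp
  qed
  have n': "length us' = n" using Suc.hyps(2) us by simp
  note P = Suc.prems [unfolded us ws]
  show ?case
  proof (cases "s = t")
    case True
    show ?thesis
      unfolding us ws True [symmetric]
      by (rule same [OF n' P(1) P(2) [folded True] P(3) [folded True] P(4) P(5) [folded True] P(6)])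
  next
    case False
    let ?w = "wprod W us" and ?m = "gord W (s \<otimes> t)"
    let ?L = "{s, t}"
    have L: "?L \<subseteq> S" "?L \<subseteq> K" using in_S by auto
    have wc: "?w \<in> carrier W" and wK: "?w \<in> WJ W K" using in_S Suc.prems wprod_WJ [OF K] by auto
    have ds: "linv ?w s" using us in_S Suc.prems(4) len_le [of us'] by simp
    have "linv (wprod W ws) t" using ws in_S Suc.prems(5) len_le [of ws'] by simp
    then have dt: "linv ?w t" using Suc.prems(3) by simp
    obtain p x where p: "p \<in> WJ W ?L" "left_min ?L x" "?w = p \<otimes> x"
      using left_min_exists [OF L(1) wc] .
    have "linv p s" "linv p t"
      using linv_left_min_mult [OF L(1) p(1,2)] reflsJ_gen [OF L(1)] p(3) ds dt by auto
    then have pm: "len p = ?m" "p = wprod W (altw s t ?m)"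
      using dihedral_longest [OF in_S(3,4) False p(1)] by auto
    have xc: "x \<in> carrier W" "p \<in> carrier W" using p WJ_closed [OF L(1)] by (auto simp: left_min_def)
    have "x = inv p \<otimes> ?w" using p xc by simp
    moreover have "p \<in> WJ W K" using p WJ_mono [OF L(2)] by blast
    ultimately have "x \<in> WJ W K" using wK K WJ_mult WJ_inv by simp
    then obtain xs where xs: "set xs \<subseteq> K" "length xs = len x" "wprod W xs = x"
      using reduced_WJ_word [OF K] by blast
    have xsS: "set xs \<subseteq> S" using xs K by blast
    have lw: "len ?w = ?m + len x" using len_left_min_mult [OF L(1) p(1,2)] p pm by simp
    have aS: "set (altw s t ?m) \<subseteq> S" "set (altw t s ?m) \<subseteq> S" "set (altw s t ?m) \<subseteq> K" "set (altw t s ?m) \<subseteq> K"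
      using set_altw [of s t ?m] set_altw [of t s ?m] in_S by auto
    have w1: "wprod W (altw s t ?m @ xs) = ?w" "wprod W (altw t s ?m @ xs) = ?w"
      using aS xsS xs p pm altw_gord [OF in_S(3,4)] by simp_all
    obtain k where k: "?m = Suc k"
      using gord_props [of "s \<otimes> t"] in_S by (cases ?m) auto
    have "foldr T us v = foldr T (altw s t ?m @ xs) v"
      unfolding us k altw.simps append_Cons
    proof (rule same [OF n' P(1) _ _ P(4) _ P(6)])
      show "set (s # altw t s k @ xs) \<subseteq> K" using aS(3) xs k by simp
      show "wprod W (s # us') = wprod W (s # altw t s k @ xs)"
        using w1(1) us unfolding k by (metis altw.simps(2) append_Cons)
      then show "length (s # altw t s k @ xs) = len (wprod W (s # altw t s k @ xs))"
        using lw us k xs by (metis altw.simps(2) append_Cons length_altw length_append)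
    qed
    also have "\<dots> = foldr T (altw t s ?m @ xs) v"
      using braid [OF in_S(7,8) False, of "foldr T xs v"] stab xs Suc.prems by simp
    also have "\<dots> = foldr T ws v"
      unfolding ws k altw.simps append_Cons
    proof (rule same [OF _ _ P(2) _ _ P(5) P(6)])
      show "set (t # altw s t k @ xs) \<subseteq> K" using aS(4) xs k by simp
      show w: "wprod W (t # altw s t k @ xs) = wprod W (t # ws')"
        using w1(2) P(3) us unfolding k by (metis altw.simps(2) append_Cons)
      show l: "length (t # altw s t k @ xs) = len (wprod W (t # altw s t k @ xs))"
        using lw us w P(3) k xs by (metis altw.simps(2) append_Cons length_altw length_append)
      show "length (altw s t k @ xs) = n"
        using l w P(3,4) n' by (metis length_Cons nat.inject)
    qed
    finally show ?thesis .
  qed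
qed

end

section \<open>Quasiparabolic sets\<close>

text \<open>The axioms of Rains and Vazirani with the conjugation of reflections kept abstract as
  \<open>cj\<close>, so that one lifting argument serves the Bruhat order, with \<open>W\<close>
  acting on itself from the left, and the order on perfect involutions.\<close>

locale qpset =
  fixes X :: "'x set" and R :: "'r set" and K :: "'r set"
    and a :: "'r \<Rightarrow> 'x \<Rightarrow> 'x" and cj :: "'r \<Rightarrow> 'r \<Rightarrow> 'r" and h :: "'x \<Rightarrow> nat"
  assumes KR: "K \<subseteq> R"
    and a_closed: "\<lbrakk>r \<in> R; x \<in> X\<rbrakk> \<Longrightarrow> a r x \<in> X"
    and a_invol: "\<lbrakk>r \<in> R; x \<in> X\<rbrakk> \<Longrightarrow> a r (a r x) = x"
    and cj_closed: "\<lbrakk>s \<in> K; r \<in> R\<rbrakk> \<Longrightarrow> cj s r \<in> R"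
    and cj: "\<lbrakk>s \<in> K; r \<in> R; x \<in> X\<rbrakk> \<Longrightarrow> a s (a r x) = a (cj s r) (a s x)"
    and qp1: "\<lbrakk>r \<in> R; x \<in> X; h (a r x) = h x\<rbrakk> \<Longrightarrow> a r x = x"
    and qp2: "\<lbrakk>r \<in> R; s \<in> K; x \<in> X; h x < h (a r x); h (a s (a r x)) < h (a s x)\<rbrakk> \<Longrightarrow> a r x = a s x"
begin

definition step where
  "step = {(y, a r y) | y r. y \<in> X \<and> r \<in> R \<and> h y < h (a r y)}"

definition up where "up s y = (if h y < h (a s y) then a s y else y)"

lemma stepI: "\<lbrakk>y \<in> X; r \<in> R; h y < h (a r y)\<rbrakk> \<Longrightarrow> (y, a r y) \<in> step"
  unfolding step_def by blast

lemma le_up: "\<lbrakk>y \<in> X; s \<in> K\<rbrakk> \<Longrightarrow> (y, up s y) \<in> step\<^sup>*"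
  using KR by (auto simp: up_def intro: r_into_rtrancl stepI)

lemma act_le_up:
  assumes "y \<in> X" "s \<in> K" shows "(a s y, up s y) \<in> step\<^sup>*"
proof -
  have sR: "s \<in> R" using assms KR by blast
  consider "h y < h (a s y)" | "h (a s y) < h y" | "h (a s y) = h y" by linarith
  then show ?thesis
  proof cases
    case 2
    have "(a s y, a s (a s y)) \<in> step"
      using 2 assms sR a_closed a_invol by (intro stepI) auto
    then have "(a s y, y) \<in> step" using a_invol [OF sR assms(1)] by (simp only:)
    moreover have "up s y = y" using 2 by (simp add: up_def)
    ultimately show ?thesis by auto
  next
    case 3
    then show ?thesis using qp1 [OF sR assms(1)] by (simp add: up_def)
  qed (simp add: up_def)
qed

text \<open>Monotonicity of \<open>up s\<close> on one step \<open>y < r y\<close>. By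
  \<open>qp2\<close>, \<open>s\<close> can reverse this step only if
  \<open>r y = s y\<close>.\<close>

lemma step_up:
  assumes "(y, y') \<in> step" "s \<in> K"
  shows "(up s y, up s y') \<in> step\<^sup>*"
proof -
  obtain r where r: "y \<in> X" "r \<in> R" "h y < h (a r y)" "y' = a r y"
    using assms(1) unfolding step_def by blast
  have sR: "s \<in> R" using assms KR by blast
  have y': "y' \<in> X" using r a_closed by simp
  have le: "(y', up s y') \<in> step\<^sup>*" using le_up [OF y' assms(2)] .
  show ?thesis
  proof (cases "h y < h (a s y)")
    case False
    then have "up s y = y" by (simp add: up_def)
    then show ?thesis using assms(1) le by (simp add: converse_rtrancl_into_rtrancl)
  next
    case True
    let ?x = "a s y" and ?z = "a s y'"
    have x: "?x \<in> X" "?z \<in> X" using r y' sR a_closed by auto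
    have z: "?z = a (cj s r) ?x" "cj s r \<in> R" using cj cj_closed r assms(2) by auto
    have u: "up s y = ?x" using True by (simp add: up_def)
    consider "h ?z < h ?x" | "h ?z = h ?x" | "h ?x < h ?z" by linarith
    then show ?thesis
    proof cases
      case 1
      then have "y' = ?x" using qp2 [OF r(2) assms(2) r(1,3)] r(4) by simp
      then show ?thesis using u le by simp
    next
      case 2
      then have "?z = ?x" using qp1 [OF z(2) x(1)] z by simp
      then have "y' = y" using a_invol [OF sR r(1)] a_invol [OF sR y'] by simp
      then show ?thesis using r by simp
    next
      case 3
      then have "(?x, ?z) \<in> step" using stepI [OF x(1) z(2)] z by simp
      moreover have "(?z, up s y') \<in> step\<^sup>*" using act_le_up [OF y' assms(2)] .
      ultimately show ?thesis using u by (simp add: converse_rtrancl_into_rtrancl)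
    qed
  qed
qed

lemma trancl_step_less: "(y, z) \<in> step\<^sup>+ \<Longrightarrow> h y < h z \<and> y \<in> X \<and> z \<in> X"
  by (induct rule: trancl_induct) (auto simp: a_closed step_def)

text \<open>\<open>s y \<le> up s y \<le> up s z = s z\<close>, strictly because \<open>s\<close>
  acts injectively and \<open>y\<close> differs from \<open>z\<close>.\<close>

lemma lifting:
  assumes yz: "(y, z) \<in> step\<^sup>+" and s: "s \<in> K" and up: "h z < h (a s z)"
  shows "(a s y, a s z) \<in> step\<^sup>+"
proof -
  have "(up s y, up s z) \<in> step\<^sup>*"
    using yz
  proof (induct rule: trancl_induct)
    case (base z)
    then show ?case using step_up [OF _ s] by blast
  next
    case (step z z')
    then show ?case using step_up [OF step(2) s] by (meson rtrancl_trans)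
  qed
  moreover have "up s z = a s z" using up by (simp add: up_def)
  moreover have c: "h y < h z" "y \<in> X" "z \<in> X" using trancl_step_less [OF yz] by auto
  ultimately have "(a s y, a s z) \<in> step\<^sup>*" using act_le_up [OF c(2) s] by (metis rtrancl_trans)
  moreover have "a s y \<noteq> a s z" using c a_invol [of s] s KR by (metis less_irrefl subsetD)
  ultimately show ?thesis by (meson rtranclD)
qed

lemma foldr_closed: "\<lbrakk>set ws \<subseteq> K; x \<in> X\<rbrakk> \<Longrightarrow> foldr a ws x \<in> X"
  using KR by (induct ws) (auto intro: a_closed)

lemma foldr_rev: "\<lbrakk>set ws \<subseteq> K; x \<in> X\<rbrakk> \<Longrightarrow> foldr a (rev ws) (foldr a ws x) = x"
proof (induct ws)
  case (Cons s ws)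
  then show ?case using a_invol [of s] foldr_closed [of ws x] KR by auto
qed simp

text \<open>A global minimum on the orbit; that local minima are global is
  \<open>local_min_unique\<close>, which needs the exchange property first.\<close>

definition orbit_min where "orbit_min y \<longleftrightarrow> y \<in> X \<and> (\<forall>ws. set ws \<subseteq> K \<longrightarrow> h y \<le> h (foldr a ws y))"

lemma orbit_min_exists:
  assumes "x \<in> X"
  obtains y ws where "orbit_min y" "set ws \<subseteq> K" "x = foldr a ws y" "y = foldr a (rev ws) x"
proof -
  have "set [] \<subseteq> K" by simp
  from ex_has_least_nat [of "\<lambda>ws. set ws \<subseteq> K", OF this, of "\<lambda>ws. h (foldr a ws x)"]
  obtain us where us: "set us \<subseteq> K" "\<And>ws. set ws \<subseteq> K \<Longrightarrow> h (foldr a us x) \<le> h (foldr a ws x)"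
    by blast
  have "h (foldr a us x) \<le> h (foldr a ws (foldr a us x))" if "set ws \<subseteq> K" for ws
    using us(2) [of "ws @ us"] us(1) that by simp
  then have "orbit_min (foldr a us x)"
    using foldr_closed [OF us(1) assms] by (simp add: orbit_min_def)
  then show ?thesis
  proof (rule that [of _ "rev us"])
    show "set (rev us) \<subseteq> K" using us(1) by simp
    show "x = foldr a (rev us) (foldr a us x)" using foldr_rev [OF us(1) assms] by (rule sym)
    show "foldr a us x = foldr a (rev (rev us)) x" by (simp only: rev_rev_ident)
  qed
qed

end

text \<open>\<open>reach\<close> keeps \<open>r y\<close> in the orbit of \<open>y\<close> under the
  generators; this settles the base case of the exchange argument.\<close>

locale generated_qpset = qpset +
  assumes reach: "\<lbrakk>r \<in> R; x \<in> X\<rbrakk> \<Longrightarrow> \<exists>ws. set ws \<subseteq> K \<and> a r x = foldr a ws x"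
begin

text \<open>Strong exchange, with words replaced by their effect on \<open>y\<close>. Either the
  reflection is carried past the first letter \<open>s\<close>, or \<open>qp2\<close> shows that it
  undoes \<open>s\<close>, and \<open>s\<close> itself is deleted.\<close>

lemma exchange:
  assumes y: "orbit_min y" and "set ws \<subseteq> K" "r \<in> R"
    "h (a r (foldr a ws y)) < h (foldr a ws y)"
  shows "\<exists>us. set us \<subseteq> K \<and> length us < length ws \<and> a r (foldr a ws y) = foldr a us y"
  using assms(2-)
proof (induct ws arbitrary: r)
  case Nil
  have yX: "y \<in> X" using y by (simp add: orbit_min_def)
  then show ?case using reach [OF Nil(2) yX] Nil(3) y by (auto simp: orbit_min_def)
next
  case (Cons s ws)
  let ?x = "foldr a ws y"
  have s: "s \<in> K" "s \<in> R" "set ws \<subseteq> K" using Cons.prems KR by auto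
  have x: "?x \<in> X" using foldr_closed s y by (simp add: orbit_min_def)
  let ?r = "cj s r"
  have r: "?r \<in> R" using cj_closed s Cons.prems by simp
  have sx: "a s ?x \<in> X" using a_closed s x by simp
  have "a s (a r (a s ?x)) = a ?r ?x"
    using cj [OF s(1) Cons.prems(2) sx] a_invol [OF s(2) x] by simp
  then have e: "a r (a s ?x) = a s (a ?r ?x)"
    using a_invol [OF s(2) a_closed [OF Cons.prems(2) sx]] by simp
  consider "h (a ?r ?x) < h ?x" | "h (a ?r ?x) = h ?x" | "h ?x < h (a ?r ?x)" by linarith
  then show ?case
  proof cases
    case 1
    then obtain us where "set us \<subseteq> K" "length us < length ws" "a ?r ?x = foldr a us y"
      using Cons.hyps [OF s(3) r] by blast
    then show ?thesis using e s by (intro exI [of _ "s # us"]) simp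
  next
    case 2
    then have "a ?r ?x = ?x" using qp1 [OF r x] by simp
    then show ?thesis using e Cons.prems(3) by simp
  next
    case 3
    then have "a ?r ?x = a s ?x"
      using qp2 [OF r s(1) x 3] e Cons.prems(3) by simp
    then have "a r (a s ?x) = ?x" using e a_invol [OF s(2) x] by simp
    then show ?thesis using s by (intro exI [of _ ws]) simp
  qed
qed

text \<open>A first letter that does not ascend can be saved: by exchange if it descends, outright
  if it fixes.\<close>

lemma shortest_ascent:
  assumes y: "orbit_min y" and ws: "set (s # ws) \<subseteq> K"
    and short: "\<And>us. \<lbrakk>set us \<subseteq> K; foldr a us y = foldr a (s # ws) y\<rbrakk> \<Longrightarrow> length (s # ws) \<le> length us"
  shows "h (foldr a ws y) < h (foldr a (s # ws) y)"
proof (rule ccontr)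
  let ?x = "foldr a ws y"
  have s: "s \<in> K" "s \<in> R" "set ws \<subseteq> K" using ws KR by auto
  have x: "?x \<in> X" using foldr_closed s y by (simp add: orbit_min_def)
  assume "\<not> ?thesis"
  then consider "h (a s ?x) < h ?x" | "h (a s ?x) = h ?x" by fastforce
  then show False
  proof cases
    case 1
    then obtain us where "set us \<subseteq> K" "length us < length ws" "a s ?x = foldr a us y"
      using exchange [OF y s(3,2)] by blast
    then show False using short [of us] by simp
  next
    case 2
    then have "a s ?x = ?x" using qp1 [OF s(2) x] by simp
    then show False using short [of ws] s by simp
  qed
qed

text \<open>Take a shortest word from \<open>y\<close>. Its first letter is a strict ascent, so
  undoing it would descend from a local minimum; hence the word is empty.\<close>

lemma local_min_unique:
  assumes y: "orbit_min y" and ws: "set ws \<subseteq> K"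
    and loc: "\<And>s. s \<in> K \<Longrightarrow> h (foldr a ws y) \<le> h (a s (foldr a ws y))"
  shows "foldr a ws y = y"
proof -
  have "\<exists>us. set us \<subseteq> K \<and> foldr a us y = foldr a ws y" using ws by blast
  then obtain us0 where "set us0 \<subseteq> K \<and> foldr a us0 y = foldr a ws y" by blast
  from ex_has_least_nat [of "\<lambda>us. set us \<subseteq> K \<and> foldr a us y = foldr a ws y", OF this, of length]
  obtain us where us: "set us \<subseteq> K" "foldr a us y = foldr a ws y"
    "\<And>vs. \<lbrakk>set vs \<subseteq> K; foldr a vs y = foldr a ws y\<rbrakk> \<Longrightarrow> length us \<le> length vs" by blast
  show ?thesis
  proof (cases us)
    case (Cons s vs)
    have s: "s \<in> K" "s \<in> R" "set vs \<subseteq> K" using us(1) Cons KR by auto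
    have x: "foldr a vs y \<in> X" using foldr_closed s y by (simp add: orbit_min_def)
    have "h (foldr a vs y) < h (foldr a (s # vs) y)"
      using us Cons by (intro shortest_ascent [OF y]) auto
    moreover have "a s (foldr a ws y) = foldr a vs y"
      using us(2) Cons a_invol [OF s(2) x] by auto
    ultimately show ?thesis using loc [OF s(1)] us(2) Cons by simp
  qed (use us in simp)
qed

end

section \<open>Laurent polynomials and linear operators\<close>

abbreviation qL :: laurent where "qL \<equiv> xL - xinv"

lemma xL_xinv [simp]: "xL * xinv = 1" "xinv * xL = 1"
  by (simp_all add: xL_def xinv_def Poly_Mapping.mult_single)

lemma lookup_barL: "Poly_Mapping.lookup (barL p) n = Poly_Mapping.lookup p (- n)"
proof -
  have "Poly_Mapping.lookup (barL p) n =
      (\<Sum>k\<in>Poly_Mapping.keys p. Poly_Mapping.lookup p k when - k = n)"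
    by (simp add: barL_def Poly_Mapping.lookup_sum Poly_Mapping.lookup_single)
  also have "\<dots> = (\<Sum>k\<in>Poly_Mapping.keys p. if k = - n then Poly_Mapping.lookup p k else 0)"
    by (rule sum.cong) (auto simp: when_def)
  also have "\<dots> = Poly_Mapping.lookup p (- n)"
    by (simp add: Poly_Mapping.in_keys_iff)
  finally show ?thesis .
qed

lemma barL_add: "barL (p + q) = barL p + barL q"
  by (rule poly_mapping_eqI) (simp add: lookup_barL lookup_add)

lemma barL_zero [simp]: "barL 0 = 0"
  by (rule poly_mapping_eqI) (simp add: lookup_barL)

lemma barL_minus: "barL (p - q) = barL p - barL q"
  by (rule poly_mapping_eqI) (simp add: lookup_barL lookup_minus)

lemma barL_uminus: "barL (- p) = - barL p"
  by (rule poly_mapping_eqI) (simp add: lookup_barL)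

lemma barL_barL [simp]: "barL (barL p) = p"
  by (rule poly_mapping_eqI) (simp add: lookup_barL)

lemma barL_sum: "barL (sum f A) = (\<Sum>i\<in>A. barL (f i))"
  by (induct A rule: infinite_finite_induct) (auto simp: barL_add)

lemma barL_single: "barL (Poly_Mapping.single k c) = Poly_Mapping.single (- k) c"
  by (rule poly_mapping_eqI) (auto simp: lookup_barL lookup_single when_def)

lemma barL_mult: "barL (p * q) = barL p * barL q"
proof -
  have ex: "r = (\<Sum>k\<in>Poly_Mapping.keys r. Poly_Mapping.single k (Poly_Mapping.lookup r k))" for r :: laurent
  proof (rule poly_mapping_eqI)
    fix n
    have "Poly_Mapping.lookup (\<Sum>k\<in>Poly_Mapping.keys r. Poly_Mapping.single k (Poly_Mapping.lookup r k)) n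
        = (\<Sum>k\<in>Poly_Mapping.keys r. if k = n then Poly_Mapping.lookup r k else 0)"
      by (simp add: lookup_sum lookup_single when_def)
    then show "Poly_Mapping.lookup r n =
        Poly_Mapping.lookup (\<Sum>k\<in>Poly_Mapping.keys r. Poly_Mapping.single k (Poly_Mapping.lookup r k)) n"
      by (simp add: Poly_Mapping.in_keys_iff)
  qed
  have "barL (p * q) = barL ((\<Sum>k\<in>Poly_Mapping.keys p. Poly_Mapping.single k (Poly_Mapping.lookup p k))
      * (\<Sum>k\<in>Poly_Mapping.keys q. Poly_Mapping.single k (Poly_Mapping.lookup q k)))"
    using ex [of p] ex [of q] by simp
  also have "\<dots> = barL p * barL q"
    by (simp add: barL_def [of p] barL_def [of q] sum_product barL_sum barL_single
        Poly_Mapping.mult_single add.commute)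
  finally show ?thesis .
qed

lemma barL_one [simp]: "barL 1 = 1"
  by (metis barL_single minus_zero Poly_Mapping.single_one)

lemma barL_xL [simp]: "barL xL = xinv" "barL xinv = xL"
  by (simp_all add: xL_def xinv_def barL_single)

lemma barL_qL [simp]: "barL qL = - qL"
  by (simp add: barL_minus)

section \<open>Semilinear maps on coefficient functions\<close>

lemma vadd_eq: "vadd f g = f + g"
  by (simp add: vadd_def fun_eq_iff)

lemma sum_fun_apply: "(\<Sum>i\<in>A. f i) x = (\<Sum>i\<in>A. f i x)"
  by (induct A rule: infinite_finite_induct) auto

lemma sc_add_right: "sc p (f + g) = sc p f + sc p g"
  by (simp add: sc_def fun_eq_iff distrib_left)

lemma sc_add_left: "sc (p + q) f = sc p f + sc q f"
  by (simp add: sc_def fun_eq_iff distrib_right)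

lemma sc_minus_left: "sc (p - q) f = sc p f - sc q f"
  by (simp add: sc_def fun_eq_iff left_diff_distrib)

lemma sc_minus_right: "sc p (f - g) = sc p f - sc p g"
  by (simp add: sc_def fun_eq_iff right_diff_distrib)

lemma sc_sc [simp]: "sc p (sc q f) = sc (p * q) f"
  by (simp add: sc_def fun_eq_iff mult.assoc)

lemma sc_one [simp]: "sc 1 f = f"
  by (simp add: sc_def)

lemma sc_zero [simp]: "sc 0 f = 0" "sc p 0 = 0"
  by (simp_all add: sc_def fun_eq_iff)

lemma sc_uminus: "sc (- p) f = - sc p f"
  by (simp add: sc_def fun_eq_iff)

text \<open>\<open>\<beta>\<close> twists the scalars, so that linear maps and maps antilinear for
  the bar involution share their lemmas.\<close>

definition slin :: "(laurent \<Rightarrow> laurent) \<Rightarrow> (('i \<Rightarrow> laurent) \<Rightarrow> ('j \<Rightarrow> laurent)) \<Rightarrow> bool" where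
  "slin \<beta> f \<longleftrightarrow> (\<forall>u v. f (u + v) = f u + f v) \<and> (\<forall>p u. f (sc p u) = sc (\<beta> p) (f u))"

abbreviation "lin \<equiv> slin (\<lambda>p. p)"
abbreviation "alin \<equiv> slin barL"

lemma slin_add: "slin \<beta> f \<Longrightarrow> f (u + v) = f u + f v"
  by (simp add: slin_def)

lemma slin_sc: "slin \<beta> f \<Longrightarrow> f (sc p u) = sc (\<beta> p) (f u)"
  by (simp add: slin_def)

lemma slin_zero: "slin \<beta> f \<Longrightarrow> f 0 = 0"
  using slin_add [of \<beta> f 0 0] by simp

lemma slin_uminus: "slin \<beta> f \<Longrightarrow> f (- u) = - f u"
  using slin_add [of \<beta> f "- u" u] slin_zero [of \<beta> f] by (simp add: eq_neg_iff_add_eq_0)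

lemma slin_minus: "slin \<beta> f \<Longrightarrow> f (u - v) = f u - f v"
  using slin_add [of \<beta> f u "- v"] slin_uminus [of \<beta> f v] by simp

lemma slin_sum: "slin \<beta> f \<Longrightarrow> f (\<Sum>i\<in>A. g i) = (\<Sum>i\<in>A. f (g i))"
proof (induct A rule: infinite_finite_induct)
  case (insert x A)
  then show ?case using slin_add [OF insert(4), of "g x" "sum g A"] by simp
qed (use slin_zero [of \<beta> f] in simp_all)

lemma sc_sum: "sc p (sum f A) = (\<Sum>i\<in>A. sc p (f i))"
  by (rule slin_sum [of "\<lambda>p. p"]) (simp add: slin_def sc_add_right mult.commute)

lemma slin_comp: "\<lbrakk>slin \<beta> f; slin \<gamma> g\<rbrakk> \<Longrightarrow> slin (\<lambda>p. \<beta> (\<gamma> p)) (\<lambda>u. f (g u))"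
  by (simp add: slin_def)

lemma lin_id: "lin (\<lambda>u. u)"
  by (simp add: slin_def)

lemma lin_foldr: "\<lbrakk>\<And>s. s \<in> set ws \<Longrightarrow> lin (T s)\<rbrakk> \<Longrightarrow> lin (foldr T ws)"
  by (induct ws) (auto simp: slin_def)

definition supp_in :: "'i set \<Rightarrow> ('i \<Rightarrow> laurent) set" where
  "supp_in X = {m. \<forall>i. i \<notin> X \<longrightarrow> m i = 0}"

lemma supp_in_add: "\<lbrakk>u \<in> supp_in X; v \<in> supp_in X\<rbrakk> \<Longrightarrow> u + v \<in> supp_in X"
  by (simp add: supp_in_def)

lemma supp_in_diff: "\<lbrakk>u \<in> supp_in X; v \<in> supp_in X\<rbrakk> \<Longrightarrow> u - v \<in> supp_in X"
  by (simp add: supp_in_def)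

lemma supp_in_sc: "u \<in> supp_in X \<Longrightarrow> sc p u \<in> supp_in X"
  by (simp add: supp_in_def sc_def)

lemma supp_in_sum: "(\<And>i. i \<in> A \<Longrightarrow> f i \<in> supp_in X) \<Longrightarrow> sum f A \<in> supp_in X"
  by (induct A rule: infinite_finite_induct) (auto simp: supp_in_def)

lemma bvec_supp_in: "i \<in> X \<Longrightarrow> bvec i \<in> supp_in X"
  by (auto simp: supp_in_def bvec_def)

lemma basis_expansion:
  assumes "finite X" "m \<in> supp_in X"
  shows "m = (\<Sum>i\<in>X. sc (m i) (bvec i))"
proof
  fix j
  have "(\<Sum>i\<in>X. sc (m i) (bvec i)) j = (\<Sum>i\<in>X. if i = j then m i else 0)"
    unfolding sum_fun_apply by (rule sum.cong) (auto simp: sc_def bvec_def)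
  also have "\<dots> = m j" using assms by (auto simp: supp_in_def)
  finally show "m j = (\<Sum>i\<in>X. sc (m i) (bvec i)) j" by simp
qed

lemma slin_eq_on:
  assumes "finite X" "slin \<beta> f" "slin \<beta> g" "\<And>i. i \<in> X \<Longrightarrow> f (bvec i) = g (bvec i)" "m \<in> supp_in X"
  shows "f m = g m"
proof -
  have "f (\<Sum>i\<in>X. sc (m i) (bvec i)) = g (\<Sum>i\<in>X. sc (m i) (bvec i))"
    using assms by (simp add: slin_sum slin_sc)
  then show ?thesis using basis_expansion [OF assms(1,5)] by simp
qed

text \<open>The common shape of all operators \<open>H_s\<close>: \<open>p\<close> is the action of
  \<open>s\<close> on the index set, \<open>d\<close> marks strict descents, \<open>l\<close> is the
  eigenvalue at fixed points. It is written by coefficients; as \<open>p\<close> is an involution,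
  the value at \<open>i\<close> is read off at \<open>p i\<close>. \<open>hecke_op_bvec\<close>
  returns to basis vectors.\<close>

definition hecke_op :: "'i set \<Rightarrow> ('i \<Rightarrow> 'i) \<Rightarrow> ('i \<Rightarrow> bool) \<Rightarrow> ('i \<Rightarrow> laurent) \<Rightarrow> ('i \<Rightarrow> laurent) \<Rightarrow> 'i \<Rightarrow> laurent" where
  "hecke_op X p d l f = (\<lambda>i. if i \<in> X then
      (if p i = i then l i * f i else f (p i) + (if d i then qL * f i else 0)) else 0)"

lemma hecke_op_lin: "lin (hecke_op X p d l)"
  by (auto simp: slin_def hecke_op_def sc_def fun_eq_iff algebra_simps)

lemma hecke_op_supp: "hecke_op X p d l f \<in> supp_in X"
  by (simp add: hecke_op_def supp_in_def)

lemma hecke_op_bvec: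
  assumes "i \<in> X" "p i \<in> X" "\<And>j. j \<in> X \<Longrightarrow> p (p j) = j"
  shows "p i = i \<Longrightarrow> hecke_op X p d l (bvec i) = sc (l i) (bvec i)"
    and "p i \<noteq> i \<Longrightarrow> \<not> d i \<Longrightarrow> hecke_op X p d l (bvec i) = bvec (p i)"
    and "p i \<noteq> i \<Longrightarrow> d i \<Longrightarrow> hecke_op X p d l (bvec i) = bvec (p i) + sc qL (bvec i)"
proof -
  have *: "j \<in> X \<Longrightarrow> p j = i \<longleftrightarrow> j = p i" for j using assms by metis
  show "p i = i \<Longrightarrow> hecke_op X p d l (bvec i) = sc (l i) (bvec i)"
    using assms * by (auto simp: hecke_op_def bvec_def sc_def fun_eq_iff)
  show "p i \<noteq> i \<Longrightarrow> \<not> d i \<Longrightarrow> hecke_op X p d l (bvec i) = bvec (p i)"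
    using assms * by (auto simp: hecke_op_def bvec_def sc_def fun_eq_iff)
  show "p i \<noteq> i \<Longrightarrow> d i \<Longrightarrow> hecke_op X p d l (bvec i) = bvec (p i) + sc qL (bvec i)"
    using assms * by (auto simp: hecke_op_def bvec_def sc_def fun_eq_iff)
qed

text \<open>At fixed points, \<open>x\<close> and \<open>-x^-1\<close> are the roots of
  \<open>X^2 = 1 + (x - x^-1) X\<close>; at moved points exactly one of \<open>i\<close> and
  \<open>p i\<close> is a descent.\<close>

lemma hecke_op_quadratic:
  assumes "\<And>i. i \<in> X \<Longrightarrow> p i \<in> X \<and> p (p i) = i \<and> (p i \<noteq> i \<longrightarrow> (d (p i) \<longleftrightarrow> \<not> d i)) \<and> l i \<in> {xL, - xinv}"
    and f: "f \<in> supp_in X"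
  shows "hecke_op X p d l (hecke_op X p d l f) = f + sc qL (hecke_op X p d l f)"
proof
  fix i
  show "hecke_op X p d l (hecke_op X p d l f) i = (f + sc qL (hecke_op X p d l f)) i"
  proof (cases "i \<in> X")
    case False
    then show ?thesis using f by (simp add: hecke_op_def sc_def supp_in_def)
  next
    case True
    show ?thesis
    proof (cases "p i = i")
      case fixed: True
      have "l i * l i = 1 + qL * l i"
        using assms(1) [OF True] by (auto simp: algebra_simps)
      then have "l i * l i * f i = (1 + qL * l i) * f i" by (simp only:)
      then have e: "l i * (l i * f i) = f i + qL * (l i * f i)"
        by (simp only: distrib_right mult.assoc mult_1)
      have 1: "hecke_op X p d l (hecke_op X p d l f) i = l i * (l i * f i)"
        using True fixed by (simp add: hecke_op_def)
      have 2: "(f + sc qL (hecke_op X p d l f)) i = f i + qL * (l i * f i)"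
        using True fixed by (simp add: hecke_op_def sc_def)
      show ?thesis unfolding 1 2 by (rule e)
    next
      case False
      then show ?thesis using True assms(1) [OF True]
        by (auto simp: hecke_op_def sc_def algebra_simps)
    qed
  qed
qed

text \<open>Let \<open>A\<close>, \<open>B\<close> be the two alternating products, starting with
  \<open>a\<close> and \<open>b\<close>, with \<open>A v = B v\<close>. For the letter
  \<open>c\<close> that ends \<open>B\<close>, \<open>A c = a B\<close>. A quadratic relation turns
  both \<open>A c v\<close> and \<open>B c v\<close> into the same sum: the product \<open>B\<close>
  without its last letter, applied to \<open>v\<close>, plus \<open>qL\<close> times
  \<open>A v = B v\<close>.\<close>

lemma braid_propagate:
  assumes lin: "lin (T s)" "lin (T t)"
    and quad: "\<And>v. v \<in> V \<Longrightarrow> T s (T s v) = v + sc qL (T s v)" "\<And>v. v \<in> V \<Longrightarrow> T t (T t v) = v + sc qL (T t v)"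
    and V: "\<And>v. v \<in> V \<Longrightarrow> T s v \<in> V" "\<And>v. v \<in> V \<Longrightarrow> T t v \<in> V"
    and n: "0 < n" and v: "v \<in> V"
    and eq: "foldr T (altw s t n) v = foldr T (altw t s n) v"
  shows "foldr T (altw s t n) (T s v) = foldr T (altw t s n) (T s v)"
    and "foldr T (altw s t n) (T t v) = foldr T (altw t s n) (T t v)"
proof -
  obtain k where k: "n = Suc k" using n by (cases n) auto
  have main: "foldr T (altw a b n) (T c v) = foldr T (altw b a n) (T c v)"
    if ab: "{a, b} = {s, t}" "c = (if even k then b else a)"
      "foldr T (altw a b n) v = foldr T (altw b a n) v" for a b c
  proof -
    have A: "lin (T a)" "lin (T b)" "lin (T c)" "\<And>v. v \<in> V \<Longrightarrow> T a v \<in> V" "\<And>v. v \<in> V \<Longrightarrow> T b v \<in> V"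
      "\<And>v. v \<in> V \<Longrightarrow> T a (T a v) = v + sc qL (T a v)" "\<And>v. v \<in> V \<Longrightarrow> T c (T c v) = v + sc qL (T c v)"
      using ab(1,2) lin quad V by (auto simp: doubleton_eq_iff split: if_splits)
    define u where "u = foldr T (altw b a k) v"
    define w where "w = foldr T (altw a b n) v"
    have "foldr T xs v \<in> V" if "set xs \<subseteq> {a, b}" for xs
      using that A v by (induct xs) auto
    then have uV: "u \<in> V" using set_altw [of b a k] by (auto simp: u_def)
    have w: "w = T a u" by (simp add: w_def u_def k)
    have "altw a b n @ [c] = a # altw b a n"
      using altw_append_last [of a b "Suc k"] ab(2) k by simp
    then have "foldr T (altw a b n @ [c]) v = foldr T (a # altw b a n) v" by (simp only:)
    then have 1: "foldr T (altw a b n) (T c v) = u + sc qL w"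
      using ab(3) A(6) [OF uV] w by (simp add: w_def [symmetric])
    have "altw b a n = altw b a k @ [c]"
      using altw_append_last [of b a k] ab(2) k by simp
    then have sp: "foldr T (altw b a n) x = foldr T (altw b a k) (T c x)" for x by simp
    have l: "lin (foldr T (altw b a k))"
      using A set_altw [of b a k] by (intro lin_foldr) auto
    have "foldr T (altw b a n) (T c v) = foldr T (altw b a k) (v + sc qL (T c v))"
      using sp A(7) [OF v] by simp
    also have "\<dots> = u + sc qL (foldr T (altw b a n) v)"
      using slin_add [OF l, of v "sc qL (T c v)"] slin_sc [OF l] sp by (simp add: u_def)
    finally show ?thesis using 1 ab(3) w_def by simp
  qed
  show "foldr T (altw s t n) (T s v) = foldr T (altw t s n) (T s v)"
    using main [of s t s] main [of t s s] eq by (cases "even k") (auto simp: insert_commute)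
  show "foldr T (altw s t n) (T t v) = foldr T (altw t s n) (T t v)"
    using main [of s t t] main [of t s t] eq by (cases "even k") (auto simp: insert_commute)
qed

section \<open>Perfect involutions\<close>

context coxeter
begin

text \<open>Pull \<open>t'\<close> back along \<open>u\<close> to \<open>r\<close>, which commutes
  with \<open>s\<close> and differs from it. In the cocycle for \<open>u s u^-1\<close> the
  contributions of \<open>u\<close> and of \<open>u^-1\<close> are then equal and cancel.\<close>

lemma linv_commuting_refl:
  assumes t: "t \<in> refls" and t': "t' \<in> refls" and ne: "t \<noteq> t'" and comm: "t \<otimes> t' = t' \<otimes> t"
  shows "\<not> linv t t'"
proof -
  obtain u s where u: "u \<in> carrier W" "s \<in> S" "t = u \<otimes> s \<otimes> inv u"
    using t by (rule reflE)
  define r where "r = inv u \<otimes> t' \<otimes> u"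
  have r: "r \<in> refls" unfolding r_def using refl_conj' [OF t' u(1)] .
  have t'c: "t' \<in> carrier W" using t' by simp
  have t'_r: "t' = u \<otimes> r \<otimes> inv u" using u t'c by (simp add: r_def m_assoc)
  have "r \<noteq> s" using t'_r u ne by auto
  have rc: "r \<in> carrier W" using r by simp
  have "u \<otimes> (s \<otimes> r) \<otimes> inv u = t \<otimes> t'" "t' \<otimes> t = u \<otimes> (r \<otimes> s) \<otimes> inv u"
    using u rc unfolding t'_r by (simp_all add: m_assoc)
  then have "u \<otimes> (s \<otimes> r) \<otimes> inv u = u \<otimes> (r \<otimes> s) \<otimes> inv u" using comm by simp
  then have "s \<otimes> r = r \<otimes> s" using u(1,2) rc by simp
  then have srs: "inv s \<otimes> r \<otimes> s = r" using u rc by (simp add: m_assoc)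
  have "linv t t' \<longleftrightarrow> linv u t' \<noteq> linv (s \<otimes> inv u) r"
    using linv_mult [OF t' u(1), of "s \<otimes> inv u"] u by (simp add: r_def m_assoc)
  moreover have "linv (s \<otimes> inv u) r \<longleftrightarrow> linv s r \<noteq> linv (inv u) r"
    using linv_mult [OF r, of s "inv u"] u srs by simp
  moreover have "\<not> linv s r" using linv_gen [OF r u(2)] \<open>r \<noteq> s\<close> by simp
  moreover have "linv (inv u) r \<longleftrightarrow> linv u t'"
    using linv_inv [OF t' u(1)] by (simp add: r_def)
  ultimately show ?thesis by simp
qed

end

locale parabolic = coxeter +
  fixes J :: "'a set"
  assumes JS: "J \<subseteq> S"
begin

abbreviation "WJJ \<equiv> WJ W J"
abbreviation "TJ \<equiv> reflsJ W J"

lemma J_S [simp]: "s \<in> J \<Longrightarrow> s \<in> S" using JS by blast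
lemma WJJ_closed [simp]: "u \<in> WJJ \<Longrightarrow> u \<in> carrier W" using WJ_closed JS by blast
lemma WJJ_mult [simp]: "u \<in> WJJ \<Longrightarrow> v \<in> WJJ \<Longrightarrow> u \<otimes> v \<in> WJJ" using WJ_mult JS by blast
lemma WJJ_inv [simp]: "u \<in> WJJ \<Longrightarrow> inv u \<in> WJJ" using WJ_inv JS by blast
lemma WJJ_one [simp]: "\<one> \<in> WJJ" using WJ_one by blast
lemma J_WJJ [simp]: "s \<in> J \<Longrightarrow> s \<in> WJJ" using WJ_gen by blast
lemma TJ_WJJ [simp]: "t \<in> TJ \<Longrightarrow> t \<in> WJJ" using reflsJ_WJ JS by blast
lemma TJ_refls [simp]: "t \<in> TJ \<Longrightarrow> t \<in> refls" using reflsJ_refls JS by blast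
lemma J_TJ [simp]: "s \<in> J \<Longrightarrow> s \<in> TJ" using reflsJ_gen JS by blast

lemma reflsJ_mono: "K \<subseteq> J \<Longrightarrow> reflsJ W K \<subseteq> TJ"
  using WJ_mono [of K J] unfolding reflsJ_def by blast

lemma wprod_WJJ: "set ws \<subseteq> J \<Longrightarrow> wprod W ws \<in> WJJ"
  using wprod_WJ JS by blast

end

text \<open>Encodes \<open>z^2 = 1\<close> without perfection, because the braid argument also
  treats an auxiliary pair \<open>(s y, \<theta>)\<close> merely as a twisted involution.\<close>

locale twisted_inv = parabolic +
  fixes y :: 'a and \<theta> :: "'a \<Rightarrow> 'a"
  assumes y [simp]: "y \<in> WJ W J" and \<theta>: "\<theta> \<in> autJ W J"
    and \<theta>\<theta>: "\<theta> \<circ> \<theta> = id" and y\<theta>: "y \<otimes> \<theta> y = \<one>"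
begin

lemma th_closed [simp]: "u \<in> WJJ \<Longrightarrow> \<theta> u \<in> WJJ"
  using \<theta> by (auto simp: autJ_def bij_betw_def)

lemma th_mult: "u \<in> WJJ \<Longrightarrow> v \<in> WJJ \<Longrightarrow> \<theta> (u \<otimes> v) = \<theta> u \<otimes> \<theta> v"
  using \<theta> by (auto simp: autJ_def)

lemma th_J [simp]: "s \<in> J \<Longrightarrow> \<theta> s \<in> J"
  using \<theta> by (auto simp: autJ_def)

lemma th_th [simp]: "\<theta> (\<theta> u) = u"
  using fun_cong [OF \<theta>\<theta>, of u] by simp

lemma th_one [simp]: "\<theta> \<one> = \<one>"
proof -
  have "\<theta> \<one> \<otimes> \<theta> \<one> = \<theta> \<one>" using th_mult [of \<one> \<one>] by simp
  then show ?thesis using l_cancel_one' [of "\<theta> \<one>" "\<theta> \<one>"] by simp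
qed

lemma th_inv: "u \<in> WJJ \<Longrightarrow> \<theta> (inv u) = inv (\<theta> u)"
  using th_mult [of "inv u" u] by (simp add: inv_equality)

lemma th_y: "\<theta> y = inv y"
  using y\<theta> by (metis inv_equality WJJ_closed th_closed y inv_inv)

lemma th_wprod: "set ws \<subseteq> J \<Longrightarrow> \<theta> (wprod W ws) = wprod W (map \<theta> ws)"
  by (induct ws) (auto simp: th_mult wprod_WJJ)

lemma th_len [simp]:
  assumes "u \<in> WJJ" shows "len (\<theta> u) = len u"
proof -
  have *: "len (\<theta> v) \<le> len v" if v: "v \<in> WJJ" for v
  proof -
    obtain ws where ws: "set ws \<subseteq> J" "length ws = len v" "wprod W ws = v"
      using reduced_WJ_word [OF JS v] by blast
    have "set (map \<theta> ws) \<subseteq> S" using ws by auto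
    from len_le [OF this] show ?thesis using th_wprod [OF ws(1)] ws by simp
  qed
  show ?thesis using * [OF assms] * [of "\<theta> u"] assms by simp
qed

lemma th_TJ [simp]:
  assumes "t \<in> TJ" shows "\<theta> t \<in> TJ"
proof -
  obtain w s where "w \<in> WJJ" "s \<in> J" "t = w \<otimes> s \<otimes> inv w"
    using assms by (rule reflsJ_E)
  then show ?thesis using reflsJ_I [of "\<theta> w" J "\<theta> s"] by (simp add: th_mult th_inv)
qed

lemma linv_th:
  assumes "u \<in> WJJ" "t \<in> WJJ" shows "linv (\<theta> u) (\<theta> t) \<longleftrightarrow> linv u t"
  using th_len [of "t \<otimes> u"] th_len [of u] assms by (simp add: th_mult)

text \<open>Conjugation by \<open>z = (y, \<theta>)\<close> in \<open>(W_J)^+\<close>, restricted to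
  \<open>W_J\<close>.\<close>

definition psi where "psi u = y \<otimes> \<theta> u \<otimes> inv y"

lemma psi_closed [simp]: "u \<in> WJJ \<Longrightarrow> psi u \<in> WJJ"
  by (simp add: psi_def)

lemma psi_mult: "u \<in> WJJ \<Longrightarrow> v \<in> WJJ \<Longrightarrow> psi (u \<otimes> v) = psi u \<otimes> psi v"
  by (simp add: psi_def th_mult m_assoc)

lemma th_psi: "u \<in> WJJ \<Longrightarrow> \<theta> (psi u) = inv y \<otimes> u \<otimes> y"
  by (simp add: psi_def th_mult th_inv th_y)

lemma psi_psi [simp]: "u \<in> WJJ \<Longrightarrow> psi (psi u) = u"
  using th_psi [of u] by (simp add: psi_def [of "psi u"] m_assoc)

lemma psi_one [simp]: "psi \<one> = \<one>"
  by (simp add: psi_def)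

lemma psi_inj: "u \<in> WJJ \<Longrightarrow> v \<in> WJJ \<Longrightarrow> psi u = psi v \<longleftrightarrow> u = v"
  by (metis psi_psi)

lemma psi_mult_y: "u \<in> WJJ \<Longrightarrow> psi u \<otimes> y = y \<otimes> \<theta> u"
  by (simp add: psi_def m_assoc)

lemma psi_TJ [simp]: "t \<in> TJ \<Longrightarrow> psi t \<in> TJ"
  using reflsJ_conj [OF JS, of "\<theta> t" y] by (simp add: psi_def)

text \<open>Conjugation by \<open>y\<close> carries inversions of \<open>y\<close> to those of
  \<open>y^-1 = \<theta>(y)\<close>, and \<open>\<theta>\<close> preserves lengths.\<close>

lemma linv_psi: 
  assumes "t \<in> TJ" shows "linv y (psi t) \<longleftrightarrow> linv y t"
proof -
  have "inv y \<otimes> psi t \<otimes> y = \<theta> t" using assms by (simp add: psi_def m_assoc)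
  then have "linv y (psi t) \<longleftrightarrow> linv (inv y) (\<theta> t)"
    using linv_inv [of "psi t" y] assms by simp
  also have "\<dots> \<longleftrightarrow> linv y t" using linv_th [of y t] assms by (simp add: th_y)
  finally show ?thesis .
qed

text \<open>\<open>psi p\<close> times \<open>y\<close> equals \<open>y \<theta>(p)\<close>. As
  \<open>a\<close> is an inversion of this product but not of \<open>y\<close>, \<open>psi a\<close>
  is an inversion of \<open>p\<close> and lies in \<open>W_K\<close>. Additivity of lengths over the
  minimal \<open>y\<close> then forces \<open>psi a\<close> to have length one.\<close>

lemma kilmoyer:
  assumes K: "K \<subseteq> J" and min: "left_min K y" and p: "p \<in> WJ W K" "psi p \<in> WJ W K"
    and a: "a \<in> K" "linv (psi p) a"
  shows "psi a \<in> K"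
proof -
  have KS: "K \<subseteq> S" using K JS by blast
  have aJ: "a \<in> J" using a K by blast
  have pJ: "p \<in> WJJ" using p WJ_mono [OF K] by blast
  have aK: "a \<in> reflsJ W K" using reflsJ_gen [OF KS a(1)] .
  have "linv (psi p \<otimes> y) a" using linv_left_min_mult [OF KS p(2) min aK] a(2) by simp
  then have "linv (y \<otimes> \<theta> p) a" using pJ by (simp add: psi_mult_y)
  moreover have "\<not> linv y a" using min a by (simp add: left_min_def)
  ultimately have "linv (\<theta> p) (inv y \<otimes> a \<otimes> y)"
    using linv_mult [of a y "\<theta> p"] aJ pJ by simp
  then have "linv (\<theta> p) (\<theta> (psi a))" using th_psi [of a] aJ by simp
  then have "linv p (psi a)" using linv_th [OF pJ, of "psi a"] aJ by simp
  then have "psi a \<in> reflsJ W K" using linv_reflsJ [OF KS p(1), of "psi a"] aJ by simp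
  then have paK: "psi a \<in> WJ W K" using reflsJ_WJ [OF KS] by blast
  have "len (psi a) + len y = len (y \<otimes> \<theta> a)"
    using len_left_min_mult [OF KS paK min] aJ by (simp add: psi_mult_y)
  also have "\<dots> \<le> len y + 1" using len_mult_le [of y "\<theta> a"] aJ by simp
  finally have "len (psi a) \<le> 1" by simp
  moreover have "psi a \<noteq> \<one>" using psi_inj [of a \<one>] aJ gen_ne_one [of a] by auto
  ultimately have l1: "len (psi a) = 1" using len_eq_0 [of "psi a"] aJ by fastforce
  obtain ws where ws: "set ws \<subseteq> K" "length ws = len (psi a)" "wprod W ws = psi a"
    using reduced_WJ_word [OF KS paK] by blast
  then obtain b where "ws = [b]" using l1 by (auto simp: length_Suc_conv)
  then show ?thesis using ws KS by auto
qed

text \<open>\<open>kilmoyer\<close> is applied to a descent \<open>a\<close> of \<open>p\<close> and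
  then to a descent of \<open>a p\<close>, which is nontrivial since \<open>p\<close> is not a
  generator; the two descents are distinct.\<close>

lemma kilmoyer_rank_two:
  assumes st: "s \<in> J" "t \<in> J" and min: "left_min {s, t} y"
    and p: "p \<in> WJ W {s, t}" "psi p \<in> WJ W {s, t}" "p \<notin> {\<one>, s, t}"
  shows "psi s \<in> {s, t} \<and> psi t \<in> {s, t}"
proof -
  let ?K = "{s, t}"
  have K: "?K \<subseteq> J" "?K \<subseteq> S" using st by auto
  have WJJ: "x \<in> WJJ" if "x \<in> WJ W ?K" for x using that WJ_mono [OF K(1)] by blast
  have desc: "psi a \<in> ?K" if "x \<in> WJ W ?K" "psi x \<in> WJ W ?K" "a \<in> ?K" "linv x a" for x a
    using kilmoyer [OF K(1) min, of "psi x" a] that WJJ by simp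
  obtain a where a: "a \<in> ?K" "linv p a" using descent_exists [OF K(2) p(1)] p(3) by blast
  have pa: "psi a \<in> ?K" using desc [OF p(1,2) a] .
  have aJ: "a \<in> J" using a(1) K(1) by blast
  then have aS: "a \<in> S" "a \<in> WJ W ?K" "a \<in> WJJ" using WJ_gen [OF a(1)] by simp_all
  have pc: "p \<in> WJJ" "p \<in> carrier W" using WJJ [OF p(1)] by simp_all
  have ap: "a \<otimes> p \<in> WJ W ?K" using WJ_mult [OF K(2) aS(2) p(1)] .
  have pap: "psi (a \<otimes> p) \<in> WJ W ?K"
    using WJ_mult [OF K(2) _ p(2), of "psi a"] pa WJ_gen [of "psi a" ?K] aS pc by (simp add: psi_mult)
  have "a \<otimes> p \<noteq> \<one>"
  proof
    assume "a \<otimes> p = \<one>"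
    then have "a \<otimes> (a \<otimes> p) = a \<otimes> \<one>" by (simp only:)
    then have "p = a" using aS pc by simp
    then show False using p a by auto
  qed
  then obtain b where b: "b \<in> ?K" "linv (a \<otimes> p) b" using descent_exists [OF K(2) ap] by blast
  have "b \<noteq> a" using b(2) a(2) aS pc by auto
  moreover have "psi b \<in> ?K" using desc [OF ap pap b] .
  ultimately show ?thesis using pa a b by auto
qed

end

locale perfect_inv = twisted_inv +
  assumes commute: "\<And>t. t \<in> reflsJ W J \<Longrightarrow>
    (y \<otimes> \<theta> t \<otimes> inv y) \<otimes> t = t \<otimes> (y \<otimes> \<theta> t \<otimes> inv y)"
begin

lemma psi_commute: "t \<in> TJ \<Longrightarrow> psi t \<otimes> t = t \<otimes> psi t"
  using commute by (simp add: psi_def)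

text \<open>Turns the two-sided \<open>t y \<theta>(t)\<close> into left multiplication by the
  commuting reflections \<open>t\<close> and \<open>psi t\<close>, to which the cocycle
  applies.\<close>

lemma conj_eq: "t \<in> TJ \<Longrightarrow> t \<otimes> y \<otimes> \<theta> t = psi t \<otimes> (t \<otimes> y)"
  using psi_commute [of t] psi_mult_y [of t] by (simp add: m_assoc) (metis m_assoc WJJ_closed TJ_WJJ psi_closed y)

lemma conj_fixed: "t \<in> TJ \<Longrightarrow> t \<otimes> y \<otimes> \<theta> t = y \<longleftrightarrow> psi t = t"
proof -
  assume t: "t \<in> TJ"
  have "t \<otimes> y \<otimes> \<theta> t = (psi t \<otimes> t) \<otimes> y" using conj_eq [OF t] t by (simp add: m_assoc)
  also have "\<dots> = y \<longleftrightarrow> psi t \<otimes> t = \<one>"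
    using r_cancel_one [of y "psi t \<otimes> t"] t by simp
  also have "\<dots> \<longleftrightarrow> psi t = t"
    using t inv_equality [of "psi t" t] by auto
  finally show ?thesis .
qed

text \<open>\<open>t\<close> contributes nothing at \<open>psi t\<close> by
  \<open>linv_commuting_refl\<close>, and \<open>linv_psi\<close> returns from \<open>psi t\<close>
  to \<open>t\<close>.\<close>

lemma linv_conj:
  assumes t: "t \<in> TJ" "psi t \<noteq> t"
  shows "linv (t \<otimes> y) (psi t) \<longleftrightarrow> linv y t"
proof -
  have "inv t \<otimes> psi t \<otimes> t = psi t" using psi_commute [OF t(1)] t by (simp add: m_assoc)
  moreover have "\<not> linv t (psi t)"
    using linv_commuting_refl [of t "psi t"] psi_commute [OF t(1)] t by simp
  ultimately show ?thesis
    using linv_mult [of "psi t" t y] linv_psi [OF t(1)] t by simp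
qed

lemma len_conj_less:
  assumes t: "t \<in> TJ" "psi t \<noteq> t" "linv y t"
  shows "len (t \<otimes> y \<otimes> \<theta> t) < len y"
  using linv_conj [OF t(1,2)] conj_eq [OF t(1)] t(3) by simp

lemma len_conj_greater:
  assumes t: "t \<in> TJ" "psi t \<noteq> t" "\<not> linv y t"
  shows "len (t \<otimes> y) < len (t \<otimes> y \<otimes> \<theta> t)" "len y < len (t \<otimes> y)"
proof -
  have "len (psi t \<otimes> (t \<otimes> y)) \<noteq> len (t \<otimes> y)" "len (t \<otimes> y) \<noteq> len y"
    using len_refl_neq [of "psi t" "t \<otimes> y"] len_refl_neq [of t y] t by auto
  then show "len (t \<otimes> y) < len (t \<otimes> y \<otimes> \<theta> t)" "len y < len (t \<otimes> y)"
    using linv_conj [OF t(1,2)] conj_eq [OF t(1)] t(3) by auto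
qed

lemma len_conj_less_iff:
  "t \<in> TJ \<Longrightarrow> len (t \<otimes> y \<otimes> \<theta> t) < len y \<longleftrightarrow> psi t \<noteq> t \<and> linv y t"
  using len_conj_less [of t] len_conj_greater [of t] conj_fixed [of t] by fastforce

lemma len_conj_greater_iff:
  "t \<in> TJ \<Longrightarrow> len y < len (t \<otimes> y \<otimes> \<theta> t) \<longleftrightarrow> psi t \<noteq> t \<and> \<not> linv y t"
  using len_conj_less [of t] len_conj_greater [of t] conj_fixed [of t] by fastforce

lemma len_conj_gen:
  assumes "s \<in> J" "psi s \<noteq> s" "\<not> linv y s"
  shows "len (s \<otimes> y \<otimes> \<theta> s) = len y + 2"
proof -
  have "len (s \<otimes> y \<otimes> \<theta> s) \<le> len (s \<otimes> y) + 1" "len (s \<otimes> y) \<le> len y + 1"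
    using len_mult_le [of "s \<otimes> y" "\<theta> s"] len_mult_le [of s y] assms by auto
  then show ?thesis using len_conj_greater [of s] assms by simp
qed

text \<open>\<open>psi\<close> swaps \<open>r\<close> and \<open>s\<close>, so both conjugates are
  the product of these two commuting reflections with \<open>y\<close>.\<close>

lemma conj_eq_conj:
  assumes "r \<in> TJ" "s \<in> J" "psi s = r"
  shows "r \<otimes> y \<otimes> \<theta> r = s \<otimes> y \<otimes> \<theta> s"
proof -
  have "psi r = s" using assms psi_psi [of s] by simp
  then have "r \<otimes> y \<otimes> \<theta> r = s \<otimes> r \<otimes> y" "s \<otimes> y \<otimes> \<theta> s = r \<otimes> s \<otimes> y"
    using conj_eq [of r] conj_eq [of s] assms by (simp_all add: m_assoc)
  then show ?thesis using psi_commute [of s] assms by simp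
qed

lemma perfect_wact:
  assumes v: "v \<in> WJJ"
  shows "perfect_inv W S J (v \<otimes> y \<otimes> inv (\<theta> v)) \<theta>"
proof unfold_locales
  show "v \<otimes> y \<otimes> inv (\<theta> v) \<in> WJJ" using v by simp
  show "\<theta> \<in> autJ W J" by (rule \<theta>)
  show "\<theta> \<circ> \<theta> = id" by (rule \<theta>\<theta>)
  show "v \<otimes> y \<otimes> inv (\<theta> v) \<otimes> \<theta> (v \<otimes> y \<otimes> inv (\<theta> v)) = \<one>"
    using v by (simp add: th_mult th_inv th_y m_assoc)
  fix t assume t: "t \<in> TJ"
  let ?t = "inv v \<otimes> t \<otimes> v"
  have t': "?t \<in> TJ" using reflsJ_conj [OF JS t, of "inv v"] v by simp
  have e: "v \<otimes> y \<otimes> inv (\<theta> v) \<otimes> \<theta> t \<otimes> inv (v \<otimes> y \<otimes> inv (\<theta> v)) = v \<otimes> psi ?t \<otimes> inv v"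
    using v t by (simp add: psi_def th_mult th_inv m_assoc inv_mult_group)
  have "v \<otimes> psi ?t \<otimes> inv v \<otimes> t = v \<otimes> (psi ?t \<otimes> ?t) \<otimes> inv v"
    using v t by (simp add: m_assoc)
  also have "\<dots> = v \<otimes> (?t \<otimes> psi ?t) \<otimes> inv v" using psi_commute [OF t'] by simp
  also have "\<dots> = t \<otimes> (v \<otimes> psi ?t \<otimes> inv v)" using v t by (simp add: m_assoc)
  finally show "v \<otimes> y \<otimes> inv (\<theta> v) \<otimes> \<theta> t \<otimes> inv (v \<otimes> y \<otimes> inv (\<theta> v)) \<otimes> t =
       t \<otimes> (v \<otimes> y \<otimes> inv (\<theta> v) \<otimes> \<theta> t \<otimes> inv (v \<otimes> y \<otimes> inv (\<theta> v)))"
    using e by simp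
qed

end

context parabolic
begin

abbreviation "IJ \<equiv> perfect_invs W J"

lemma perfect_invs_iff: "z \<in> IJ \<longleftrightarrow> perfect_inv W S J (fst z) (snd z)"
proof
  assume z: "z \<in> IJ"
  obtain y \<theta> where yt: "z = (y, \<theta>)" by fastforce
  interpret twisted_inv W S J y \<theta>
    using z yt by unfold_locales (auto simp: perfect_invs_def pmult_def pone_def)
  show "perfect_inv W S J (fst z) (snd z)"
    unfolding yt fst_conv snd_conv
  proof unfold_locales
    fix t assume t: "t \<in> TJ"
    let ?zt = "pmult W z (t, id)"
    \<comment> \<open>\<open>(zt)^2\<close> lies in \<open>W_J\<close> and equals
      \<open>psi t\<close> times \<open>t\<close>; its square is one exactly when the two
      reflections commute.\<close>
    have q: "pmult W ?zt ?zt = (psi t \<otimes> t, id)"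
      using t by (simp add: yt pmult_def psi_def th_mult th_y m_assoc \<theta>\<theta>)
    have "pmult W (pmult W ?zt ?zt) (pmult W ?zt ?zt) = pone W"
      using z t by (auto simp: perfect_invs_def Let_def)
    then have "(psi t \<otimes> t) \<otimes> (psi t \<otimes> t) = \<one>"
      unfolding q by (simp add: pmult_def pone_def)
    then have "psi t \<otimes> t = inv (psi t \<otimes> t)" using t inv_equality [of "psi t \<otimes> t" "psi t \<otimes> t"] by simp
    also have "\<dots> = t \<otimes> psi t" using t by (simp add: inv_mult_group)
    finally show "y \<otimes> \<theta> t \<otimes> inv y \<otimes> t = t \<otimes> (y \<otimes> \<theta> t \<otimes> inv y)" by (simp add: psi_def)
  qed
next
  assume a: "perfect_inv W S J (fst z) (snd z)"
  obtain y \<theta> where yt: "z = (y, \<theta>)" by fastforce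
  interpret perfect_inv W S J y \<theta> using a yt by simp
  have "pmult W (pmult W zt zt) (pmult W zt zt) = pone W"
    if t: "t \<in> TJ" and zt: "zt = pmult W z (t, id)" for t zt
  proof -
    have q: "pmult W zt zt = (psi t \<otimes> t, id)"
      using t by (simp add: zt yt pmult_def psi_def th_mult th_y m_assoc \<theta>\<theta>)
    have "(psi t \<otimes> t) \<otimes> (psi t \<otimes> t) = (psi t \<otimes> t) \<otimes> (t \<otimes> psi t)"
      using psi_commute [OF t] by simp
    also have "\<dots> = \<one>" using t by (simp add: m_assoc)
    finally show ?thesis unfolding q by (simp add: pmult_def pone_def)
  qed
  then show "z \<in> IJ"
    using y\<theta> \<theta>\<theta> \<theta> y by (auto simp: perfect_invs_def yt pmult_def [of W "(y, \<theta>)" "(y, \<theta>)"] pone_def Let_def)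
qed

lemma perfect_invD: "z \<in> IJ \<Longrightarrow> perfect_inv W S J (fst z) (snd z)"
  by (simp add: perfect_invs_iff)

lemma zlen_eq: "z \<in> IJ \<Longrightarrow> zlen W J z = len (fst z)"
  using lenS_WJ [OF JS] by (auto simp: zlen_def perfect_invs_def)

lemma wact_closed: "\<lbrakk>z \<in> IJ; v \<in> WJJ\<rbrakk> \<Longrightarrow> wact W v z \<in> IJ"
  using perfect_inv.perfect_wact [OF perfect_invD] by (simp add: perfect_invs_iff wact_def)

lemma wact_one: "z \<in> IJ \<Longrightarrow> wact W \<one> z = z"
proof -
  assume z: "z \<in> IJ"
  interpret perfect_inv W S J "fst z" "snd z" by (rule perfect_invD [OF z])
  show ?thesis by (simp add: wact_def prod_eq_iff)
qed

lemma wact_mult: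
  assumes z: "z \<in> IJ" and u: "u \<in> WJJ" and v: "v \<in> WJJ"
  shows "wact W (u \<otimes> v) z = wact W u (wact W v z)"
proof -
  interpret perfect_inv W S J "fst z" "snd z" by (rule perfect_invD [OF z])
  show ?thesis using u v by (simp add: wact_def m_assoc th_mult inv_mult_group)
qed

lemma conjJ_eq: "conjJ W t z = (t \<otimes> fst z \<otimes> snd z t, snd z)"
  by (simp add: conjJ_def pmult_def)

lemma conjJ_wact:
  assumes z: "z \<in> IJ" and t: "t \<in> TJ"
  shows "conjJ W t z = wact W t z"
proof -
  interpret perfect_inv W S J "fst z" "snd z" by (rule perfect_invD [OF z])
  have "inv (snd z t) = snd z t" using refl_inv [of "snd z t"] th_TJ [OF t] by simp
  then show ?thesis by (simp add: conjJ_eq wact_def)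
qed

lemma conjJ_closed: "\<lbrakk>z \<in> IJ; t \<in> TJ\<rbrakk> \<Longrightarrow> conjJ W t z \<in> IJ"
  using wact_closed [of z t] conjJ_wact [of z t] by simp

lemma foldr_conjJ:
  "\<lbrakk>z \<in> IJ; set ws \<subseteq> J\<rbrakk> \<Longrightarrow> foldr (conjJ W) ws z = wact W (wprod W ws) z"
proof (induct ws)
  case (Cons s ws)
  then show ?case
    using conjJ_wact [OF wact_closed [OF Cons(2), of "wprod W ws"], of s]
      wact_mult [OF Cons(2), of s "wprod W ws"] wprod_WJJ [of ws] by simp
qed (simp add: wact_one)

lemma wact_eq_iff:
  assumes z: "z \<in> IJ" and u: "u \<in> WJJ" and v: "v \<in> WJJ"
  shows "wact W u z = wact W v z \<longleftrightarrow> wact W (inv u \<otimes> v) z = z"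
proof
  assume "wact W u z = wact W v z"
  then have "wact W (inv u) (wact W u z) = wact W (inv u) (wact W v z)" by simp
  then show "wact W (inv u \<otimes> v) z = z"
    using wact_mult [OF z, of "inv u" u] wact_mult [OF z, of "inv u" v] u v wact_one [OF z] by simp
next
  assume "wact W (inv u \<otimes> v) z = z"
  then have "wact W u (wact W (inv u \<otimes> v) z) = wact W u z" by simp
  then show "wact W u z = wact W v z"
    using wact_mult [OF z, of u "inv u \<otimes> v"] u v by simp
qed

lemma wact_fixed_iff:
  assumes z: "z \<in> IJ" and u: "u \<in> WJJ"
  shows "wact W u z = z \<longleftrightarrow> fst z \<otimes> snd z u \<otimes> inv (fst z) = u"
proof -
  interpret perfect_inv W S J "fst z" "snd z" by (rule perfect_invD [OF z])
  have c: "fst z \<in> carrier W" "snd z u \<in> carrier W" "u \<in> carrier W" using u by auto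
  have "wact W u z = z \<longleftrightarrow> u \<otimes> fst z \<otimes> inv (snd z u) = fst z"
    by (simp add: wact_def prod_eq_iff)
  also have "\<dots> \<longleftrightarrow> u \<otimes> fst z = fst z \<otimes> snd z u"
    using c by (metis inv_solve_right' m_closed)
  also have "\<dots> \<longleftrightarrow> fst z \<otimes> snd z u \<otimes> inv (fst z) = u"
    using c by (metis inv_solve_right' m_closed)
  finally show ?thesis .
qed

text \<open>Stated for every \<open>K \<subseteq> J\<close>: the full \<open>J\<close> serves the
  order and minimality, pairs of generators serve the braid relations.\<close>

lemma perfect_qpset:
  assumes K: "K \<subseteq> J"
  shows "generated_qpset IJ (reflsJ W K) K (conjJ W) (\<lambda>s r. s \<otimes> r \<otimes> s) (zlen W J)"
proof unfold_locales
  have KS: "K \<subseteq> S" using K JS by blast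
  have RT: "r \<in> TJ" if "r \<in> reflsJ W K" for r using that reflsJ_mono [OF K] by blast
  have KJ: "s \<in> J" if "s \<in> K" for s using that K by blast
  show "K \<subseteq> reflsJ W K" using reflsJ_gen [OF KS] by blast
  show "conjJ W r x \<in> IJ" if "r \<in> reflsJ W K" "x \<in> IJ" for r x
    using that RT conjJ_closed by blast
  show "conjJ W r (conjJ W r x) = x" if "r \<in> reflsJ W K" "x \<in> IJ" for r x
    using conjJ_wact [of x r] conjJ_wact [of "conjJ W r x" r] conjJ_closed [of x r]
      wact_mult [of x r r] wact_one [of x] RT [of r] that by simp
  show "s \<otimes> r \<otimes> s \<in> reflsJ W K" if "s \<in> K" "r \<in> reflsJ W K" for s r
    using reflsJ_conj_gen [OF KS] that by blast
  show cj: "conjJ W s (conjJ W r x) = conjJ W (s \<otimes> r \<otimes> s) (conjJ W s x)"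
    if "s \<in> K" "r \<in> reflsJ W K" "x \<in> IJ" for s r x
  proof -
    have s: "s \<in> J" "r \<in> TJ" "s \<otimes> r \<otimes> s \<in> TJ"
      using that RT [of r] KJ reflsJ_conj_gen [OF JS] by auto
    have "conjJ W s (conjJ W r x) = wact W (s \<otimes> r) x"
      using conjJ_wact [of x r] conjJ_wact [of "conjJ W r x" s] conjJ_closed [of x r]
        wact_mult [of x s r] s that by simp
    moreover have "conjJ W (s \<otimes> r \<otimes> s) (conjJ W s x) = wact W (s \<otimes> r \<otimes> s \<otimes> s) x"
      using conjJ_wact [of x s] conjJ_wact [of "conjJ W s x" "s \<otimes> r \<otimes> s"] conjJ_closed [of x s]
        wact_mult [of x "s \<otimes> r \<otimes> s" s] s that by simp
    moreover have "s \<otimes> r \<otimes> s \<otimes> s = s \<otimes> r" using s by (simp add: m_assoc)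
    ultimately show ?thesis by simp
  qed
  show qp1: "conjJ W r x = x" if "r \<in> reflsJ W K" "x \<in> IJ" "zlen W J (conjJ W r x) = zlen W J x" for r x
  proof -
    interpret perfect_inv W S J "fst x" "snd x" by (rule perfect_invD [OF that(2)])
    have r: "r \<in> TJ" using that RT by blast
    have "len (r \<otimes> fst x \<otimes> snd x r) = len (fst x)"
      using that r zlen_eq [OF that(2)] zlen_eq [OF conjJ_closed [OF that(2) r]] by (simp add: conjJ_eq)
    then have "psi r = r"
      using len_conj_less [OF r] len_conj_greater [OF r] by fastforce
    then show ?thesis using conj_fixed [OF r] by (simp add: conjJ_eq prod_eq_iff)
  qed
  show "conjJ W r x = conjJ W s x"
    if r: "r \<in> reflsJ W K" and s: "s \<in> K" and x: "x \<in> IJ" and up: "zlen W J x < zlen W J (conjJ W r x)"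
      and down: "zlen W J (conjJ W s (conjJ W r x)) < zlen W J (conjJ W s x)" for r s x
  proof (cases "r = s")
    case False
    interpret x: perfect_inv W S J "fst x" "snd x" by (rule perfect_invD [OF x])
    let ?y = "fst x" and ?th = "snd x"
    have rT: "r \<in> TJ" and sJ: "s \<in> J" using r s RT KJ by auto
    \<comment> \<open>For \<open>qp2\<close>: \<open>r\<close> is no inversion of \<open>y\<close>,
      but \<open>s r s\<close> is one of \<open>s y \<theta>(s)\<close>. Cancelling \<open>s\<close>
      and then \<open>y\<close> in the cocycle leaves \<open>y^-1 r y\<close> as an inversion of the
      generator \<open>\<theta>(s)\<close>, so the two are equal and
      \<open>psi s = r\<close>.\<close>
    define x1 where "x1 = conjJ W s x"
    define r1 where "r1 = s \<otimes> r \<otimes> s"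
    have x1: "x1 \<in> IJ" unfolding x1_def using conjJ_closed x sJ by simp
    interpret x1: perfect_inv W S J "fst x1" "snd x1" by (rule perfect_invD [OF x1])
    have r1: "r1 \<in> TJ" unfolding r1_def using reflsJ_conj_gen [OF JS rT sJ] .
    have "len ?y < len (r \<otimes> ?y \<otimes> ?th r)"
      using up zlen_eq [OF x] zlen_eq [OF conjJ_closed [OF x rT]] by (simp add: conjJ_eq)
    then have nl: "\<not> linv ?y r" using x.len_conj_greater_iff [OF rT] by simp
    have "zlen W J (conjJ W r1 x1) < zlen W J x1"
      using down cj [OF s r x] by (simp add: x1_def r1_def)
    then have "len (r1 \<otimes> fst x1 \<otimes> snd x1 r1) < len (fst x1)"
      using zlen_eq [OF x1] zlen_eq [OF conjJ_closed [OF x1 r1]] by (simp add: conjJ_eq)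
    then have l1: "linv (fst x1) r1" using x1.len_conj_less_iff [OF r1] by simp
    have rc: "r \<in> carrier W" "s \<in> carrier W" "s \<in> S" using rT sJ by auto
    have "r1 \<noteq> s"
    proof
      assume "r1 = s"
      then have "s \<otimes> r1 \<otimes> s = s" using rc by simp
      then show False using False rc by (simp add: r1_def m_assoc)
    qed
    then have "\<not> linv s r1" using linv_gen [of r1 s] r1 rc by simp
    moreover have "inv s \<otimes> r1 \<otimes> s = r" using rc by (simp add: r1_def m_assoc)
    moreover have "fst x1 = s \<otimes> (?y \<otimes> ?th s)" using sJ by (simp add: x1_def conjJ_eq m_assoc)
    ultimately have "linv (?y \<otimes> ?th s) r"
      using linv_mult [of r1 s "?y \<otimes> ?th s"] l1 r1 sJ by simp
    then have "linv (?th s) (inv ?y \<otimes> r \<otimes> ?y)"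
      using linv_mult [of r ?y "?th s"] nl rT sJ by simp
    then have e: "inv ?y \<otimes> r \<otimes> ?y = ?th s"
      using linv_gen [of "inv ?y \<otimes> r \<otimes> ?y" "?th s"] refl_conj' [of r ?y] rT sJ by simp
    have "x.psi s = r" unfolding x.psi_def e [symmetric] using rc by (simp add: m_assoc)
    then show ?thesis using x.conj_eq_conj [OF rT sJ] by (simp add: conjJ_eq)
  qed simp
  show "\<exists>ws. set ws \<subseteq> K \<and> conjJ W r x = foldr (conjJ W) ws x" if r: "r \<in> reflsJ W K" and x: "x \<in> IJ" for r x
  proof -
    obtain ws where ws: "set ws \<subseteq> K" "wprod W ws = r"
      using WJ_word [OF KS reflsJ_WJ [OF KS r]] by blast
    then have "foldr (conjJ W) ws x = conjJ W r x"
      using foldr_conjJ [OF x, of ws] conjJ_wact [OF x RT [OF r]] K by auto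
    then show ?thesis using ws by metis
  qed
qed

end

section \<open>The module of perfect involutions\<close>

context coxeter
begin

lemma gord_swap:
  assumes "s \<in> S" "t \<in> S" shows "gord W (t \<otimes> s) = gord W (s \<otimes> t)"
proof -
  have "t \<otimes> s = inv (s \<otimes> t)" using assms by (simp add: inv_mult_group)
  then have "(t \<otimes> s) [^] n = \<one> \<longleftrightarrow> (s \<otimes> t) [^] n = \<one>" for n :: nat
    using assms by (simp add: nat_pow_inv inv_eq_1_iff)
  then show ?thesis by (simp add: gord_def)
qed

lemma gord_commuting:
  assumes "s \<in> S" "t \<in> S" "s \<noteq> t" "s \<otimes> t = t \<otimes> s"
  shows "gord W (s \<otimes> t) = 2"
proof -
  have "(s \<otimes> t) \<otimes> (s \<otimes> t) = (s \<otimes> t) \<otimes> (t \<otimes> s)" using assms(4) by simp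
  also have "\<dots> = \<one>" using assms(1,2) by (simp add: m_assoc)
  finally have "(s \<otimes> t) [^] (2::nat) = \<one>" using assms(1,2) by (simp add: numeral_2_eq_2)
  then have "gord W (s \<otimes> t) \<le> 2" unfolding gord_def by (intro Least_le) simp
  moreover have "gord W (s \<otimes> t) \<noteq> 1"
  proof
    assume "gord W (s \<otimes> t) = 1"
    then have "(s \<otimes> t) [^] (1::nat) = \<one>" using gord_props [of "s \<otimes> t"] assms by simp
    then have "s \<otimes> t = \<one>" using assms by (simp del: One_nat_def) 
    then have "inv t = s" using assms by (intro inv_equality) auto
    then show False using assms by simp
  qed
  moreover have "0 < gord W (s \<otimes> t)" using gord_props [of "s \<otimes> t"] assms by simp
  ultimately show ?thesis by linarith
qed

text \<open>That \<open>sts\<close> commutes with \<open>t\<close> means \<open>(st)^4 = 1\<close>.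
  Order 1 would give \<open>s = t\<close>, order 2 commutation, and order 3 contradicts exponent
  4.\<close>

lemma gord_dvd_4:
  assumes st: "s \<in> S" "t \<in> S" "s \<noteq> t" and c: "(s \<otimes> t \<otimes> s) \<otimes> t = t \<otimes> (s \<otimes> t \<otimes> s)" and nc: "s \<otimes> t \<noteq> t \<otimes> s"
  shows "gord W (s \<otimes> t) = 4"
proof -
  let ?m = "gord W (s \<otimes> t)"
  have mp: "0 < ?m" "(s \<otimes> t) [^] ?m = \<one>" using gord_props [of "s \<otimes> t"] st by auto
  have inv_st: "inv (s \<otimes> t) = t \<otimes> s" using st by (simp add: inv_mult_group)
  have p2: "(s \<otimes> t) [^] (2::nat) = (s \<otimes> t) \<otimes> (s \<otimes> t)" using st by (simp add: numeral_2_eq_2)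
  have c': "(s \<otimes> t) \<otimes> (s \<otimes> t) = (t \<otimes> s) \<otimes> (t \<otimes> s)" using c st by (simp add: m_assoc)
  have "(s \<otimes> t) [^] (4::nat) = (s \<otimes> t) [^] (2::nat) \<otimes> (s \<otimes> t) [^] (2::nat)"
    using st by (simp add: nat_pow_mult)
  also have "\<dots> = ((s \<otimes> t) \<otimes> (s \<otimes> t)) \<otimes> ((t \<otimes> s) \<otimes> (t \<otimes> s))" using p2 c' by simp
  also have "\<dots> = \<one>" using st by (simp add: m_assoc)
  finally have p4: "(s \<otimes> t) [^] (4::nat) = \<one>" .
  then have "?m \<le> 4" unfolding gord_def by (intro Least_le) simp
  moreover have "?m \<noteq> 1"
  proof
    assume "?m = 1"
    then have "s \<otimes> t = \<one>" using mp(2) st by (simp del: One_nat_def)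
    then have "inv t = s" using st by (intro inv_equality) auto
    then show False using st by simp
  qed
  moreover have n2: "(s \<otimes> t) [^] (2::nat) \<noteq> \<one>"
  proof
    assume "(s \<otimes> t) [^] (2::nat) = \<one>"
    then have "inv (s \<otimes> t) = s \<otimes> t" using p2 st by (intro inv_equality) auto
    then show False using inv_st nc by simp
  qed
  moreover have "?m \<noteq> 3"
  proof
    assume "?m = 3"
    then have "(s \<otimes> t) [^] (3::nat) = \<one>" using mp by simp
    then have "s \<otimes> t = \<one>" using p4 nat_pow_mult [of "s \<otimes> t" 3 1] st by (simp del: One_nat_def)
    then have "inv t = s" using st by (intro inv_equality) auto
    then show False using st by simp
  qed
  ultimately show ?thesis using mp by (cases "?m = 2") auto
qed

end

lemma foldr_altw_eigen:
  assumes "lin (T s)" "lin (T t)" "T s e = sc \<alpha> e" "T t e = sc \<beta> e"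
  shows "foldr T (altw s t (2 * k)) e = sc ((\<alpha> * \<beta>) ^ k) e"
    and "foldr T (altw s t (Suc (2 * k))) e = sc (\<alpha> * (\<alpha> * \<beta>) ^ k) e"
proof -
  have *: "foldr T (altw a b (2 * k)) e = sc ((c * d) ^ k) e"
    if "lin (T a)" "lin (T b)" "T a e = sc c e" "T b e = sc d e" for a b c d
  proof (induct k)
    case (Suc k)
    have "foldr T (altw a b (2 * Suc k)) e = T a (T b (sc ((c * d) ^ k) e))"
      using Suc by simp
    also have "\<dots> = sc ((c * d) ^ Suc k) e"
      using slin_sc [OF that(1)] slin_sc [OF that(2)] that(3,4) by (simp add: mult_ac)
    finally show ?case .
  qed simp
  show "foldr T (altw s t (2 * k)) e = sc ((\<alpha> * \<beta>) ^ k) e" using * assms by blast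
  have "foldr T (altw s t (Suc (2 * k))) e = T s (sc ((\<beta> * \<alpha>) ^ k) e)"
    using * [OF assms(2,1,4,3)] by simp
  then show "foldr T (altw s t (Suc (2 * k))) e = sc (\<alpha> * (\<alpha> * \<beta>) ^ k) e"
    using slin_sc [OF assms(1)] assms(3) by (simp add: mult_ac)
qed

section \<open>The operators on perfect involutions and their braid relations\<close>

locale sigma_parabolic = parabolic +
  fixes \<sigma> :: "'a \<Rightarrow> int"
  assumes sigma_pm: "\<forall>u\<in>WJ W J. \<sigma> u \<in> {1, -1}"
    and sigma_hom: "\<forall>u\<in>WJ W J. \<forall>v\<in>WJ W J. \<sigma> (u \<otimes> v) = \<sigma> u * \<sigma> v"
begin

text \<open>The two roots of the quadratic relation: \<open>x\<close> belongs to
  \<open>DesE\<close>, \<open>-x^-1\<close> to \<open>AscE\<close>.\<close>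

definition lam where "lam u = (if \<sigma> u = 1 then xL else - xinv)"

lemma sigma_conj:
  assumes "u \<in> WJJ" "g \<in> WJJ" shows "\<sigma> (g \<otimes> u \<otimes> inv g) = \<sigma> u"
proof -
  have "\<sigma> (g \<otimes> u \<otimes> inv g \<otimes> g) = \<sigma> (g \<otimes> u \<otimes> inv g) * \<sigma> g"
    using sigma_hom assms by simp
  moreover have "g \<otimes> u \<otimes> inv g \<otimes> g = g \<otimes> u" using assms by (simp add: m_assoc)
  ultimately have "\<sigma> g * \<sigma> u = \<sigma> (g \<otimes> u \<otimes> inv g) * \<sigma> g"
    using sigma_hom assms by simp
  moreover have "\<sigma> g \<noteq> 0" using sigma_pm assms by force
  ultimately show ?thesis by simp
qed

lemma lam_cases: "lam u \<in> {xL, - xinv}"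
  by (simp add: lam_def)

lemma finite_IJ: "finite IJ"
proof -
  have fin: "finite WJJ" using finite_carrier by (rule finite_subset [rotated]) auto
  \<comment> \<open>Members of \<open>autJ\<close> are total functions; being the identity off
    \<open>W_J\<close>, they are determined by their graph over the finite set
    \<open>W_J\<close>.\<close>
  let ?g = "\<lambda>\<theta>::'a \<Rightarrow> 'a. {(u, \<theta> u) | u. u \<in> WJJ}"
  have inj: "inj_on ?g (autJ W J)"
  proof (rule inj_onI)
    fix \<theta> \<eta> assume a: "\<theta> \<in> autJ W J" "\<eta> \<in> autJ W J" "?g \<theta> = ?g \<eta>"
    show "\<theta> = \<eta>"
    proof
      fix u
      show "\<theta> u = \<eta> u"
      proof (cases "u \<in> WJJ")
        case True
        then have "(u, \<theta> u) \<in> ?g \<eta>" using a(3) by blast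
        then show ?thesis by blast
      next
        case False
        then show ?thesis using a(1,2) by (simp add: autJ_def)
      qed
    qed
  qed
  have "?g ` autJ W J \<subseteq> Pow (WJJ \<times> WJJ)"
    by (auto simp: autJ_def bij_betw_def)
  then have "finite (?g ` autJ W J)"
    by (rule finite_subset) (use fin in simp)
  then have "finite (autJ W J)" using inj by (rule finite_imageD)
  then have "finite (WJJ \<times> autJ W J)" using fin by simp
  moreover have "IJ \<subseteq> WJJ \<times> autJ W J" unfolding perfect_invs_def by auto
  ultimately show ?thesis by (rule finite_subset [rotated])
qed

abbreviation "VN \<equiv> supp_in IJ"

definition TN where
  "TN s = hecke_op IJ (conjJ W s) (\<lambda>z. zlen W J (conjJ W s z) < zlen W J z) (\<lambda>_. lam s)"

lemma TN_lin: "lin (TN s)"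
  unfolding TN_def by (rule hecke_op_lin)

lemma TN_V: "TN s f \<in> VN"
  unfolding TN_def by (rule hecke_op_supp)

lemma conjJ_invol: "\<lbrakk>s \<in> J; z \<in> IJ\<rbrakk> \<Longrightarrow> conjJ W s (conjJ W s z) = z"
proof -
  assume s: "s \<in> J" "z \<in> IJ"
  interpret q: generated_qpset IJ TJ J "conjJ W" "\<lambda>s r. s \<otimes> r \<otimes> s" "zlen W J"
    by (rule perfect_qpset) simp
  show ?thesis using q.a_invol s by simp
qed

lemma conjJ_fixed: "\<lbrakk>s \<in> J; z \<in> IJ\<rbrakk> \<Longrightarrow> conjJ W s z = z \<longleftrightarrow> zlen W J (conjJ W s z) = zlen W J z"
proof -
  assume s: "s \<in> J" "z \<in> IJ"
  interpret q: generated_qpset IJ TJ J "conjJ W" "\<lambda>s r. s \<otimes> r \<otimes> s" "zlen W J"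
    by (rule perfect_qpset) simp
  show ?thesis using q.qp1 [of s z] s by auto
qed

lemma TN_quad:
  assumes "s \<in> J" "f \<in> VN" shows "TN s (TN s f) = f + sc qL (TN s f)"
  unfolding TN_def
proof (rule hecke_op_quadratic [OF _ assms(2)])
  fix z assume z: "z \<in> IJ"
  have c: "conjJ W s z \<in> IJ" "conjJ W s (conjJ W s z) = z"
    using z assms conjJ_closed conjJ_invol by auto
  then show "conjJ W s z \<in> IJ \<and> conjJ W s (conjJ W s z) = z \<and>
      (conjJ W s z \<noteq> z \<longrightarrow> (zlen W J (conjJ W s (conjJ W s z)) < zlen W J (conjJ W s z))
         = (\<not> zlen W J (conjJ W s z) < zlen W J z)) \<and> lam s \<in> {xL, - xinv}"
    using conjJ_fixed [OF assms(1) z] lam_cases [of s] by auto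
qed

lemma TN_bvec:
  assumes "s \<in> J" "z \<in> IJ"
  shows "conjJ W s z = z \<Longrightarrow> TN s (bvec z) = sc (lam s) (bvec z)"
    and "zlen W J z < zlen W J (conjJ W s z) \<Longrightarrow> TN s (bvec z) = bvec (conjJ W s z)"
    and "zlen W J (conjJ W s z) < zlen W J z \<Longrightarrow> TN s (bvec z) = bvec (conjJ W s z) + sc qL (bvec z)"
proof -
  have i: "\<And>j. j \<in> IJ \<Longrightarrow> conjJ W s (conjJ W s j) = j" using assms conjJ_invol by blast
  have c: "conjJ W s z \<in> IJ" using assms conjJ_closed by simp
  note b = hecke_op_bvec [OF assms(2), of "conjJ W s", OF c i]
  show "conjJ W s z = z \<Longrightarrow> TN s (bvec z) = sc (lam s) (bvec z)"
    unfolding TN_def by (rule b(1))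
  show "zlen W J z < zlen W J (conjJ W s z) \<Longrightarrow> TN s (bvec z) = bvec (conjJ W s z)"
    unfolding TN_def by (rule b(2)) auto
  show "zlen W J (conjJ W s z) < zlen W J z \<Longrightarrow> TN s (bvec z) = bvec (conjJ W s z) + sc qL (bvec z)"
    unfolding TN_def by (rule b(3)) auto
qed

definition shortest where
  "shortest K z ws \<longleftrightarrow> set ws \<subseteq> K \<and>
    (\<forall>us. set us \<subseteq> K \<longrightarrow> foldr (conjJ W) us z = foldr (conjJ W) ws z \<longrightarrow> length ws \<le> length us)"

text \<open>Every letter of a shortest word is a strict ascent, so only the ascent rule is ever
  applied and basis vectors go to basis vectors.\<close>

lemma TN_shortest:
  assumes K: "K \<subseteq> J" and z: "qpset.orbit_min IJ K (conjJ W) (zlen W J) z"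
    and ws: "shortest K z ws"
  shows "foldr TN ws (bvec z) = bvec (foldr (conjJ W) ws z)"
proof -
  interpret q: generated_qpset IJ "reflsJ W K" K "conjJ W" "\<lambda>s r. s \<otimes> r \<otimes> s" "zlen W J"
    by (rule perfect_qpset [OF K])
  have zI: "z \<in> IJ" using z by (simp add: q.orbit_min_def)
  show ?thesis using ws
  proof (induct ws)
    case (Cons s ws)
    have sub: "set ws \<subseteq> K" "s \<in> K" "s \<in> J" using Cons.prems K by (auto simp: shortest_def)
    have "shortest K z ws"
      unfolding shortest_def
    proof (intro conjI allI impI)
      show "set ws \<subseteq> K" by (rule sub)
      fix us assume "set us \<subseteq> K" "foldr (conjJ W) us z = foldr (conjJ W) ws z"
      then have "set (s # us) \<subseteq> K" "foldr (conjJ W) (s # us) z = foldr (conjJ W) (s # ws) z"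
        using sub by auto
      then have "length (s # ws) \<le> length (s # us)"
        using Cons.prems unfolding shortest_def by blast
      then show "length ws \<le> length us" by simp
    qed
    then have IH: "foldr TN ws (bvec z) = bvec (foldr (conjJ W) ws z)" by (rule Cons.hyps)
    have "zlen W J (foldr (conjJ W) ws z) < zlen W J (foldr (conjJ W) (s # ws) z)"
      by (rule q.shortest_ascent [OF z]) (use Cons.prems in \<open>auto simp: shortest_def\<close>)
    then show ?case
      using IH TN_bvec(2) [OF sub(3) q.foldr_closed [OF sub(1) zI]] by simp
  qed simp
qed

lemma shortestI:
  assumes K: "K \<subseteq> J" and z: "z \<in> IJ" and ws: "set ws \<subseteq> K"
    and min: "\<And>u. \<lbrakk>u \<in> WJ W K; wact W u z = wact W (wprod W ws) z\<rbrakk> \<Longrightarrow> length ws \<le> len u"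
  shows "shortest K z ws"
  unfolding shortest_def
proof (intro conjI allI impI)
  show "set ws \<subseteq> K" by (rule ws)
  fix us assume us: "set us \<subseteq> K" "foldr (conjJ W) us z = foldr (conjJ W) ws z"
  have KS: "K \<subseteq> S" using K JS by blast
  have sub: "set us \<subseteq> J" "set ws \<subseteq> J" "set us \<subseteq> S" using us ws K JS by auto
  have "wact W (wprod W us) z = wact W (wprod W ws) z"
    using us(2) foldr_conjJ [OF z sub(1)] foldr_conjJ [OF z sub(2)] by simp
  then have "length ws \<le> len (wprod W us)" using min wprod_WJ [OF KS us(1)] by blast
  also have "\<dots> \<le> length us" by (rule len_le [OF sub(3)])
  finally show "length ws \<le> length us" .
qed

text \<open>If only \<open>s\<close> fixes \<open>z\<close>, the dihedral orbit is a path with \<open>gord W (s \<otimes> t)\<close> vertices,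
  whose two ends carry the same eigenvalue.\<close>
lemma TN_braid_path:
  assumes st: "s \<in> J" "t \<in> J" "s \<noteq> t"
    and z: "qpset.orbit_min IJ {s, t} (conjJ W) (zlen W J) z" "z \<in> IJ"
    and fixs: "conjJ W s z = z"
    and stab: "\<And>p. \<lbrakk>p \<in> WJ W {s, t}; wact W p z = z\<rbrakk> \<Longrightarrow> p \<in> {\<one>, s}"
  shows "foldr TN (altw s t (gord W (s \<otimes> t))) (bvec z) = foldr TN (altw t s (gord W (s \<otimes> t))) (bvec z)"
proof -
  let ?K = "{s, t}" and ?m = "gord W (s \<otimes> t)"
  have K: "?K \<subseteq> J" "?K \<subseteq> S" and stS: "s \<in> S" "t \<in> S" using st by auto
  have WJJ: "x \<in> WJJ" if "x \<in> WJ W ?K" for x using that WJ_mono [OF K(1)] by blast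
  obtain k where k: "?m = Suc k" using gord_props [of "s \<otimes> t"] stS by (cases ?m) auto
  \<comment> \<open>\<open>b\<close> carries \<open>z\<close> along the \<open>m - 1\<close> edges
    of the path to its far end, starting with \<open>t\<close> because \<open>s\<close> fixes
    \<open>z\<close>.\<close>
  define b where "b = inv (wprod W (altw t s k))"
  have aK: "wprod W (altw t s n) \<in> WJ W ?K" for n
    using altw_WJ [OF stS(2,1), of n] by (simp add: insert_commute)
  have a_c: "wprod W (altw t s n) \<in> carrier W" for n using WJJ [OF aK] by simp
  have bK: "b \<in> WJ W ?K" unfolding b_def using WJ_inv [OF K(2) aK] .
  have bJ: "b \<in> WJJ" using WJJ [OF bK] .
  have sub: "set (altw t s n) \<subseteq> ?K" for n using set_altw [of t s n] by auto
  have subS: "set (altw t s n) \<subseteq> S" for n using sub K(2) by blast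
  have lk: "len (wprod W (altw t s k)) = k"
    using len_altw [OF stS(2,1)] st(3) k gord_swap [OF stS] by simp
  have "shortest ?K z (rev (altw t s k))"
  proof (rule shortestI [OF K(1) z(2)])
    show "set (rev (altw t s k)) \<subseteq> ?K" using sub by simp
    fix u assume u: "u \<in> WJ W ?K" "wact W u z = wact W (wprod W (rev (altw t s k))) z"
    have bb: "wprod W (rev (altw t s k)) = b" using wprod_rev [OF subS] by (simp add: b_def)
    have "wact W (inv b \<otimes> u) z = z"
      using wact_eq_iff [OF z(2) bJ WJJ [OF u(1)]] u(2) bb by simp
    moreover have "inv b \<otimes> u \<in> WJ W ?K" using WJ_mult [OF K(2) WJ_inv [OF K(2) bK] u(1)] .
    \<comment> \<open>By the assumption on the stabiliser only \<open>b\<close> and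
      \<open>b s\<close> reach the far end; their lengths are \<open>m - 1\<close> and
      \<open>m\<close>, so no shorter word does.\<close>
    ultimately have e: "inv b \<otimes> u \<in> {\<one>, s}" using stab by blast
    have uc: "u \<in> carrier W" "b \<in> carrier W" using WJJ [OF u(1)] bJ by auto
    have u_eq: "u = b \<otimes> (inv b \<otimes> u)" using uc by simp
    have lb: "len b = k" using lk a_c by (simp add: b_def)
    have "len (b \<otimes> s) = Suc k"
    proof -
      have "b \<otimes> s = inv (wprod W (altw s t (Suc k)))"
        using stS a_c by (simp add: b_def inv_mult_group)
      moreover have "wprod W (altw s t (Suc k)) \<in> carrier W" using stS a_c by simp
      ultimately show ?thesis using len_altw [OF stS st(3), of "Suc k"] k by simp
    qed
    moreover have "u = b \<or> u = b \<otimes> s"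
    proof (cases "inv b \<otimes> u = \<one>")
      case True
      then show ?thesis using u_eq uc by (metis r_one)
    next
      case False
      then have "inv b \<otimes> u = s" using e by blast
      then show ?thesis using u_eq by simp
    qed
    ultimately have "k \<le> len u" using lb by auto
    then show "length (rev (altw t s k)) \<le> len u" by simp
  qed
  from TN_shortest [OF K(1) z(1) this]
  have top: "foldr TN (rev (altw t s k)) (bvec z) = bvec (wact W b z)"
    using foldr_conjJ [OF z(2), of "rev (altw t s k)"] sub [of k] K(1) wprod_rev [OF subS] by (simp add: b_def)
  \<comment> \<open>The generator fixing the far end: \<open>r b = b s\<close> is the braid relation
    read through inverses. So \<open>r\<close> is conjugate to \<open>s\<close> and has the same
    eigenvalue.\<close>
  define r where "r = (if even k then t else s)"
  have rJ: "r \<in> J" using st by (simp add: r_def)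
  have rc: "r \<in> S" "r \<in> WJJ" using rJ by auto
  have l1: "altw t s (Suc k) = altw t s k @ [r]" unfolding r_def by (rule altw_append_last)
  have rb: "r \<otimes> b = b \<otimes> s"
  proof -
    have "r \<otimes> b = inv (wprod W (altw t s (Suc k)))"
      unfolding l1 using rc subS a_c by (simp add: b_def inv_mult_group)
    also have "\<dots> = inv (wprod W (altw s t (Suc k)))" using altw_gord [OF stS] k by simp
    also have "\<dots> = b \<otimes> s" using stS a_c by (simp add: b_def inv_mult_group)
    finally show ?thesis .
  qed
  have s_z: "wact W s z = z" using conjJ_wact [OF z(2), of s] fixs st by simp
  have wI: "wact W b z \<in> IJ" using wact_closed [OF z(2) bJ] .
  have "conjJ W r (wact W b z) = wact W (r \<otimes> b) z"
    using conjJ_wact [OF wI, of r] wact_mult [OF z(2) rc(2) bJ] rJ by simp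
  also have "\<dots> = wact W b z"
    unfolding rb using wact_mult [OF z(2) bJ, of s] s_z st by simp
  finally have r_fix: "TN r (bvec (wact W b z)) = sc (lam r) (bvec (wact W b z))"
    using TN_bvec(1) [OF rJ wI] by simp
  have "r = b \<otimes> s \<otimes> inv b" using rb rc bJ st inv_solve_right [of r "b \<otimes> s" b] by simp
  then have lam: "lam r = lam s" using sigma_conj [of s b] bJ st by (simp add: lam_def)
  have "rev (altw s t ?m) = rev (altw t s k) @ [s]" by (simp add: k)
  then have "foldr TN (rev (altw s t ?m)) (bvec z) = foldr TN (rev (altw t s k)) (TN s (bvec z))" by simp
  also have "\<dots> = sc (lam s) (bvec (wact W b z))"
    using TN_bvec(1) [OF st(1) z(2) fixs] top slin_sc [OF lin_foldr [of "rev (altw t s k)" TN, OF TN_lin]]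
    by simp
  also have "\<dots> = foldr TN (rev (altw t s ?m)) (bvec z)"
    using r_fix lam top unfolding k l1 by simp
  finally have *: "foldr TN (rev (altw s t ?m)) (bvec z) = foldr TN (rev (altw t s ?m)) (bvec z)" .
  \<comment> \<open>Reversal swaps the two alternating words for even \<open>m\<close> and fixes
    each for odd \<open>m\<close>, so the identity for the reversed words suffices.\<close>
  show ?thesis
  proof (cases "even ?m")
    case True
    then have a: "altw s t ?m = rev (altw t s ?m)" using altw_eq_rev [of s t ?m] by argo
    then have b: "altw t s ?m = rev (altw s t ?m)" by (rule rev_swap [THEN iffD1, OF sym])
    have "foldr TN (altw s t ?m) (bvec z) = foldr TN (rev (altw t s ?m)) (bvec z)" by (simp only: a)
    also have "\<dots> = foldr TN (rev (altw s t ?m)) (bvec z)" by (rule * [symmetric])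
    also have "\<dots> = foldr TN (altw t s ?m) (bvec z)" by (simp only: b)
    finally show ?thesis .
  next
    case False
    then have a: "altw s t ?m = rev (altw s t ?m)" "altw t s ?m = rev (altw t s ?m)"
      using altw_eq_rev [of s t ?m] altw_eq_rev [of t s ?m] by argo+
    then show ?thesis using * by argo
  qed
qed

text \<open>With trivial stabiliser the orbit is a copy of the dihedral group, and both alternating
  words of length \<open>m\<close> are shortest words to the same vertex.\<close>

lemma TN_braid_free:
  assumes st: "s \<in> J" "t \<in> J" "s \<noteq> t"
    and z: "qpset.orbit_min IJ {s, t} (conjJ W) (zlen W J) z" "z \<in> IJ"
    and stab: "\<And>p. \<lbrakk>p \<in> WJ W {s, t}; wact W p z = z\<rbrakk> \<Longrightarrow> p = \<one>"
  shows "foldr TN (altw s t (gord W (s \<otimes> t))) (bvec z) = foldr TN (altw t s (gord W (s \<otimes> t))) (bvec z)"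
proof -
  let ?K = "{s, t}" and ?m = "gord W (s \<otimes> t)"
  have K: "?K \<subseteq> J" "?K \<subseteq> S" and stS: "s \<in> S" "t \<in> S" using st by auto
  have WJJ: "x \<in> WJJ" if "x \<in> WJ W ?K" for x using that WJ_mono [OF K(1)] by blast
  have *: "foldr TN (altw a b ?m) (bvec z) = bvec (wact W (wprod W (altw a b ?m)) z)"
    if ab: "a \<in> ?K" "b \<in> ?K" "len (wprod W (altw a b ?m)) = ?m" for a b
  proof -
    have sub: "set (altw a b ?m) \<subseteq> ?K" using set_altw [of a b ?m] ab by auto
    have wK: "wprod W (altw a b ?m) \<in> WJ W ?K" using wprod_WJ [OF K(2) sub] .
    have "shortest ?K z (altw a b ?m)"
    proof (rule shortestI [OF K(1) z(2) sub])
      fix u assume u: "u \<in> WJ W ?K" "wact W u z = wact W (wprod W (altw a b ?m)) z"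
      then have "wact W (inv u \<otimes> wprod W (altw a b ?m)) z = z"
        using wact_eq_iff [OF z(2) WJJ [OF u(1)] WJJ [OF wK]] by simp
      then have "inv u \<otimes> wprod W (altw a b ?m) = \<one>"
        using stab WJ_mult [OF K(2) WJ_inv [OF K(2) u(1)] wK] by blast
      then have "u = wprod W (altw a b ?m)"
        using WJJ [OF u(1)] WJJ [OF wK] by (metis WJJ_closed inv_cancel_right r_one)
      then show "length (altw a b ?m) \<le> len u" using ab by simp
    qed
    from TN_shortest [OF K(1) z(1) this] show ?thesis
      using foldr_conjJ [OF z(2), of "altw a b ?m"] sub K(1) by auto
  qed
  show ?thesis
    using * [of s t] * [of t s] altw_gord [OF stS] len_altw [OF stS st(3), of ?m] by simp
qed

text \<open>Either the stabiliser is \<open>{1, s}\<close> and the orbit is a path, or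
  \<open>psi t = s t s\<close>. In the second case \<open>m = 4\<close>, the orbit is
  \<open>{z, tzt}\<close>, and the relation is computed by hand on these two basis vectors.\<close>

lemma TN_braid_one_fixed:
  assumes st: "s \<in> J" "t \<in> J" "s \<noteq> t"
    and z: "qpset.orbit_min IJ {s, t} (conjJ W) (zlen W J) z" "z \<in> IJ"
    and fixs: "conjJ W s z = z" and movt: "conjJ W t z \<noteq> z"
    and tmin: "zlen W J z \<le> zlen W J (conjJ W t z)"
  shows "foldr TN (altw s t (gord W (s \<otimes> t))) (bvec z) = foldr TN (altw t s (gord W (s \<otimes> t))) (bvec z)"
proof -
  let ?K = "{s, t}" and ?m = "gord W (s \<otimes> t)" and ?y = "fst z"
  interpret z: perfect_inv W S J "fst z" "snd z" by (rule perfect_invD [OF z(2)])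
  have K: "?K \<subseteq> J" "?K \<subseteq> S" and stS: "s \<in> S" "t \<in> S" using st by auto
  have WJJ: "x \<in> WJJ" if "x \<in> WJ W ?K" for x using that WJ_mono [OF K(1)] by blast
  have fix_psi: "conjJ W a z = z \<longleftrightarrow> z.psi a = a" if "a \<in> J" for a
    using z.conj_fixed [of a] that by (simp add: conjJ_eq prod_eq_iff)
  have ps: "z.psi s = s" and pt: "z.psi t \<noteq> t" using fix_psi st fixs movt by auto
  have up_t: "zlen W J z < zlen W J (conjJ W t z)"
    using tmin movt conjJ_fixed [OF st(2) z(2)] by simp
  have ltn: "\<not> linv ?y t"
  proof -
    have "len ?y < len (t \<otimes> ?y \<otimes> snd z t)"
      using up_t zlen_eq [OF z(2)] zlen_eq [OF conjJ_closed [OF z(2), of t]] st by (simp add: conjJ_eq)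
    then show ?thesis using z.len_conj_greater_iff [of t] st by simp
  qed
  have wfix: "wact W p z = z \<longleftrightarrow> z.psi p = p" if "p \<in> WJ W ?K" for p
    using wact_fixed_iff [OF z(2) WJJ [OF that]] by (simp add: z.psi_def)
  show ?thesis
  proof (cases "z.psi t = s \<otimes> t \<otimes> s")
    case False
    have "p \<in> {\<one>, s}" if p: "p \<in> WJ W ?K" "wact W p z = z" for p
    proof (rule ccontr)
      assume n: "p \<notin> {\<one>, s}"
      have pp: "z.psi p = p" using wfix p by simp
      then have "p \<notin> {\<one>, s, t}" using n pt by auto
      show False
      proof (cases "linv ?y s")
        case ls: False
        have min: "left_min ?K ?y" using ls ltn by (simp add: left_min_def)
        have "z.psi t \<in> ?K"
          using z.kilmoyer_rank_two [OF st(1,2) min p(1)] pp p(1) \<open>p \<notin> {\<one>, s, t}\<close> by simp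
        then have "z.psi t = z.psi s" using pt ps by auto
        then show False using z.psi_inj [of t s] st by simp
      next
        case ls: True
        \<comment> \<open>If \<open>s\<close> is a descent of \<open>y\<close>, then
          \<open>y\<close> is not minimal in its coset, but \<open>s y\<close> will be;
          \<open>(s y, \<theta>)\<close> is a twisted involution because \<open>s\<close> commutes
          with \<open>z\<close>.\<close>
        have sy: "?y \<otimes> snd z s = s \<otimes> ?y" using z.psi_mult_y [of s] ps st by simp
        interpret z1: twisted_inv W S J "s \<otimes> ?y" "snd z"
        proof unfold_locales
          show "s \<otimes> ?y \<in> WJJ" using st by simp
          show "snd z \<in> autJ W J" by (rule z.\<theta>)
          show "snd z \<circ> snd z = id" by (rule z.\<theta>\<theta>)
          have "s \<otimes> ?y \<otimes> snd z (s \<otimes> ?y) = s \<otimes> (?y \<otimes> snd z s) \<otimes> snd z ?y"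
            using st by (simp add: z.th_mult m_assoc)
          also have "\<dots> = \<one>" unfolding sy using st z.y\<theta> by (simp add: m_assoc)
          finally show "s \<otimes> ?y \<otimes> snd z (s \<otimes> ?y) = \<one>" .
        qed
        have psi1: "z1.psi u = s \<otimes> z.psi u \<otimes> s" if "u \<in> WJJ" for u
          using that st by (simp add: z1.psi_def z.psi_def m_assoc inv_mult_group)
        have l1: "\<not> linv (s \<otimes> ?y) s" using ls st by auto
        have l2: "\<not> linv (s \<otimes> ?y) t"
        proof
          assume "linv (s \<otimes> ?y) t"
          then have "linv (?y \<otimes> snd z s) t" using sy by simp
          then have "linv (snd z s) (inv ?y \<otimes> t \<otimes> ?y)"
            using linv_mult [of t ?y "snd z s"] ltn st by simp
          then have "inv ?y \<otimes> t \<otimes> ?y = snd z s"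
            using linv_gen [of "inv ?y \<otimes> t \<otimes> ?y" "snd z s"] refl_conj' [of t ?y] st by simp
          then have "snd z (z.psi t) = snd z s" using z.th_psi [of t] st by simp
          then have "z.psi t = s" by (metis z.th_th)
          then have "z.psi t = z.psi s" using ps by simp
          then show False using z.psi_inj [of t s] st by simp
        qed
        have min: "left_min ?K (s \<otimes> ?y)" using l1 l2 st by (simp add: left_min_def)
        have sK: "s \<in> WJ W ?K" using WJ_gen [of s ?K] by simp
        have "z1.psi p \<in> WJ W ?K"
          using psi1 [OF WJJ [OF p(1)]] pp WJ_mult [OF K(2) WJ_mult [OF K(2) sK p(1)] sK] by simp
        then have "z1.psi t \<in> ?K"
          using z1.kilmoyer_rank_two [OF st(1,2) min p(1)] \<open>p \<notin> {\<one>, s, t}\<close> by simp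
        moreover have "z1.psi s = s" using psi1 [of s] ps st by simp
        then have "z1.psi t \<noteq> s" using z1.psi_inj [of t s] st by auto
        ultimately have "z1.psi t = t" by simp
        then have "s \<otimes> z.psi t \<otimes> s = t" using psi1 [of t] st by simp
        then have "s \<otimes> (s \<otimes> z.psi t \<otimes> s) \<otimes> s = s \<otimes> t \<otimes> s" by simp
        then have "z.psi t = s \<otimes> t \<otimes> s" using st by (simp add: m_assoc)
        then show False using False by simp
      qed
    qed
    then show ?thesis using TN_braid_path [OF st z fixs] by blast
  next
    case True
    have c: "(s \<otimes> t \<otimes> s) \<otimes> t = t \<otimes> (s \<otimes> t \<otimes> s)" using z.psi_commute [of t] st True by simp
    have nc: "s \<otimes> t \<noteq> t \<otimes> s"
    proof
      assume "s \<otimes> t = t \<otimes> s"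
      then have "s \<otimes> t \<otimes> s = t" using st by (simp add: m_assoc)
      then show False using True pt by simp
    qed
    have m4: "?m = Suc (Suc (Suc (Suc 0)))" using gord_dvd_4 [OF stS st(3) c nc] by simp
    let ?e = "bvec z" and ?f = "bvec (conjJ W t z)"
    have tI: "conjJ W t z \<in> IJ" using conjJ_closed z st by simp
    have te: "TN t ?e = ?f" using TN_bvec(2) [OF st(2) z(2) up_t] .
    have se: "TN s ?e = sc (lam s) ?e" using TN_bvec(1) [OF st(1) z(2) fixs] .
    have tf: "TN t ?f = ?e + sc qL ?f"
      using TN_bvec(3) [OF st(2) tI] conjJ_invol [OF st(2) z(2)] up_t by simp
    \<comment> \<open>\<open>tst\<close> is fixed by \<open>psi\<close> and hence fixes
      \<open>z\<close>; so \<open>s\<close> fixes \<open>tzt\<close>, and the orbit ends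
      there.\<close>
    have "conjJ W s (conjJ W t z) = conjJ W t z"
    proof -
      have tsx: "t \<otimes> s \<otimes> t \<in> WJ W ?K"
        using WJ_mult [OF K(2) WJ_mult [OF K(2)]] WJ_gen [of s ?K] WJ_gen [of t ?K] by simp
      have "z.psi (t \<otimes> s \<otimes> t) = (s \<otimes> t \<otimes> s) \<otimes> s \<otimes> (s \<otimes> t \<otimes> s)"
        using st by (simp add: z.psi_mult True ps)
      also have "\<dots> = ((s \<otimes> t \<otimes> s) \<otimes> t) \<otimes> s" using st by (simp add: m_assoc)
      also have "\<dots> = t \<otimes> s \<otimes> t" unfolding c using st by (simp add: m_assoc)
      finally have "wact W (t \<otimes> s \<otimes> t) z = z" using wfix [OF tsx] by simp
      then have "wact W t (wact W (t \<otimes> s \<otimes> t) z) = wact W t z" by simp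
      then have "wact W (s \<otimes> t) z = wact W t z"
        using wact_mult [OF z(2), of t "t \<otimes> s \<otimes> t"] st by (simp add: m_assoc)
      then show ?thesis
        using conjJ_wact [OF z(2), of t] conjJ_wact [OF tI, of s] wact_mult [OF z(2), of s t] st by simp
    qed
    then have sf: "TN s ?f = sc (lam s) ?f" using TN_bvec(1) [OF st(1) tI] by simp
    note ls = slin_sc [OF TN_lin] slin_add [OF TN_lin]
    show ?thesis
      unfolding m4 by (simp add: te se tf sf ls sc_add_right mult_ac)
  qed
qed

lemma TN_braid_min:
  assumes st: "s \<in> J" "t \<in> J" "s \<noteq> t"
    and z: "qpset.orbit_min IJ {s, t} (conjJ W) (zlen W J) z" 
  shows "foldr TN (altw s t (gord W (s \<otimes> t))) (bvec z) = foldr TN (altw t s (gord W (s \<otimes> t))) (bvec z)"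
proof -
  let ?K = "{s, t}" and ?m = "gord W (s \<otimes> t)" and ?y = "fst z"
  have K: "?K \<subseteq> J" "?K \<subseteq> S" and stS: "s \<in> S" "t \<in> S" using st by auto
  interpret q: generated_qpset IJ "reflsJ W ?K" ?K "conjJ W" "\<lambda>s r. s \<otimes> r \<otimes> s" "zlen W J"
    by (rule perfect_qpset [OF K(1)])
  have zI: "z \<in> IJ" using z by (simp add: q.orbit_min_def)
  have loc: "zlen W J z \<le> zlen W J (conjJ W a z)" if "a \<in> ?K" for a
  proof -
    have "set [a] \<subseteq> ?K" using that by simp
    then have "zlen W J z \<le> zlen W J (foldr (conjJ W) [a] z)"
      using z unfolding q.orbit_min_def by blast
    then show ?thesis by simp
  qed
  interpret z: perfect_inv W S J "fst z" "snd z" by (rule perfect_invD [OF zI])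
  have WJJ: "x \<in> WJJ" if "x \<in> WJ W ?K" for x using that WJ_mono [OF K(1)] by blast
  have fix_psi: "conjJ W a z = z \<longleftrightarrow> z.psi a = a" if "a \<in> J" for a
    using z.conj_fixed [of a] that by (simp add: conjJ_eq prod_eq_iff)
  consider "conjJ W s z = z" "conjJ W t z = z" | "conjJ W s z = z" "conjJ W t z \<noteq> z"
    | "conjJ W s z \<noteq> z" "conjJ W t z = z" | "conjJ W s z \<noteq> z" "conjJ W t z \<noteq> z" by blast
  then show ?thesis
  proof cases
    case 1
    have e: "TN s (bvec z) = sc (lam s) (bvec z)" "TN t (bvec z) = sc (lam t) (bvec z)"
      using TN_bvec(1) [OF _ zI] 1 st by auto
    show ?thesis
    proof (cases "even ?m")
      case True
      then obtain k where "?m = 2 * k" by blast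
      then show ?thesis
        using foldr_altw_eigen(1) [OF TN_lin TN_lin e] foldr_altw_eigen(1) [OF TN_lin TN_lin e(2,1)]
        by (simp add: mult.commute)
    next
      case False
      \<comment> \<open>For odd \<open>m\<close> the generators \<open>s\<close> and
        \<open>t\<close> are conjugate, so \<open>\<sigma>\<close> and the eigenvalues agree on
        them.\<close>
      then obtain k where k: "?m = Suc (2 * k)" by (metis oddE Suc_eq_plus1)
      let ?w = "wprod W (altw s t ?m)"
      have wJ: "?w \<in> WJJ" using WJJ [OF altw_WJ [OF stS]] .
      have "t \<otimes> ?w = wprod W (altw t s (Suc ?m))" by simp
      also have "\<dots> = wprod W (altw t s ?m) \<otimes> s"
        unfolding altw_append_last using False stS set_altw_S [OF stS(2,1)] by simp
      also have "\<dots> = ?w \<otimes> s" using altw_gord [OF stS] by simp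
      finally have "t = ?w \<otimes> s \<otimes> inv ?w"
        using inv_solve_right [of t "?w \<otimes> s" ?w] wJ stS by simp
      then have "\<sigma> t = \<sigma> s" using sigma_conj [of s ?w] wJ st by simp
      then have "lam t = lam s" by (simp add: lam_def)
      then show ?thesis
        using foldr_altw_eigen(2) [OF TN_lin TN_lin e] foldr_altw_eigen(2) [OF TN_lin TN_lin e(2,1)] k
        by (simp del: altw.simps)
    qed
  next
    case 2
    then show ?thesis using TN_braid_one_fixed [OF st z zI] loc by simp
  next
    case 3
    have z': "qpset.orbit_min IJ {t, s} (conjJ W) (zlen W J) z" using z by (simp add: insert_commute)
    show ?thesis
      using TN_braid_one_fixed [OF st(2,1) st(3) [symmetric] z' zI 3(2,1)] loc gord_swap [OF stS] by simp
  next
    case 4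
    have p: "z.psi s \<noteq> s" "z.psi t \<noteq> t" using 4 fix_psi st by auto
    have up: "zlen W J z < zlen W J (conjJ W a z)" if "a \<in> ?K" for a
      using loc [OF that] that 4 conjJ_fixed [of a z] zI st by fastforce
    have nl: "\<not> linv ?y a" if "a \<in> ?K" for a
    proof -
      have aJ: "a \<in> J" using that st by auto
      have "len ?y < len (a \<otimes> ?y \<otimes> snd z a)"
        using up [OF that] zlen_eq [OF zI] zlen_eq [OF conjJ_closed [OF zI, of a]] aJ by (simp add: conjJ_eq)
      then show ?thesis using z.len_conj_greater_iff [of a] aJ by simp
    qed
    have min: "left_min ?K ?y" using nl by (simp add: left_min_def)
    show ?thesis
    proof (cases "z.psi s = t")
      case True
      \<comment> \<open>Here \<open>m = 2\<close> and \<open>szs = tzt\<close>, so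
        \<open>TN s\<close> and \<open>TN t\<close> agree on the basis vector and both products
        follow from a quadratic relation.\<close>
      have "t \<otimes> s = s \<otimes> t" using z.psi_commute [of s] True st by simp
      then have m2: "?m = Suc (Suc 0)" using gord_commuting [OF stS st(3)] by simp
      have "conjJ W t z = conjJ W s z"
        using z.conj_eq_conj [OF _ st(1) True] st by (simp add: conjJ_eq)
      then have "TN t (bvec z) = TN s (bvec z)"
        using TN_bvec(2) [OF _ zI] up st by simp
      then show ?thesis unfolding m2
        using TN_quad [OF st(1), of "bvec z"] TN_quad [OF st(2), of "bvec z"] bvec_supp_in [OF zI] by simp
    next
      case False
      \<comment> \<open>A nontrivial stabiliser element cannot be \<open>s\<close> or
        \<open>t\<close>, as neither fixes \<open>z\<close>; any other would make \<open>psi\<close>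
        permute \<open>{s, t}\<close>, but \<open>psi s\<close> is neither \<open>s\<close> nor
        \<open>t\<close>.\<close>
      have "q = \<one>" if q: "q \<in> WJ W ?K" "wact W q z = z" for q
      proof (rule ccontr)
        assume "q \<noteq> \<one>"
        have "z.psi q = q" using wact_fixed_iff [OF zI WJJ [OF q(1)]] q(2) by (simp add: z.psi_def)
        then have "z.psi s \<in> ?K"
          using z.kilmoyer_rank_two [OF st(1,2) min q(1)] q(1) p \<open>q \<noteq> \<one>\<close> by auto
        then show False using p False by simp
      qed
      then show ?thesis by (rule TN_braid_free [OF st z zI])
    qed
  qed
qed

text \<open>Shortest words lead from the minimal vector of a dihedral orbit to all of its basis
  vectors, and \<open>braid_propagate\<close> carries the relation along each letter.\<close>

lemma TN_braid:
  assumes st: "s \<in> J" "t \<in> J" "s \<noteq> t" and v: "v \<in> VN"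
  shows "foldr TN (altw s t (gord W (s \<otimes> t))) v = foldr TN (altw t s (gord W (s \<otimes> t))) v"
proof (rule slin_eq_on [OF finite_IJ _ _ _ v])
  let ?K = "{s, t}" and ?m = "gord W (s \<otimes> t)"
  show "lin (foldr TN (altw s t ?m))" "lin (foldr TN (altw t s ?m))"
    by (rule lin_foldr [OF TN_lin])+
  have K: "?K \<subseteq> J" using st by auto
  interpret q: generated_qpset IJ "reflsJ W ?K" ?K "conjJ W" "\<lambda>s r. s \<otimes> r \<otimes> s" "zlen W J"
    by (rule perfect_qpset [OF K])
  fix x assume x: "x \<in> IJ"
  obtain z vs where z: "q.orbit_min z" "set vs \<subseteq> ?K" "x = foldr (conjJ W) vs z"
    by (rule q.orbit_min_exists [OF x])
  have "set vs \<subseteq> ?K \<and> foldr (conjJ W) vs z = x" using z(2) z(3) [symmetric] by (rule conjI)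
  from ex_has_least_nat [of "\<lambda>ws. set ws \<subseteq> ?K \<and> foldr (conjJ W) ws z = x", OF this, of length]
  obtain ws where ws: "set ws \<subseteq> ?K" "foldr (conjJ W) ws z = x"
    "\<forall>us. set us \<subseteq> ?K \<and> foldr (conjJ W) us z = x \<longrightarrow> length ws \<le> length us" by blast
  then have "shortest ?K z ws" unfolding shortest_def by blast
  then have e: "foldr TN ws (bvec z) = bvec x" using TN_shortest [OF K z(1)] ws(2) by simp
  have zI: "z \<in> IJ" using z(1) by (simp add: q.orbit_min_def)
  have m: "0 < ?m" using gord_props [of "s \<otimes> t"] st by simp
  have "foldr TN us (bvec z) \<in> VN \<and>
     foldr TN (altw s t ?m) (foldr TN us (bvec z)) = foldr TN (altw t s ?m) (foldr TN us (bvec z))"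
    if "set us \<subseteq> ?K" for us
    using that
  proof (induct us)
    case Nil
    then show ?case using TN_braid_min [OF st z(1)] bvec_supp_in [OF zI] by simp
  next
    case (Cons a us)
    let ?v = "foldr TN us (bvec z)"
    have IH: "?v \<in> VN" "foldr TN (altw s t ?m) ?v = foldr TN (altw t s ?m) ?v" using Cons by auto
    note pr = braid_propagate [where T = TN and V = VN and s = s and t = t, OF TN_lin TN_lin
        TN_quad [OF st(1)] TN_quad [OF st(2)] TN_V TN_V m IH]
    from Cons.prems have "a = s \<or> a = t" by auto
    then show ?case using pr TN_V by auto
  qed
  then show "foldr TN (altw s t ?m) (bvec x) = foldr TN (altw t s ?m) (bvec x)"
    using ws(1) e by metis
qed

end

section \<open>Representations of the Hecke algebra\<close>

context coxeter
begin

lemma WJ_S [simp]: "WJ W S = carrier W"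
  using coxeter by (simp add: WJ_def coxeter_system_def)

text \<open>Think of \<open>P w\<close> as \<open>H_w \<cdot> P \<one>\<close>; the two instances are the standard basis of the Hecke algebra
  and the elements \<open>H_w \<otimes> n\<close> of an induced module.\<close>
lemma regular_braid:
  assumes lin: "\<And>s. s \<in> S \<Longrightarrow> lin (T s)"
    and V: "\<And>s v. \<lbrakk>s \<in> S; v \<in> V\<rbrakk> \<Longrightarrow> T s v \<in> V"
    and quad: "\<And>s v. \<lbrakk>s \<in> S; v \<in> V\<rbrakk> \<Longrightarrow> T s (T s v) = v + sc qL (T s v)"
    and P: "\<And>w. w \<in> carrier W \<Longrightarrow> P w \<in> V"
    and up: "\<And>s w. \<lbrakk>s \<in> S; w \<in> carrier W; \<not> linv w s\<rbrakk> \<Longrightarrow> T s (P w) = P (s \<otimes> w)"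
    and st: "s \<in> S" "t \<in> S" "s \<noteq> t" and x: "x \<in> carrier W"
  shows "foldr T (altw s t (gord W (s \<otimes> t))) (P x) = foldr T (altw t s (gord W (s \<otimes> t))) (P x)"
proof -
  let ?K = "{s, t}" and ?m = "gord W (s \<otimes> t)"
  have K: "?K \<subseteq> S" using st by simp
  obtain v x0 where v: "v \<in> WJ W ?K" "left_min ?K x0" "x = v \<otimes> x0"
    by (rule left_min_exists [OF K x])
  have x0: "x0 \<in> carrier W" using v(2) by (simp add: left_min_def)
  \<comment> \<open>Above a minimal representative \<open>x0\<close> every reduced word in
    \<open>s\<close>, \<open>t\<close> climbs, so both alternating words end at the same value of
    \<open>P\<close>.\<close>
  have asc: "foldr T ws (P x0) = P (wprod W ws \<otimes> x0)"
    if "set ws \<subseteq> ?K" "length ws = len (wprod W ws)" for ws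
    using that
  proof (induct ws)
    case (Cons a ws)
    have a: "a \<in> S" "a \<in> ?K" "set ws \<subseteq> ?K" "set ws \<subseteq> S" "set (a # ws) \<subseteq> S" using Cons.prems K by auto
    note r = reduced_Cons [OF a(5) Cons.prems(2)]
    have w: "wprod W ws \<in> WJ W ?K" "wprod W ws \<in> carrier W" using wprod_WJ [OF K a(3)] a by auto
    have "\<not> linv (wprod W ws \<otimes> x0) a"
      using linv_left_min_mult [OF K w(1) v(2) reflsJ_gen [OF K a(2)]] r(2) by simp
    then show ?case using Cons.hyps [OF a(3) r(1)] up [OF a(1), of "wprod W ws \<otimes> x0"] w a x0
      by (simp add: m_assoc)
  qed (use x0 in simp)
  have sub: "set (altw s t ?m) \<subseteq> ?K" "set (altw t s ?m) \<subseteq> ?K"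
    using set_altw [of s t ?m] set_altw [of t s ?m] by auto
  have base: "foldr T (altw s t ?m) (P x0) = foldr T (altw t s ?m) (P x0)"
    using asc [OF sub(1)] asc [OF sub(2)] altw_gord [OF st(1,2)] len_altw [OF st, of ?m] by simp
  have m: "0 < ?m" using gord_props [of "s \<otimes> t"] st by simp
  have spread: "foldr T us (P x0) \<in> V \<and>
     foldr T (altw s t ?m) (foldr T us (P x0)) = foldr T (altw t s ?m) (foldr T us (P x0))"
    if "set us \<subseteq> ?K" for us
    using that
  proof (induct us)
    case Nil
    then show ?case using base P [OF x0] by simp
  next
    case (Cons a us)
    let ?v = "foldr T us (P x0)"
    have IH: "?v \<in> V" "foldr T (altw s t ?m) ?v = foldr T (altw t s ?m) ?v" using Cons by auto
    note pr = braid_propagate [where T = T and V = V and s = s and t = t, OF lin [OF st(1)] lin [OF st(2)]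
        quad [OF st(1)] quad [OF st(2)] V [OF st(1)] V [OF st(2)] m IH]
    from Cons.prems have "a = s \<or> a = t" by auto
    then show ?case using pr V IH st by auto
  qed
  obtain ws where ws: "set ws \<subseteq> ?K" "length ws = len v" "wprod W ws = v"
    using reduced_WJ_word [OF K v(1)] by blast
  then have "foldr T ws (P x0) = P x" using asc v(3) by simp
  then show ?thesis using spread [OF ws(1)] by simp
qed

end

text \<open>Instantiated three times: \<open>J\<close> acting on perfect involutions,
  \<open>S\<close> on the Hecke algebra and \<open>S\<close> on the induced module. \<open>V\<close>
  is explicit because coefficient functions are total, while the relations hold only for those of
  the right support.\<close>

locale hecke_rep = coxeter +
  fixes K :: "'a set" and T :: "'a \<Rightarrow> ('i \<Rightarrow> laurent) \<Rightarrow> ('i \<Rightarrow> laurent)" and V :: "('i \<Rightarrow> laurent) set"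
  assumes KS: "K \<subseteq> S"
    and T_lin: "s \<in> K \<Longrightarrow> lin (T s)"
    and T_V: "\<lbrakk>s \<in> K; v \<in> V\<rbrakk> \<Longrightarrow> T s v \<in> V"
    and V_diff: "\<lbrakk>u \<in> V; v \<in> V\<rbrakk> \<Longrightarrow> u - v \<in> V"
    and V_sc: "v \<in> V \<Longrightarrow> sc p v \<in> V"
    and T_quad: "\<lbrakk>s \<in> K; v \<in> V\<rbrakk> \<Longrightarrow> T s (T s v) = v + sc qL (T s v)"
    and T_braid: "\<lbrakk>s \<in> K; t \<in> K; s \<noteq> t; v \<in> V\<rbrakk> \<Longrightarrow>
      foldr T (altw s t (gord W (s \<otimes> t))) v = foldr T (altw t s (gord W (s \<otimes> t))) v"
begin

definition kword where "kword w = (SOME ws. set ws \<subseteq> K \<and> wprod W ws = w \<and> length ws = len w)"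

definition Tw where "Tw w = foldr T (kword w)"

text \<open>The inverse of \<open>T s\<close> by the quadratic relation, that is, the action of
  \<open>bar H_s\<close>.\<close>

definition U where "U s v = T s v - sc qL v"

text \<open>The action of \<open>bar H_w\<close>. It is inverse to \<open>H_(w^-1)\<close>, so the
  factors come in the order of a word for \<open>w\<close>.\<close>

definition Uw where "Uw w = foldr U (kword w)"

lemma kword:
  assumes "w \<in> WJ W K"
  shows "set (kword w) \<subseteq> K" "wprod W (kword w) = w" "length (kword w) = len w"
proof -
  have "\<exists>ws. set ws \<subseteq> K \<and> wprod W ws = w \<and> length ws = len w"
    using reduced_WJ_word [OF KS assms] by blast
  from someI_ex [OF this]
  show "set (kword w) \<subseteq> K" "wprod W (kword w) = w" "length (kword w) = len w"
    by (simp_all add: kword_def)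
qed

lemma foldr_T_V: "\<lbrakk>set ws \<subseteq> K; v \<in> V\<rbrakk> \<Longrightarrow> foldr T ws v \<in> V"
  by (induct ws) (auto intro: T_V)

lemma foldr_T_lin: "set ws \<subseteq> K \<Longrightarrow> lin (foldr T ws)"
  using T_lin by (intro lin_foldr) auto

lemma Tw_lin: "w \<in> WJ W K \<Longrightarrow> lin (Tw w)"
  unfolding Tw_def using kword(1) by (rule foldr_T_lin)

lemma Tw_V: "\<lbrakk>w \<in> WJ W K; v \<in> V\<rbrakk> \<Longrightarrow> Tw w v \<in> V"
  unfolding Tw_def using kword(1) by (rule foldr_T_V)

lemma Tw_word:
  assumes "set ws \<subseteq> K" "length ws = len (wprod W ws)" "v \<in> V"
  shows "foldr T ws v = Tw (wprod W ws) v"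
proof -
  have w: "wprod W ws \<in> WJ W K" using wprod_WJ [OF KS assms(1)] .
  show ?thesis
    unfolding Tw_def
    by (rule matsumoto [OF KS T_V T_braid])
      (simp_all add: assms kword [OF w])
qed

lemma Tw_one [simp]: "v \<in> V \<Longrightarrow> Tw \<one> v = v"
  using Tw_word [of "[]" v] by simp

lemma Tw_gen: "\<lbrakk>s \<in> K; v \<in> V\<rbrakk> \<Longrightarrow> Tw s v = T s v"
  using Tw_word [of "[s]" v] KS by (auto simp: subset_iff)

lemma T_Tw_up:
  assumes s: "s \<in> K" and w: "w \<in> WJ W K" and v: "v \<in> V" and "\<not> linv w s"
  shows "T s (Tw w v) = Tw (s \<otimes> w) v"
proof -
  have sS: "s \<in> S" and wc: "w \<in> carrier W" using s KS w WJ_closed [OF KS w] by auto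
  note k = kword [OF w]
  have "len (s \<otimes> w) = len w + 1" using len_gen_mult(1) [OF sS wc] assms(4) by simp
  then have "length (s # kword w) = len (wprod W (s # kword w))" using k by simp
  moreover have "set (s # kword w) \<subseteq> K" using k s by simp
  ultimately have "foldr T (s # kword w) v = Tw (wprod W (s # kword w)) v" using Tw_word v by blast
  then show ?thesis using k by (simp add: Tw_def)
qed

lemma T_Tw_down:
  assumes s: "s \<in> K" and w: "w \<in> WJ W K" and v: "v \<in> V" and l: "linv w s"
  shows "T s (Tw w v) = Tw (s \<otimes> w) v + sc qL (Tw w v)"
proof -
  have sS: "s \<in> S" and wc: "w \<in> carrier W" using s KS w WJ_closed [OF KS w] by auto
  have sw: "s \<otimes> w \<in> WJ W K" using WJ_mult [OF KS WJ_gen [OF s] w] .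
  have "\<not> linv (s \<otimes> w) s" using l sS wc by simp
  then have "T s (Tw (s \<otimes> w) v) = Tw w v" using T_Tw_up [OF s sw v] sS wc by simp
  then show ?thesis using T_quad [OF s Tw_V [OF sw v]] by simp
qed

lemma U_V: "\<lbrakk>s \<in> K; v \<in> V\<rbrakk> \<Longrightarrow> U s v \<in> V"
  by (simp add: U_def V_diff V_sc T_V)

lemma U_lin: "s \<in> K \<Longrightarrow> lin (U s)"
  using T_lin [of s] by (simp add: slin_def U_def sc_add_right sc_minus_right mult.commute)

lemma U_T [simp]: "\<lbrakk>s \<in> K; v \<in> V\<rbrakk> \<Longrightarrow> U s (T s v) = v"
  by (simp add: U_def T_quad)

lemma T_U [simp]: "\<lbrakk>s \<in> K; v \<in> V\<rbrakk> \<Longrightarrow> T s (U s v) = v"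
  using slin_minus [OF T_lin, of s "T s v" "sc qL v"] slin_sc [OF T_lin, of s qL v]
  by (simp add: U_def T_quad)

lemma foldr_U_V: "\<lbrakk>set ws \<subseteq> K; v \<in> V\<rbrakk> \<Longrightarrow> foldr U ws v \<in> V"
  by (induct ws) (auto intro: U_V)

lemma foldr_U_lin: "set ws \<subseteq> K \<Longrightarrow> lin (foldr U ws)"
  using U_lin by (intro lin_foldr) auto

lemma foldr_T_U: "\<lbrakk>set ws \<subseteq> K; v \<in> V\<rbrakk> \<Longrightarrow> foldr T (rev ws) (foldr U ws v) = v"
  by (induct ws) (simp_all add: foldr_U_V)

lemma foldr_U_T: "\<lbrakk>set ws \<subseteq> K; v \<in> V\<rbrakk> \<Longrightarrow> foldr U ws (foldr T (rev ws) v) = v"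
proof (induct ws rule: rev_induct)
  case (snoc a ws)
  then show ?case using foldr_T_V [of "rev ws" v] by simp
qed simp

text \<open>Independence of the reduced word is inherited from \<open>T\<close>:
  \<open>foldr U ws\<close> inverts \<open>foldr T (rev ws)\<close>, which depends only on the
  product of the word.\<close>

lemma Uw_word:
  assumes ws: "set ws \<subseteq> K" "length ws = len (wprod W ws)" and v: "v \<in> V"
  shows "foldr U ws v = Uw (wprod W ws) v"
proof -
  have w: "wprod W ws \<in> WJ W K" using wprod_WJ [OF KS ws(1)] .
  note k = kword [OF w]
  have S: "set ws \<subseteq> S" "set (kword (wprod W ws)) \<subseteq> S" using ws k KS by auto
  have wc: "wprod W ws \<in> carrier W" using S by simp
  have x: "foldr U ws v \<in> V" using foldr_U_V [OF ws(1) v] .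
  have "foldr T (rev ws) (foldr U ws v) = foldr T (rev (kword (wprod W ws))) (foldr U ws v)"
    using Tw_word [of "rev ws", OF _ _ x] Tw_word [of "rev (kword (wprod W ws))", OF _ _ x] ws k S wc
    by (simp add: wprod_rev)
  then have "foldr T (rev (kword (wprod W ws))) (foldr U ws v) = v"
    using foldr_T_U [OF ws(1) v] by simp
  then have "foldr U (kword (wprod W ws)) v = foldr U ws v"
    using foldr_U_T [OF k(1) x] by simp
  then show ?thesis by (simp add: Uw_def)
qed

lemma Uw_gen: "\<lbrakk>s \<in> K; v \<in> V\<rbrakk> \<Longrightarrow> Uw s v = U s v"
  using Uw_word [of "[s]" v] KS by (auto simp: subset_iff)

lemma Uw_V: "\<lbrakk>w \<in> WJ W K; v \<in> V\<rbrakk> \<Longrightarrow> Uw w v \<in> V"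
  unfolding Uw_def using kword(1) by (rule foldr_U_V)

lemma Uw_lin: "w \<in> WJ W K \<Longrightarrow> lin (Uw w)"
  unfolding Uw_def using kword(1) by (rule foldr_U_lin)

lemma Uw_mult:
  assumes u: "u \<in> WJ W K" and w: "w \<in> WJ W K" and l: "len (u \<otimes> w) = len u + len w" and v: "v \<in> V"
  shows "Uw (u \<otimes> w) v = Uw u (Uw w v)"
proof -
  note k = kword [OF u] kword [OF w]
  have S: "set (kword u) \<subseteq> S" "set (kword w) \<subseteq> S" using k KS by auto
  have "set (kword u @ kword w) \<subseteq> K" using k by simp
  moreover have p: "wprod W (kword u @ kword w) = u \<otimes> w" using k S by simp
  moreover have "length (kword u @ kword w) = len (wprod W (kword u @ kword w))"
    unfolding p using k l by simp
  ultimately have "foldr U (kword u @ kword w) v = Uw (u \<otimes> w) v" using Uw_word v by metis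
  then show ?thesis by (simp add: Uw_def)
qed

lemma U_Uw:
  assumes s: "s \<in> K" and w: "w \<in> WJ W K" and "\<not> linv w s" and v: "v \<in> V"
  shows "U s (Uw w v) = Uw (s \<otimes> w) v"
proof -
  have "s \<in> S" "w \<in> carrier W" using s KS w WJ_closed [OF KS w] by auto
  then have "len (s \<otimes> w) = len s + len w" using len_gen_mult(1) [of s w] assms(3) by simp
  then show ?thesis using Uw_mult [OF WJ_gen [OF s] w _ v] Uw_gen [OF s Uw_V [OF w v]] by simp
qed

lemma Uw_U:
  assumes s: "s \<in> K" and w: "w \<in> WJ W K" and "len (w \<otimes> s) = len w + 1" and v: "v \<in> V"
  shows "Uw w (U s v) = Uw (w \<otimes> s) v"
proof -
  have "s \<in> S" using s KS by auto
  then show ?thesis using Uw_mult [OF w WJ_gen [OF s] _ v] Uw_gen [OF s v] assms(3) by simp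
qed

text \<open>If \<open>s\<close> lengthens \<open>w\<close>, both sides are \<open>Uw\<close> of
  \<open>s w = w r\<close>. Otherwise \<open>w = s u = u r\<close> with \<open>u\<close> shorter,
  and both sides are \<open>U s\<close>, \<open>Uw u\<close>, \<open>U r\<close> in
  succession.\<close>

lemma U_Uw_commute:
  assumes s: "s \<in> K" and r: "r \<in> K" and w: "w \<in> WJ W K" and e: "s \<otimes> w = w \<otimes> r" and v: "v \<in> V"
  shows "U s (Uw w v) = Uw w (U r v)"
proof -
  have c: "s \<in> S" "r \<in> S" "w \<in> carrier W" using s r KS w WJ_closed [OF KS w] by auto
  show ?thesis
  proof (cases "linv w s")
    case False
    then have "len (w \<otimes> r) = len w + 1" using len_gen_mult(1) [OF c(1,3)] e by simp
    then show ?thesis using U_Uw [OF s w False v] Uw_U [OF r w _ v] e by simp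
  next
    case True
    define u where "u = s \<otimes> w"
    have u: "u \<in> WJ W K" unfolding u_def using WJ_mult [OF KS WJ_gen [OF s] w] .
    have uc: "u \<in> carrier W" using WJ_closed [OF KS u] .
    have w1: "w = s \<otimes> u" using c by (simp add: u_def)
    have w2: "w = u \<otimes> r" using c e by (simp add: u_def m_assoc)
    have n: "\<not> linv u s" using True c by (simp add: u_def)
    have l: "len (u \<otimes> r) = len u + 1" using len_gen_mult(1) [OF c(1) uc] n w1 w2 by simp
    have "Uw w v = Uw u (U r v)" using Uw_U [OF r u l v] w2 by simp
    moreover have "Uw w (U r v) = U s (Uw u (U r v))"
      using U_Uw [OF s u n U_V [OF r v]] w1 by simp
    ultimately show ?thesis by simp
  qed
qed

end

section \<open>The regular representation\<close>

context coxeter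
begin

lemma heckeH_eq: "heckeH W = supp_in (carrier W)"
  by (simp add: heckeH_def supp_in_def)

lemma Ls_eq:
  assumes "s \<in> S"
  shows "Ls W S s = hecke_op (carrier W) (\<lambda>v. s \<otimes> v) (\<lambda>v. linv v s) (\<lambda>_. xL)"
proof (intro ext)
  fix h v
  have "s \<otimes> v \<noteq> v" if "v \<in> carrier W"
    using len_refl_neq [of s v] assms that by auto
  then show "Ls W S s h v = hecke_op (carrier W) (\<lambda>v. s \<otimes> v) (\<lambda>v. linv v s) (\<lambda>_. xL) h v"
    by (simp add: Ls_def hecke_op_def)
qed

lemma Ls_bvec:
  assumes "s \<in> S" "w \<in> carrier W"
  shows "\<not> linv w s \<Longrightarrow> Ls W S s (bvec w) = bvec (s \<otimes> w)"
    and "linv w s \<Longrightarrow> Ls W S s (bvec w) = bvec (s \<otimes> w) + sc qL (bvec w)"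
proof -
  have ne: "s \<otimes> w \<noteq> w" using len_refl_neq [of s w] assms by auto
  have c: "s \<otimes> w \<in> carrier W" "\<And>j. j \<in> carrier W \<Longrightarrow> s \<otimes> (s \<otimes> j) = j" using assms by auto
  note b = hecke_op_bvec [OF assms(2), of "\<lambda>v. s \<otimes> v", OF c]
  show "\<not> linv w s \<Longrightarrow> Ls W S s (bvec w) = bvec (s \<otimes> w)"
    unfolding Ls_eq [OF assms(1)] by (rule b(2)) (use ne in auto)
  show "linv w s \<Longrightarrow> Ls W S s (bvec w) = bvec (s \<otimes> w) + sc qL (bvec w)"
    unfolding Ls_eq [OF assms(1)] by (rule b(3)) (use ne in auto)
qed

lemma Ls_quad:
  assumes "s \<in> S" "v \<in> supp_in (carrier W)"
  shows "Ls W S s (Ls W S s v) = v + sc qL (Ls W S s v)"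
  unfolding Ls_eq [OF assms(1)]
proof (rule hecke_op_quadratic [OF _ assms(2)])
  fix i assume "i \<in> carrier W"
  then show "s \<otimes> i \<in> carrier W \<and> s \<otimes> (s \<otimes> i) = i \<and> (s \<otimes> i \<noteq> i \<longrightarrow>
      linv (s \<otimes> i) s = (\<not> linv i s)) \<and> xL \<in> {xL, - xinv}"
    using assms(1) len_refl_neq [of s i] by auto
qed

lemma hecke_regular: "hecke_rep W S S (Ls W S) (heckeH W)"
  unfolding heckeH_eq
proof unfold_locales
  show "S \<subseteq> S" by simp
  show lin: "lin (Ls W S s)" if "s \<in> S" for s
    unfolding Ls_eq [OF that] by (rule hecke_op_lin)
  show V: "Ls W S s v \<in> supp_in (carrier W)" if "s \<in> S" "v \<in> supp_in (carrier W)" for s v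
    unfolding Ls_eq [OF that(1)] by (rule hecke_op_supp)
  show "u - v \<in> supp_in (carrier W)" if "u \<in> supp_in (carrier W)" "v \<in> supp_in (carrier W)" for u v
    :: "'a \<Rightarrow> laurent" using that by (rule supp_in_diff)
  show "sc p v \<in> supp_in (carrier W)" if "v \<in> supp_in (carrier W)" for p and v :: "'a \<Rightarrow> laurent"
    using that by (rule supp_in_sc)
  show quad: "Ls W S s (Ls W S s v) = v + sc qL (Ls W S s v)"
    if "s \<in> S" "v \<in> supp_in (carrier W)" for s v
    using Ls_quad that by blast
  show "foldr (Ls W S) (altw s t (gord W (s \<otimes> t))) v = foldr (Ls W S) (altw t s (gord W (s \<otimes> t))) v"
    if st: "s \<in> S" "t \<in> S" "s \<noteq> t" and v: "v \<in> supp_in (carrier W)" for s t v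
  proof (rule slin_eq_on [OF finite_carrier _ _ _ v])
    show "lin (foldr (Ls W S) (altw s t (gord W (s \<otimes> t))))"
      using set_altw [of s t] st lin by (intro lin_foldr) blast
    show "lin (foldr (Ls W S) (altw t s (gord W (s \<otimes> t))))"
      using set_altw [of t s] st lin by (intro lin_foldr) blast
    fix w assume w: "w \<in> carrier W"
    show "foldr (Ls W S) (altw s t (gord W (s \<otimes> t))) (bvec w) =
       foldr (Ls W S) (altw t s (gord W (s \<otimes> t))) (bvec w)"
      by (rule regular_braid [where V = "supp_in (carrier W)", OF lin V quad _ _ st w])
        (auto simp: bvec_supp_in Ls_bvec)
  qed
qed

end

section \<open>The induced module on \<open>K^J\<close>\<close>

context sigma_parabolic
begin

sublocale N: hecke_rep W S J TN VN
proof unfold_locales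
  show "J \<subseteq> S" by (rule JS)
  show "lin (TN s)" for s by (rule TN_lin)
  show "TN s v \<in> VN" for s v by (rule TN_V)
  show "u - v \<in> VN" if "u \<in> VN" "v \<in> VN" for u v using that by (rule supp_in_diff)
  show "sc p v \<in> VN" if "v \<in> VN" for p v using that by (rule supp_in_sc)
  show "TN s (TN s v) = v + sc qL (TN s v)" if "s \<in> J" "v \<in> VN" for s v using TN_quad that .
  show "foldr TN (altw s t (gord W (s \<otimes> t))) v = foldr TN (altw t s (gord W (s \<otimes> t))) v"
    if "s \<in> J" "t \<in> J" "s \<noteq> t" "v \<in> VN" for s t v using TN_braid that .
qed

abbreviation "WU \<equiv> WupJ W S J"
abbreviation "KK \<equiv> KJ W S J"
abbreviation "act \<equiv> sact W S J"

lemma WU_closed: "u \<in> WU \<Longrightarrow> u \<in> carrier W"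
  by (simp add: WupJ_def)

text \<open>\<open>W^J\<close> represents the cosets \<open>w W_J\<close>; inversion transports the
  results on cosets \<open>W_J x\<close>.\<close>

lemma WU_left_min: "u \<in> WU \<longleftrightarrow> u \<in> carrier W \<and> left_min J (inv u)"
proof (cases "u \<in> carrier W")
  case True
  have "len u < len (u \<otimes> s) \<longleftrightarrow> \<not> linv (inv u) s" if s: "s \<in> J" for s
  proof -
    have "len (u \<otimes> s) = len (s \<otimes> inv u)"
      using len_inv [of "u \<otimes> s"] True s by (simp add: inv_mult_group)
    then show ?thesis using len_refl_neq [of s "inv u"] True s by auto
  qed
  then show ?thesis using True by (simp add: WupJ_def left_min_def)
qed (simp add: WupJ_def)

lemma len_WU_mult:
  assumes u: "u \<in> WU" and v: "v \<in> WJJ" shows "len (u \<otimes> v) = len u + len v"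
proof -
  have c: "u \<in> carrier W" "left_min J (inv u)" using u WU_left_min by auto
  have "len (inv v \<otimes> inv u) = len (inv v) + len (inv u)"
    using len_left_min_mult [OF JS WJJ_inv [OF v] c(2)] .
  then show ?thesis using c v len_inv [of "u \<otimes> v"] by (simp add: inv_mult_group)
qed

lemma WU_decomp:
  assumes "w \<in> carrier W"
  obtains u v where "u \<in> WU" "v \<in> WJJ" "w = u \<otimes> v"
proof -
  obtain v x where v: "v \<in> WJJ" "left_min J x" "inv w = v \<otimes> x"
    by (rule left_min_exists [OF JS inv_closed [OF assms]])
  have x: "x \<in> carrier W" using v by (simp add: left_min_def)
  have "w = inv (inv w)" using assms by simp
  also have "\<dots> = inv x \<otimes> inv v" unfolding v(3) using v x by (simp add: inv_mult_group)
  finally show ?thesis using that [of "inv x" "inv v"] v x by (simp add: WU_left_min)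
qed

lemma WU_decomp_unique:
  assumes "u \<in> WU" "v \<in> WJJ" "u' \<in> WU" "v' \<in> WJJ" "u \<otimes> v = u' \<otimes> v'"
  shows "u = u'" "v = v'"
proof -
  have c: "u \<in> carrier W" "u' \<in> carrier W" "left_min J (inv u)" "left_min J (inv u')"
    using assms WU_left_min by auto
  have "inv (u \<otimes> v) = inv (u' \<otimes> v')" using assms(5) by simp
  then have "inv v \<otimes> inv u = inv v' \<otimes> inv u'"
    using c(1,2) assms(2,4) by (simp add: inv_mult_group)
  then have "inv v = inv v'" "inv u = inv u'"
    using left_min_unique [OF JS WJJ_inv [OF assms(2)] c(3) WJJ_inv [OF assms(4)] c(4)] by auto
  then show "u = u'" "v = v'" using c assms by (metis inv_inv WJJ_closed)+
qed

text \<open>Deodhar's lemma: \<open>s u\<close> stays in \<open>W^J\<close> or equals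
  \<open>u a\<close> with \<open>a\<close> in \<open>J\<close>. If some \<open>a\<close> in
  \<open>J\<close> shortens \<open>s u\<close> from the right, the cocycle makes
  \<open>u a u^-1\<close> an inversion of \<open>s\<close>, hence equal to \<open>s\<close>.\<close>

lemma WU_mult_gen:
  assumes u: "u \<in> WU" and s: "s \<in> S"
  shows "s \<otimes> u \<notin> WU \<longleftrightarrow> inv u \<otimes> s \<otimes> u \<in> J"
proof
  have c: "u \<in> carrier W" "left_min J (inv u)" using u WU_left_min by auto
  assume "s \<otimes> u \<notin> WU"
  then have "\<not> left_min J (inv u \<otimes> s)" using WU_left_min [of "s \<otimes> u"] c s by (simp add: inv_mult_group)
  then obtain a where a: "a \<in> J" "linv (inv u \<otimes> s) a" using c s by (auto simp: left_min_def)
  then have "linv s (u \<otimes> a \<otimes> inv u)"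
    using linv_mult [of a "inv u" s] c s by (auto simp: left_min_def)
  then have e: "u \<otimes> a \<otimes> inv u = s"
    using linv_gen [of "u \<otimes> a \<otimes> inv u" s] refl_conj [of a u] a c s by simp
  have "inv u \<otimes> s \<otimes> u = a" unfolding e [symmetric] using a c by (simp add: m_assoc)
  then show "inv u \<otimes> s \<otimes> u \<in> J" using a by simp
next
  have c: "u \<in> carrier W" using u WU_closed by simp
  assume a: "inv u \<otimes> s \<otimes> u \<in> J"
  let ?a = "inv u \<otimes> s \<otimes> u"
  have e: "s \<otimes> u = u \<otimes> ?a" using c s by (simp add: m_assoc)
  show "s \<otimes> u \<notin> WU"
  proof
    assume "s \<otimes> u \<in> WU"
    then have "len (s \<otimes> u) < len (s \<otimes> u \<otimes> ?a)" using a by (simp add: WupJ_def)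
    also have "s \<otimes> u \<otimes> ?a = u" using c s by (simp add: m_assoc)
    finally have "len (u \<otimes> ?a) < len u" using e by simp
    moreover have "len u < len (u \<otimes> ?a)" using u a unfolding WupJ_def by blast
    ultimately show False by simp
  qed
qed

lemma WU_descend:
  assumes u: "u \<in> WU" and s: "s \<in> S" and l: "linv u s"
  shows "s \<otimes> u \<in> WU"
proof (rule ccontr)
  assume "s \<otimes> u \<notin> WU"
  then have a: "inv u \<otimes> s \<otimes> u \<in> J" using WU_mult_gen [OF u s] by simp
  have "s \<otimes> u = u \<otimes> (inv u \<otimes> s \<otimes> u)" using WU_closed [OF u] s by (simp add: m_assoc)
  then show False using l u a unfolding WupJ_def by auto
qed

text \<open>\<open>zmin\<close> is described through the whole \<open>W_J\<close>-class of
  \<open>z\<close>, so the correction term in \<open>ht\<close> cancels in every comparison along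
  the action.\<close>

lemma zmin_conjJ:
  assumes z: "z \<in> IJ" and t: "t \<in> TJ" shows "zmin W J (conjJ W t z) = zmin W J z"
proof -
  have "(\<exists>v\<in>WJJ. z' = wact W v (conjJ W t z)) \<longleftrightarrow> (\<exists>v\<in>WJJ. z' = wact W v z)" for z'
  proof
    assume "\<exists>v\<in>WJJ. z' = wact W v (conjJ W t z)"
    then obtain v where "v \<in> WJJ" "z' = wact W v (conjJ W t z)" by blast
    then show "\<exists>v\<in>WJJ. z' = wact W v z"
      using conjJ_wact [OF z t] wact_mult [OF z, of v t] t by (intro bexI [of _ "v \<otimes> t"]) simp_all
  next
    assume "\<exists>v\<in>WJJ. z' = wact W v z"
    then obtain v where v: "v \<in> WJJ" "z' = wact W v z" by blast
    have "wact W (v \<otimes> t) (wact W t z) = wact W (v \<otimes> t \<otimes> t) z"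
      using wact_mult [OF z, of "v \<otimes> t" t] v t by simp
    also have "v \<otimes> t \<otimes> t = v" using v t by (simp add: m_assoc)
    finally show "\<exists>v\<in>WJJ. z' = wact W v (conjJ W t z)"
      using conjJ_wact [OF z t] v t by (intro bexI [of _ "v \<otimes> t"]) simp_all
  qed
  then show ?thesis by (simp add: zmin_def)
qed

abbreviation "cg u s \<equiv> inv u \<otimes> s \<otimes> u"

lemma KK_iff: "(u, z) \<in> KK \<longleftrightarrow> u \<in> WU \<and> z \<in> IJ"
  by (simp add: KJ_def)

lemma act_move: "s \<otimes> u \<in> WU \<Longrightarrow> act s (u, z) = (s \<otimes> u, z)"
  by (simp add: sact_def)

lemma act_conj: "s \<otimes> u \<notin> WU \<Longrightarrow> act s (u, z) = (u, conjJ W (cg u s) z)"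
  by (simp add: sact_def)

lemma ht_move: "ht W S J (s \<otimes> u, z) < ht W S J (u, z) \<longleftrightarrow> linv u s"
  "ht W S J (u, z) < ht W S J (s \<otimes> u, z) \<longleftrightarrow> len u < len (s \<otimes> u)"
  by (simp_all add: ht_def)

lemma ht_conj:
  assumes "z \<in> IJ" "a \<in> J"
  shows "ht W S J (u, conjJ W a z) < ht W S J (u, z) \<longleftrightarrow> zlen W J (conjJ W a z) < zlen W J z"
    "ht W S J (u, z) < ht W S J (u, conjJ W a z) \<longleftrightarrow> zlen W J z < zlen W J (conjJ W a z)"
    "ht W S J (u, conjJ W a z) = ht W S J (u, z) \<longleftrightarrow> zlen W J (conjJ W a z) = zlen W J z"
  using zmin_conjJ [OF assms(1), of a] assms(2) by (simp_all add: ht_def)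

lemma act_KK: "\<lbrakk>s \<in> S; \<tau> \<in> KK\<rbrakk> \<Longrightarrow> act s \<tau> \<in> KK"
proof -
  assume s: "s \<in> S" and "\<tau> \<in> KK"
  then obtain u z where t: "\<tau> = (u, z)" "u \<in> WU" "z \<in> IJ" by (cases \<tau>) (auto simp: KK_iff)
  show ?thesis
  proof (cases "s \<otimes> u \<in> WU")
    case True
    then show ?thesis using t by (simp add: act_move KK_iff)
  next
    case False
    then have "cg u s \<in> J" using WU_mult_gen [OF t(2) s] by simp
    then show ?thesis using False t conjJ_closed by (simp add: act_conj KK_iff)
  qed
qed

lemma act_invol: "\<lbrakk>s \<in> S; \<tau> \<in> KK\<rbrakk> \<Longrightarrow> act s (act s \<tau>) = \<tau>"
proof -
  assume s: "s \<in> S" and "\<tau> \<in> KK"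
  then obtain u z where t: "\<tau> = (u, z)" "u \<in> WU" "z \<in> IJ" by (cases \<tau>) (auto simp: KK_iff)
  show ?thesis
  proof (cases "s \<otimes> u \<in> WU")
    case True
    then show ?thesis using t s WU_closed [OF t(2)] by (simp add: act_move)
  next
    case False
    then have "cg u s \<in> J" using WU_mult_gen [OF t(2) s] by simp
    then show ?thesis using False t conjJ_invol by (simp add: act_conj)
  qed
qed

lemma act_fixed: "\<lbrakk>s \<in> S; \<tau> \<in> KK\<rbrakk> \<Longrightarrow> act s \<tau> = \<tau> \<longleftrightarrow> ht W S J (act s \<tau>) = ht W S J \<tau>"
proof -
  assume s: "s \<in> S" and "\<tau> \<in> KK"
  then obtain u z where t: "\<tau> = (u, z)" "u \<in> WU" "z \<in> IJ" by (cases \<tau>) (auto simp: KK_iff)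
  show ?thesis
  proof (cases "s \<otimes> u \<in> WU")
    case True
    have "len (s \<otimes> u) \<noteq> len u" using len_refl_neq [of s u] s WU_closed [OF t(2)] by simp
    then show ?thesis using True t by (auto simp: act_move ht_def)
  next
    case False
    then have "cg u s \<in> J" using WU_mult_gen [OF t(2) s] by simp
    then show ?thesis using False t conjJ_fixed [of "cg u s" z] by (auto simp: act_conj ht_conj)
  qed
qed

lemma act_fixed_cg: "\<lbrakk>s \<in> S; (u, z) \<in> KK; act s (u, z) = (u, z)\<rbrakk> \<Longrightarrow> cg u s \<in> J \<and> conjJ W (cg u s) z = z"
proof -
  assume a: "s \<in> S" "(u, z) \<in> KK" "act s (u, z) = (u, z)"
  have u: "u \<in> WU" using a(2) by (simp add: KK_iff)
  have "s \<otimes> u \<notin> WU"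
    using a len_refl_neq [of s u] WU_closed [OF u] by (auto simp: act_move)
  then show ?thesis using WU_mult_gen [OF u a(1)] a(3) by (simp add: act_conj)
qed

lemma finite_KK: "finite KK"
  unfolding KJ_def using finite_IJ finite_carrier by (auto simp: WupJ_def)

lemma Mcar_eq: "Mcar W S J = supp_in KK"
  by (simp add: Mcar_def supp_in_def)

definition TM where
  "TM s = hecke_op KK (act s) (\<lambda>\<tau>. ht W S J (act s \<tau>) < ht W S J \<tau>) (\<lambda>\<tau>. lam (cg (fst \<tau>) s))"

abbreviation "VM \<equiv> supp_in KK"

lemma TM_lin: "lin (TM s)"
  unfolding TM_def by (rule hecke_op_lin)

lemma TM_V: "TM s f \<in> VM"
  unfolding TM_def by (rule hecke_op_supp)

lemma TM_quad:
  assumes "s \<in> S" "f \<in> VM" shows "TM s (TM s f) = f + sc qL (TM s f)"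
  unfolding TM_def
proof (rule hecke_op_quadratic [OF _ assms(2)])
  fix \<tau> assume t: "\<tau> \<in> KK"
  then show "act s \<tau> \<in> KK \<and> act s (act s \<tau>) = \<tau> \<and>
      (act s \<tau> \<noteq> \<tau> \<longrightarrow> (ht W S J (act s (act s \<tau>)) < ht W S J (act s \<tau>))
         = (\<not> ht W S J (act s \<tau>) < ht W S J \<tau>)) \<and> lam (cg (fst \<tau>) s) \<in> {xL, - xinv}"
    using act_KK [OF assms(1) t] act_invol [OF assms(1) t] act_fixed [OF assms(1) t] lam_cases by auto
qed

lemma TM_bvec:
  assumes "s \<in> S" "\<tau> \<in> KK"
  shows "act s \<tau> = \<tau> \<Longrightarrow> TM s (bvec \<tau>) = sc (lam (cg (fst \<tau>) s)) (bvec \<tau>)"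
    and "ht W S J \<tau> < ht W S J (act s \<tau>) \<Longrightarrow> TM s (bvec \<tau>) = bvec (act s \<tau>)"
    and "ht W S J (act s \<tau>) < ht W S J \<tau> \<Longrightarrow> TM s (bvec \<tau>) = bvec (act s \<tau>) + sc qL (bvec \<tau>)"
proof -
  have i: "\<And>j. j \<in> KK \<Longrightarrow> act s (act s j) = j" using assms act_invol by blast
  have c: "act s \<tau> \<in> KK" using assms act_KK by simp
  note b = hecke_op_bvec [OF assms(2), of "act s", OF c i]
  show "act s \<tau> = \<tau> \<Longrightarrow> TM s (bvec \<tau>) = sc (lam (cg (fst \<tau>) s)) (bvec \<tau>)"
    unfolding TM_def by (rule b(1))
  show "ht W S J \<tau> < ht W S J (act s \<tau>) \<Longrightarrow> TM s (bvec \<tau>) = bvec (act s \<tau>)"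
    unfolding TM_def by (rule b(2)) auto
  show "ht W S J (act s \<tau>) < ht W S J \<tau> \<Longrightarrow> TM s (bvec \<tau>) = bvec (act s \<tau>) + sc qL (bvec \<tau>)"
    unfolding TM_def by (rule b(3)) auto
qed

text \<open>\<open>embed u n\<close> is the element \<open>H_u \<otimes> n\<close> of the module induced from \<open>TN\<close>.\<close>
definition embed where "embed u n = (\<lambda>\<tau>. if fst \<tau> = u then n (snd \<tau>) else (0::laurent))"

lemma embed_lin: "lin (embed u)"
  by (auto simp: slin_def embed_def sc_def fun_eq_iff)

lemma embed_bvec: "embed u (bvec z) = bvec (u, z)"
  by (auto simp: embed_def bvec_def fun_eq_iff)

lemma embed_V: "\<lbrakk>u \<in> WU; n \<in> VN\<rbrakk> \<Longrightarrow> embed u n \<in> VM"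
  by (auto simp: embed_def supp_in_def KJ_def)

lemma TM_embed_up:
  assumes u: "u \<in> WU" and s: "s \<in> S" "s \<otimes> u \<in> WU" "\<not> linv u s" and n: "n \<in> VN"
  shows "TM s (embed u n) = embed (s \<otimes> u) n"
proof (rule slin_eq_on [OF finite_IJ _ embed_lin _ n])
  show "lin (\<lambda>n. TM s (embed u n))" using slin_comp [OF TM_lin embed_lin] .
  fix z assume z: "z \<in> IJ"
  have "len u < len (s \<otimes> u)" using s len_refl_neq [of s u] WU_closed [OF u] by fastforce
  then show "TM s (embed u (bvec z)) = embed (s \<otimes> u) (bvec z)"
    using TM_bvec(2) [OF s(1), of "(u, z)"] u z s by (simp add: embed_bvec act_move ht_move KK_iff)
qed

lemma TM_embed_conj:
  assumes u: "u \<in> WU" and s: "s \<in> S" "cg u s \<in> J" and n: "n \<in> VN"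
  shows "TM s (embed u n) = embed u (TN (cg u s) n)"
proof (rule slin_eq_on [OF finite_IJ _ _ _ n])
  show "lin (\<lambda>n. TM s (embed u n))" using slin_comp [OF TM_lin embed_lin] .
  show "lin (\<lambda>n. embed u (TN (cg u s) n))" using slin_comp [OF embed_lin TN_lin] .
  fix z assume z: "z \<in> IJ"
  let ?a = "cg u s"
  have nu: "s \<otimes> u \<notin> WU" using WU_mult_gen [OF u s(1)] s(2) by simp
  have k: "(u, z) \<in> KK" using u z by (simp add: KK_iff)
  consider "conjJ W ?a z = z" | "zlen W J z < zlen W J (conjJ W ?a z)" | "zlen W J (conjJ W ?a z) < zlen W J z"
    using conjJ_fixed [OF s(2) z] by linarith
  then show "TM s (embed u (bvec z)) = embed u (TN ?a (bvec z))"
  proof cases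
    case 1
    then show ?thesis
      using TM_bvec(1) [OF s(1) k] TN_bvec(1) [OF s(2) z] nu
      by (simp add: embed_bvec act_conj slin_sc [OF embed_lin])
  next
    case 2
    then show ?thesis
      using TM_bvec(2) [OF s(1) k] TN_bvec(2) [OF s(2) z] nu ht_conj [OF z s(2)]
      by (simp add: embed_bvec act_conj)
  next
    case 3
    then show ?thesis
      using TM_bvec(3) [OF s(1) k] TN_bvec(3) [OF s(2) z] nu ht_conj [OF z s(2)]
      by (simp add: embed_bvec act_conj slin_sc [OF embed_lin] slin_add [OF embed_lin])
  qed
qed

text \<open>\<open>H_w \<otimes> n\<close> for arbitrary \<open>w = u v\<close>, with
  \<open>H_v\<close> moved across the tensor sign; the factorisation is unique, so the description
  is proper.\<close>

definition induced where
  "induced n w = (THE m. \<exists>u v. u \<in> WU \<and> v \<in> WJJ \<and> w = u \<otimes> v \<and> m = embed u (N.Tw v n))"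

lemma induced_eq: "\<lbrakk>u \<in> WU; v \<in> WJJ\<rbrakk> \<Longrightarrow> induced n (u \<otimes> v) = embed u (N.Tw v n)"
  unfolding induced_def
proof (rule the_equality)
  fix m assume a: "u \<in> WU" "v \<in> WJJ"
    "\<exists>u' v'. u' \<in> WU \<and> v' \<in> WJJ \<and> u \<otimes> v = u' \<otimes> v' \<and> m = embed u' (N.Tw v' n)"
  then obtain u' v' where "u' \<in> WU" "v' \<in> WJJ" "u \<otimes> v = u' \<otimes> v'" "m = embed u' (N.Tw v' n)" by blast
  then show "m = embed u (N.Tw v n)" using WU_decomp_unique [of u v u' v'] a by simp
qed blast

text \<open>By Deodhar's lemma \<open>s\<close> either moves \<open>u\<close> or passes through it
  as \<open>a = u^-1 s u\<close> and acts on \<open>v\<close>. Additivity of lengths makes it an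
  ascent there as well.\<close>

lemma induced_up:
  assumes n: "n \<in> VN" and s: "s \<in> S" and w: "w \<in> carrier W" "\<not> linv w s"
  shows "TM s (induced n w) = induced n (s \<otimes> w)"
proof -
  obtain u v where uv: "u \<in> WU" "v \<in> WJJ" "w = u \<otimes> v" by (rule WU_decomp [OF w(1)])
  have c: "u \<in> carrier W" "v \<in> carrier W" using uv WU_closed by auto
  have Tn: "N.Tw v n \<in> VN" using N.Tw_V [OF uv(2) n] .
  show ?thesis
  proof (cases "s \<otimes> u \<in> WU")
    case True
    have "len (s \<otimes> w) = len (s \<otimes> u) + len v" "len w = len u + len v"
      using len_WU_mult [OF True uv(2)] len_WU_mult [OF uv(1,2)] uv c s by (simp_all add: m_assoc)
    then have "\<not> linv u s" using w by simp
    then show ?thesis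
      using TM_embed_up [OF uv(1) s True _ Tn] induced_eq [OF uv(1,2)] induced_eq [OF True uv(2)] uv(3) c s
      by (simp add: m_assoc)
  next
    case False
    let ?a = "cg u s"
    have a: "?a \<in> J" using WU_mult_gen [OF uv(1) s] False by simp
    have av: "?a \<otimes> v \<in> WJJ" using a uv by simp
    have sw: "s \<otimes> w = u \<otimes> (?a \<otimes> v)" using uv c s by (simp add: m_assoc)
    have "len (s \<otimes> w) = len u + len (?a \<otimes> v)" "len w = len u + len v"
      using len_WU_mult [OF uv(1) av] len_WU_mult [OF uv(1,2)] uv(3) sw by simp_all
    then have "\<not> linv v ?a" using w by simp
    then have "TN ?a (N.Tw v n) = N.Tw (?a \<otimes> v) n" using N.T_Tw_up [OF a uv(2) n] by simp
    then show ?thesis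
      unfolding sw using TM_embed_conj [OF uv(1) s a Tn] induced_eq [OF uv(1,2)] induced_eq [OF uv(1) av] uv(3)
      by simp
  qed
qed

lemma induced_V: "\<lbrakk>n \<in> VN; w \<in> carrier W\<rbrakk> \<Longrightarrow> induced n w \<in> VM"
proof -
  assume n: "n \<in> VN" and w: "w \<in> carrier W"
  obtain u v where uv: "u \<in> WU" "v \<in> WJJ" "w = u \<otimes> v" by (rule WU_decomp [OF w(1)])
  then show ?thesis using induced_eq [OF uv(1,2)] embed_V N.Tw_V n by simp
qed

lemma induced_bvec: "\<lbrakk>u \<in> WU; z \<in> IJ\<rbrakk> \<Longrightarrow> induced (bvec z) u = bvec (u, z)"
  using induced_eq [of u \<one> "bvec z"] WU_closed [of u] bvec_supp_in [of z IJ] by (simp add: embed_bvec)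

lemma hecke_M: "hecke_rep W S S TM VM"
proof unfold_locales
  show "S \<subseteq> S" by simp
  show lin: "lin (TM s)" for s by (rule TM_lin)
  show V: "TM s v \<in> VM" for s v by (rule TM_V)
  show "u - v \<in> VM" if "u \<in> VM" "v \<in> VM" for u v using that by (rule supp_in_diff)
  show "sc p v \<in> VM" if "v \<in> VM" for p v using that by (rule supp_in_sc)
  show quad: "TM s (TM s v) = v + sc qL (TM s v)" if "s \<in> S" "v \<in> VM" for s v
    using TM_quad that .
  show "foldr TM (altw s t (gord W (s \<otimes> t))) v = foldr TM (altw t s (gord W (s \<otimes> t))) v"
    if st: "s \<in> S" "t \<in> S" "s \<noteq> t" and v: "v \<in> VM" for s t v
  proof (rule slin_eq_on [OF finite_KK _ _ _ v])
    show "lin (foldr TM (altw s t (gord W (s \<otimes> t))))" "lin (foldr TM (altw t s (gord W (s \<otimes> t))))"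
      by (rule lin_foldr [OF TM_lin])+
    fix \<tau> assume "\<tau> \<in> KK"
    then obtain u z where t: "\<tau> = (u, z)" "u \<in> WU" "z \<in> IJ" by (cases \<tau>) (auto simp: KK_iff)
    have zV: "bvec z \<in> VN" using bvec_supp_in [OF t(3)] .
    \<comment> \<open>Every basis vector is of the form \<open>H_u \<otimes> bvec z\<close>, so
      \<open>regular_braid\<close> reaches it directly.\<close>
    have "foldr TM (altw s t (gord W (s \<otimes> t))) (induced (bvec z) u) =
       foldr TM (altw t s (gord W (s \<otimes> t))) (induced (bvec z) u)"
      by (rule regular_braid [where V = VM and P = "induced (bvec z)", OF lin V quad induced_V [OF zV]
            induced_up [OF zV] st WU_closed [OF t(2)]])
    then show "foldr TM (altw s t (gord W (s \<otimes> t))) (bvec \<tau>) =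
       foldr TM (altw t s (gord W (s \<otimes> t))) (bvec \<tau>)"
      using induced_bvec [OF t(2,3)] t(1) by simp
  qed
qed

end

text \<open>A competing action or bar operator is constrained only on functions of the right
  support, so uniqueness needs semilinearity relative to a support.\<close>

definition slin_on :: "'i set \<Rightarrow> (laurent \<Rightarrow> laurent) \<Rightarrow> (('i \<Rightarrow> laurent) \<Rightarrow> ('j \<Rightarrow> laurent)) \<Rightarrow> bool" where
  "slin_on X \<beta> f \<longleftrightarrow> (\<forall>u\<in>supp_in X. \<forall>v\<in>supp_in X. f (u + v) = f u + f v) \<and>
     (\<forall>p. \<forall>u\<in>supp_in X. f (sc p u) = sc (\<beta> p) (f u))"

lemma zero_supp_in: "0 \<in> supp_in X"
  by (simp add: supp_in_def)

lemma sc_apply: "sc p u i = p * u i"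
  by (simp add: sc_def)

lemma slin_sum_sc:
  assumes "slin \<beta> f"
  shows "f (\<Sum>i\<in>A. sc (c i) (g i)) = (\<Sum>i\<in>A. sc (\<beta> (c i)) (f (g i)))"
  unfolding slin_sum [OF assms] slin_sc [OF assms] ..

lemma slin_on_expansion:
  assumes X: "finite X" and f: "slin_on X \<beta> f" and m: "m \<in> supp_in X"
  shows "f m = (\<Sum>i\<in>X. sc (\<beta> (m i)) (f (bvec i)))"
proof -
  have z: "f 0 = 0"
  proof -
    have "f (0 + 0) = f 0 + f 0" using f zero_supp_in unfolding slin_on_def by blast
    then show ?thesis by simp
  qed
  have "f (\<Sum>i\<in>A. sc (m i) (bvec i)) = (\<Sum>i\<in>A. sc (\<beta> (m i)) (f (bvec i)))" if "A \<subseteq> X" for A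
    using finite_subset [OF that X] that
  proof (induct A rule: finite_induct)
    case empty
    then show ?case using z by (simp only: sum.empty)
  next
    case (insert a A)
    have b: "bvec a \<in> supp_in X" using insert by (simp add: bvec_supp_in)
    have "(\<Sum>i\<in>A. sc (m i) (bvec i)) \<in> supp_in X"
      using insert by (intro supp_in_sum supp_in_sc bvec_supp_in) auto
    then have "f (sc (m a) (bvec a) + (\<Sum>i\<in>A. sc (m i) (bvec i))) =
        f (sc (m a) (bvec a)) + f (\<Sum>i\<in>A. sc (m i) (bvec i))"
      using f supp_in_sc [OF b] unfolding slin_on_def by blast
    moreover have "f (sc (m a) (bvec a)) = sc (\<beta> (m a)) (f (bvec a))"
      using f b unfolding slin_on_def by blast
    moreover have "f (\<Sum>i\<in>A. sc (m i) (bvec i)) = (\<Sum>i\<in>A. sc (\<beta> (m i)) (f (bvec i)))"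
      using insert by blast
    ultimately show ?case unfolding sum.insert [OF insert(1,2)] by (simp only:)
  qed
  from this [of X] show ?thesis using basis_expansion [OF X m] by simp
qed

section \<open>From operators to modules over the Hecke algebra\<close>

locale hecke_module = hecke_rep W S S T V for W (structure) and S and T :: "'a \<Rightarrow> ('i \<Rightarrow> laurent) \<Rightarrow> ('i \<Rightarrow> laurent)" and V +
  assumes V_add: "\<lbrakk>u \<in> V; v \<in> V\<rbrakk> \<Longrightarrow> u + v \<in> V"
begin

definition hact where "hact h m = (\<Sum>w\<in>carrier W. sc (h w) (Tw w m))"

lemma V_zero: "m \<in> V \<Longrightarrow> 0 \<in> V"
  using V_diff [of m m] by simp

lemma V_sum: "\<lbrakk>m \<in> V; \<And>i. i \<in> A \<Longrightarrow> f i \<in> V\<rbrakk> \<Longrightarrow> sum f A \<in> V"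
  using V_zero [of m] by (induct A rule: infinite_finite_induct) (auto intro: V_add)

lemma hact_V: "m \<in> V \<Longrightarrow> hact h m \<in> V"
  unfolding hact_def by (rule V_sum) (simp_all add: V_sc Tw_V)

lemma hact_lin_left: "lin (\<lambda>h. hact h m)"
  unfolding slin_def
  by (simp only: hact_def plus_fun_apply sc_add_left sum.distrib sc_apply sc_sum sc_sc simp_thms)

lemma hact_lin: "lin (hact h)"
proof -
  have "lin (Tw w)" if "w \<in> carrier W" for w using Tw_lin [of w] that by simp
  then show ?thesis
    unfolding slin_def hact_def
    by (auto simp: sc_sum sum.distrib [symmetric] sc_add_right [symmetric] slin_def mult.commute intro!: sum.cong)
qed

lemma hact_bvec:
  assumes "w \<in> carrier W" shows "hact (bvec w) m = Tw w m"
proof -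
  have "hact (bvec w) m = (\<Sum>x\<in>carrier W. if x = w then Tw x m else 0)"
    unfolding hact_def by (rule sum.cong) (auto simp: bvec_def)
  then show ?thesis using assms finite_carrier by simp
qed

lemma T_Tw:
  assumes "s \<in> S" "w \<in> carrier W" "m \<in> V"
  shows "T s (Tw w m) = Tw (s \<otimes> w) m + sc (if linv w s then qL else 0) (Tw w m)"
  using T_Tw_up [of s w m] T_Tw_down [of s w m] assms by simp

text \<open>Compares coefficients after the substitution of \<open>s w\<close> for \<open>w\<close>;
  the descent terms of \<open>Ls\<close> and of \<open>T_Tw\<close> match.\<close>

lemma hact_Ls:
  assumes s: "s \<in> S" and m: "m \<in> V"
  shows "hact (Ls W S s h) m = T s (hact h m)"
proof -
  let ?d = "\<lambda>w. if linv w s then qL else 0"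
  have "T s (hact h m) = (\<Sum>w\<in>carrier W. sc (h w) (T s (Tw w m)))"
    unfolding hact_def by (rule slin_sum_sc [OF T_lin [OF s]])
  also have "\<dots> = (\<Sum>w\<in>carrier W. sc (h w) (Tw (s \<otimes> w) m) + sc (h w) (sc (?d w) (Tw w m)))"
    by (rule sum.cong) (use T_Tw [OF s _ m] in \<open>auto simp: sc_add_right\<close>)
  also have "\<dots> = (\<Sum>w\<in>carrier W. sc (h w) (Tw (s \<otimes> w) m)) + (\<Sum>w\<in>carrier W. sc (?d w * h w) (Tw w m))"
    by (simp only: sum.distrib sc_sc mult.commute)
  also have "(\<Sum>w\<in>carrier W. sc (h w) (Tw (s \<otimes> w) m)) = (\<Sum>w\<in>carrier W. sc (h (s \<otimes> w)) (Tw w m))"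
    by (rule sum.reindex_bij_witness [of _ "\<lambda>w. s \<otimes> w" "\<lambda>w. s \<otimes> w"]) (use s in auto)
  also have "(\<Sum>w\<in>carrier W. sc (h (s \<otimes> w)) (Tw w m)) + (\<Sum>w\<in>carrier W. sc (?d w * h w) (Tw w m))
      = (\<Sum>w\<in>carrier W. sc (h (s \<otimes> w) + ?d w * h w) (Tw w m))"
    by (simp only: sum.distrib sc_add_left)
  also have "\<dots> = hact (Ls W S s h) m"
    unfolding hact_def by (rule sum.cong) (auto simp: Ls_def)
  finally show ?thesis by simp
qed

lemma hact_foldr_Ls:
  "\<lbrakk>set ws \<subseteq> S; m \<in> V\<rbrakk> \<Longrightarrow> hact (foldr (Ls W S) ws h) m = foldr T ws (hact h m)"
  by (induct ws) (auto simp: hact_Ls)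

lemma kword_redword: "kword = redword W S"
  by (simp add: kword_def redword_def fun_eq_iff)

lemma hmult_eq: "hmult W S a b = (\<Sum>w\<in>carrier W. sc (a w) (foldr (Ls W S) (kword w) b))"
  by (simp add: hmult_def Lw_def kword_redword fun_eq_iff sum_fun_apply sc_def)

text \<open>\<open>hmult\<close> expands its left factor along the same reduced words as
  \<open>hact\<close>, so compatibility with single generators suffices.\<close>

lemma hact_hmult:
  assumes m: "m \<in> V" shows "hact (hmult W S a b) m = hact a (hact b m)"
proof -
  have "hact (hmult W S a b) m = (\<Sum>w\<in>carrier W. sc (a w) (hact (foldr (Ls W S) (kword w) b) m))"
    unfolding hmult_eq by (rule slin_sum_sc [OF hact_lin_left])
  also have "\<dots> = hact a (hact b m)"
    unfolding hact_def [of a]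
    by (rule sum.cong) (use kword in \<open>auto simp: hact_foldr_Ls m Tw_def\<close>)
  finally show ?thesis .
qed

lemma hact_hone: "m \<in> V \<Longrightarrow> hact (hone W) m = m"
  by (simp add: hone_def hact_bvec)

end

context coxeter
begin

lemma hecke_module_regular: "hecke_module W S (Ls W S) (heckeH W)"
  using hecke_regular by (auto simp: hecke_module_def hecke_module_axioms_def heckeH_eq supp_in_add)

sublocale H: hecke_module W S "Ls W S" "heckeH W"
  by (rule hecke_module_regular)

text \<open>The product is the action on the regular module, so \<open>hact_hmult\<close> and
  \<open>hact_hone\<close> become associativity and the unit law.\<close>

lemma hmult_hact: "hmult W S a b = H.hact a b"
  by (simp add: H.hmult_eq H.hact_def H.Tw_def)

lemma hone_V: "hone W \<in> heckeH W"
  by (simp add: hone_def heckeH_eq bvec_supp_in)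

lemma H_foldr_hone:
  assumes "set ws \<subseteq> S" "length ws = len (wprod W ws)"
  shows "foldr (Ls W S) ws (hone W) = bvec (wprod W ws)"
  using assms
proof (induct ws)
  case (Cons s ws)
  have s: "s \<in> S" "set ws \<subseteq> S" using Cons.prems by auto
  note r = reduced_Cons [OF Cons.prems]
  show ?case using Cons.hyps [OF s(2) r(1)] Ls_bvec(1) [OF s(1) _ r(2)] s by simp
qed (simp add: hone_def)

lemma H_Tw_hone: "w \<in> carrier W \<Longrightarrow> H.Tw w (hone W) = bvec w"
  using H_foldr_hone [of "H.kword w"] H.kword [of w] by (simp add: H.Tw_def)

lemma H_hact_hone_right: "h \<in> heckeH W \<Longrightarrow> H.hact h (hone W) = h"
  unfolding H.hact_def using basis_expansion [OF finite_carrier, of h] by (simp add: H_Tw_hone heckeH_eq)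

text \<open>\<open>U\<close> along a word for \<open>w\<close> undoes \<open>Ls\<close> along the
  reversed word from either side; uniqueness of two-sided inverses then evaluates the
  \<open>THE\<close> in \<open>hinv\<close>.\<close>

lemma hinv_bvec:
  assumes w: "w \<in> carrier W"
  shows "hinv W S (bvec (inv w)) = H.Uw w (hone W)"
  unfolding hinv_def
proof (rule the_equality)
  let ?b = "H.Uw w (hone W)" and ?ws = "H.kword w"
  have k: "set ?ws \<subseteq> S" "wprod W ?ws = w" "length ?ws = len w" using H.kword [of w] w by auto
  have r: "set (rev ?ws) \<subseteq> S" "wprod W (rev ?ws) = inv w" "length (rev ?ws) = len (wprod W (rev ?ws))"
    using k w by (simp_all add: wprod_rev)
  have bV: "?b \<in> heckeH W" using H.Uw_V hone_V w by simp
  have iV: "bvec (inv w) \<in> heckeH W" using w by (simp add: heckeH_eq bvec_supp_in)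
  have Tr: "foldr (Ls W S) (rev ?ws) x = H.Tw (inv w) x" if "x \<in> heckeH W" for x
    using H.Tw_word [OF r(1,3) that] r(2) by simp
  have ab: "hmult W S (bvec (inv w)) ?b = hone W"
  proof -
    have "hmult W S (bvec (inv w)) ?b = H.Tw (inv w) ?b" using w by (simp add: hmult_hact H.hact_bvec)
    also have "\<dots> = foldr (Ls W S) (rev ?ws) (foldr H.U ?ws (hone W))"
      using Tr [OF bV] by (simp add: H.Uw_def)
    also have "\<dots> = hone W" by (rule H.foldr_T_U [OF k(1) hone_V])
    finally show ?thesis .
  qed
  have actU: "H.hact (foldr H.U us h) m = foldr H.U us (H.hact h m)"
    if "set us \<subseteq> S" "m \<in> heckeH W" for us h m
    using that
  proof (induct us)
    case (Cons s us)
    have e: "H.hact (H.U s x) m = H.U s (H.hact x m)" for x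
      using H.hact_Ls [of s m x] Cons.prems slin_minus [OF H.hact_lin_left] slin_sc [OF H.hact_lin_left]
      by (simp add: H.U_def)
    show ?case using Cons e by simp
  qed simp
  have ba: "hmult W S ?b (bvec (inv w)) = hone W"
  proof -
    have "hmult W S ?b (bvec (inv w)) = foldr H.U ?ws (bvec (inv w))"
      using actU [OF k(1) iV] H.hact_hone [OF iV] by (simp add: hmult_hact H.Uw_def)
    also have "\<dots> = foldr H.U ?ws (foldr (Ls W S) (rev ?ws) (hone W))"
      using Tr [OF hone_V] H_Tw_hone [of "inv w"] w by simp
    also have "\<dots> = hone W"
      by (rule H.foldr_U_T [OF k(1) hone_V])
    finally show ?thesis .
  qed
  show "?b \<in> heckeH W \<and> hmult W S (bvec (inv w)) ?b = hone W \<and> hmult W S ?b (bvec (inv w)) = hone W"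
    using bV ab ba by simp
  fix b' assume b': "b' \<in> heckeH W \<and> hmult W S (bvec (inv w)) b' = hone W \<and> hmult W S b' (bvec (inv w)) = hone W"
  have "b' = H.hact b' (H.hact (bvec (inv w)) ?b)"
    using ab H_hact_hone_right [of b'] b' by (simp add: hmult_hact)
  also have "\<dots> = H.hact (hmult W S b' (bvec (inv w))) ?b" using H.hact_hmult [OF bV] by simp
  also have "\<dots> = ?b" using b' H.hact_hone [OF bV] by simp
  finally show "b' = ?b" .
qed

lemma barH_eq: "barH W S h = (\<Sum>w\<in>carrier W. sc (barL (h w)) (H.Uw w (hone W)))"
  unfolding barH_def by (auto simp: fun_eq_iff sum_fun_apply sc_def hinv_bvec intro!: sum.cong)

end

context hecke_module
begin

lemma hact_foldr_U:
  "\<lbrakk>set us \<subseteq> S; m \<in> V\<rbrakk> \<Longrightarrow> hact (foldr H.U us h) m = foldr U us (hact h m)"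
proof (induct us)
  case (Cons s us)
  have e: "hact (H.U s x) m = U s (hact x m)" for x
    using hact_Ls [of s m x] Cons.prems slin_minus [OF hact_lin_left] slin_sc [OF hact_lin_left]
    by (simp add: H.U_def U_def)
  show ?case using Cons e by simp
qed simp

lemma hact_barH:
  assumes m: "m \<in> V"
  shows "hact (barH W S h) m = (\<Sum>w\<in>carrier W. sc (barL (h w)) (Uw w m))"
proof -
  have "hact (barH W S h) m = (\<Sum>w\<in>carrier W. sc (barL (h w)) (hact (H.Uw w (hone W)) m))"
    unfolding barH_eq by (rule slin_sum_sc [OF hact_lin_left])
  also have "\<dots> = (\<Sum>w\<in>carrier W. sc (barL (h w)) (Uw w m))"
    by (rule sum.cong) (use H.kword m in \<open>auto simp: H.Uw_def Uw_def hact_foldr_U hact_hone\<close>)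
  finally show ?thesis .
qed

end

section \<open>The structure of minimal perfect involutions\<close>

context perfect_inv
begin

text \<open>Let \<open>K\<close> be the descents of \<open>y\<close> and \<open>y = v y'\<close>
  with \<open>v\<close> in \<open>W_K\<close> and \<open>y'\<close> minimal. A right descent
  \<open>b'\<close> of \<open>y'\<close> yields an inversion \<open>b\<close> of \<open>y'\<close>,
  which is no reflection of \<open>W_K\<close>. But \<open>v b v^-1 = psi (\<theta> b')\<close> is
  one: either \<open>\<theta> b'\<close> is a descent and fixed by \<open>psi\<close>, or its image
  is no inversion of \<open>y\<close> and must be one of \<open>v\<close>. So \<open>y' = 1\<close>,
  \<open>psi\<close> fixes \<open>y\<close>, and \<open>psi y = y^-1\<close>.\<close>

lemma minimal_structure:
  assumes min: "\<And>s. \<lbrakk>s \<in> J; linv y s\<rbrakk> \<Longrightarrow> psi s = s"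
  shows "y \<in> WJ W {s \<in> J. linv y s}" "inv y = y"
proof -
  let ?K = "{s \<in> J. linv y s}"
  have K: "?K \<subseteq> J" "?K \<subseteq> S" by auto
  have WJJ: "x \<in> WJJ" if "x \<in> WJ W ?K" for x using that WJ_mono [OF K(1)] by blast
  have fix_word: "psi (wprod W ws) = wprod W ws" if "set ws \<subseteq> ?K" for ws
    using that
  proof (induct ws)
    case (Cons a ws)
    then have "psi a = a" "a \<in> J" "set ws \<subseteq> J" using min by auto
    then show ?case using Cons psi_mult [of a "wprod W ws"] wprod_WJJ [of ws] by simp
  qed simp
  have psi_fix: "psi p = p" if p: "p \<in> WJ W ?K" for p
    using WJ_word [OF K(2) p] fix_word by blast
  have yc: "y \<in> carrier W" by simp
  obtain v y' where v: "v \<in> WJ W ?K" "left_min ?K y'" "y = v \<otimes> y'"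
    by (rule left_min_exists [OF K(2) yc])
  have vJ: "v \<in> WJJ" using WJJ [OF v(1)] .
  have y'c: "y' \<in> carrier W" using v(2) by (simp add: left_min_def)
  have y'_eq: "y' = inv v \<otimes> y" using v(3) vJ y'c by simp
  have y'J: "y' \<in> WJJ" unfolding y'_eq using vJ by simp
  have "y' = \<one>"
  proof (rule ccontr)
    assume "y' \<noteq> \<one>"
    then have "inv y' \<noteq> \<one>" using y'c inv_eq_1_iff by simp
    then obtain b' where b': "b' \<in> J" "linv (inv y') b'"
      using descent_exists [OF JS WJJ_inv [OF y'J]] by blast
    define b where "b = y' \<otimes> b' \<otimes> inv y'"
    have bT: "b \<in> TJ" unfolding b_def using reflsJ_conj [OF JS _ y'J] b' by simp
    have lb: "linv y' b"
      using linv_inv [of b y'] bT b' y'J by (simp add: b_def m_assoc)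
    have no: "b \<notin> reflsJ W ?K" using left_min_reflsJ [OF K(2) v(2)] lb by blast
    define a where "a = \<theta> b'"
    have aJ: "a \<in> J" using b' by (simp add: a_def)
    have "(v \<otimes> y') \<otimes> b' \<otimes> inv (v \<otimes> y') = v \<otimes> b \<otimes> inv v"
      using vJ y'J b' by (simp add: b_def m_assoc inv_mult_group)
    then have pa: "psi a = v \<otimes> b \<otimes> inv v"
      unfolding psi_def a_def th_th v(3) [symmetric] .
    have b_pa: "b = inv v \<otimes> psi a \<otimes> v" unfolding pa using vJ bT by (simp add: m_assoc)
    have "psi a \<in> reflsJ W ?K"
    proof (cases "linv y a")
      case True
      then have "psi a = a" "a \<in> ?K" using min aJ by auto
      then show ?thesis using reflsJ_gen [OF K(2)] by simp
    next
      case False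
      then have "\<not> linv y (psi a)" using linv_psi [of a] aJ by simp
      moreover have "linv (v \<otimes> y') (psi a) \<longleftrightarrow> linv v (psi a) \<noteq> linv y' (inv v \<otimes> psi a \<otimes> v)"
        using vJ y'J aJ by (intro linv_mult) simp_all
      ultimately have "linv v (psi a)"
        using lb unfolding v(3) [symmetric] b_pa [symmetric] by blast
      then show ?thesis using linv_reflsJ [OF K(2) v(1)] aJ by simp
    qed
    then have "b \<in> reflsJ W ?K"
      unfolding b_pa using reflsJ_conj [OF K(2) _ WJ_inv [OF K(2) v(1)]] vJ by fastforce
    then show False using no by simp
  qed
  then show yK: "y \<in> WJ W ?K" using v vJ by simp
  have "psi y = inv y" using y\<theta> by (simp add: psi_def)
  then show "inv y = y" using psi_fix [OF yK] by simp
qed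

end

section \<open>Existence and uniqueness of the module structure\<close>

context sigma_parabolic
begin

sublocale M: hecke_module W S TM VM
  using hecke_M by (auto simp: hecke_module_def hecke_module_axioms_def supp_in_add)

lemma hmodule_M: "is_hmodule W S J M.hact"
  unfolding is_hmodule_def Mcar_eq vadd_eq
  using M.hact_V slin_add [OF M.hact_lin_left] slin_add [OF M.hact_lin] slin_sc [OF M.hact_lin_left]
    slin_sc [OF M.hact_lin] M.hact_hmult M.hact_hone by simp

lemma hact_gen: "\<lbrakk>s \<in> S; m \<in> VM\<rbrakk> \<Longrightarrow> M.hact (bvec s) m = TM s m"
  by (simp add: M.hact_bvec M.Tw_gen)

lemma sigma_vals: "u \<in> WJJ \<Longrightarrow> \<sigma> u = 1 \<or> \<sigma> u = -1"
  using sigma_pm by auto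

lemma rules_M: "action_rules W S J \<sigma> M.hact"
  unfolding action_rules_def
proof (intro ballI conjI impI)
  fix s \<tau> assume s: "s \<in> S" and t: "\<tau> \<in> KK"
  have e: "M.hact (bvec s) (bvec \<tau>) = TM s (bvec \<tau>)" using hact_gen [OF s bvec_supp_in [OF t]] .
  show "M.hact (bvec s) (bvec \<tau>) = bvec (act s \<tau>)" if "s \<in> AscL W S J \<tau>"
    using that TM_bvec(2) [OF s t] e by (simp add: AscL_def)
  show "M.hact (bvec s) (bvec \<tau>) = vadd (bvec (act s \<tau>)) (sc qL (bvec \<tau>))" if "s \<in> DesL W S J \<tau>"
    using that TM_bvec(3) [OF s t] e by (simp add: DesL_def vadd_eq)
  show "M.hact (bvec s) (bvec \<tau>) = sc (- xinv) (bvec \<tau>)" if "s \<in> AscE W S J \<sigma> \<tau>"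
    using that TM_bvec(1) [OF s t] e act_fixed [OF s t] by (simp add: AscE_def lam_def)
  show "M.hact (bvec s) (bvec \<tau>) = sc xL (bvec \<tau>)" if "s \<in> DesE W S J \<sigma> \<tau>"
    using that TM_bvec(1) [OF s t] e act_fixed [OF s t] by (simp add: DesE_def lam_def)
qed

lemma rules_gen:
  assumes mod: "is_hmodule W S J act'" and rules: "action_rules W S J \<sigma> act'"
    and s: "s \<in> S" and m: "m \<in> VM"
  shows "act' (bvec s) m = TM s m"
proof -
  have sH: "bvec s \<in> heckeH W" using s by (simp add: heckeH_eq bvec_supp_in)
  have l: "slin_on KK (\<lambda>p. p) (act' (bvec s))"
    using mod sH unfolding is_hmodule_def Mcar_eq vadd_eq slin_on_def by blast
  have l': "slin_on KK (\<lambda>p. p) (TM s)"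
    using TM_lin [of s] by (simp add: slin_on_def slin_def)
  have "act' (bvec s) (bvec \<tau>) = TM s (bvec \<tau>)" if t: "\<tau> \<in> KK" for \<tau>
  proof -
    have r: "(s \<in> AscL W S J \<tau> \<longrightarrow> act' (bvec s) (bvec \<tau>) = bvec (act s \<tau>))
     \<and> (s \<in> DesL W S J \<tau> \<longrightarrow> act' (bvec s) (bvec \<tau>) = vadd (bvec (act s \<tau>)) (sc qL (bvec \<tau>)))
     \<and> (s \<in> AscE W S J \<sigma> \<tau> \<longrightarrow> act' (bvec s) (bvec \<tau>) = sc (- xinv) (bvec \<tau>))
     \<and> (s \<in> DesE W S J \<sigma> \<tau> \<longrightarrow> act' (bvec s) (bvec \<tau>) = sc xL (bvec \<tau>))"
      using rules s t unfolding action_rules_def by blast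
    consider "ht W S J \<tau> < ht W S J (act s \<tau>)" | "ht W S J (act s \<tau>) < ht W S J \<tau>"
      | "ht W S J (act s \<tau>) = ht W S J \<tau>" by linarith
    then show ?thesis
    proof cases
      case 1
      then show ?thesis using r s TM_bvec(2) [OF s t] by (simp add: AscL_def)
    next
      case 2
      then show ?thesis using r s TM_bvec(3) [OF s t] by (simp add: DesL_def vadd_eq)
    next
      case 3
      then have f: "act s \<tau> = \<tau>" using act_fixed [OF s t] by simp
      then have "cg (fst \<tau>) s \<in> J" using act_fixed_cg [OF s, of "fst \<tau>" "snd \<tau>"] t by simp
      then have "\<sigma> (cg (fst \<tau>) s) = 1 \<or> \<sigma> (cg (fst \<tau>) s) = -1" using sigma_vals by simp
      then show ?thesis
        using r s 3 TM_bvec(1) [OF s t f] by (auto simp: AscE_def DesE_def lam_def)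
    qed
  qed
  then show ?thesis
    using slin_on_expansion [OF finite_KK l m] slin_on_expansion [OF finite_KK l' m] by simp
qed

lemma hmodule_unique:
  assumes mod: "is_hmodule W S J act'" and rules: "action_rules W S J \<sigma> act'"
    and h: "h \<in> heckeH W" and m: "m \<in> VM"
  shows "act' h m = M.hact h m"
proof -
  have one: "act' (hone W) m = m"
    using mod m unfolding is_hmodule_def Mcar_eq by blast
  have mult: "act' (hmult W S a b) m = act' a (act' b m)" if "a \<in> heckeH W" "b \<in> heckeH W" for a b
    using mod m that unfolding is_hmodule_def Mcar_eq by blast
  have w: "act' (bvec (wprod W ws)) m = foldr TM ws m"
    if "set ws \<subseteq> S" "length ws = len (wprod W ws)" for ws
    using that
  proof (induct ws)
    case Nil
    then show ?case using one by (simp add: hone_def)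
  next
    case (Cons s ws)
    have s: "s \<in> S" "set ws \<subseteq> S" using Cons.prems by auto
    note r = reduced_Cons [OF Cons.prems]
    let ?w = "wprod W ws"
    have b: "bvec s \<in> heckeH W" "bvec ?w \<in> heckeH W" using s by (simp_all add: heckeH_eq bvec_supp_in)
    have "hmult W S (bvec s) (bvec ?w) = bvec (s \<otimes> ?w)"
      using Ls_bvec(1) [OF s(1) _ r(2)] s H.Tw_gen [OF s(1) b(2)] by (simp add: hmult_hact H.hact_bvec)
    then have "act' (bvec (s \<otimes> ?w)) m = act' (bvec s) (act' (bvec ?w) m)" using mult [OF b] by simp
    also have "\<dots> = TM s (foldr TM ws m)"
      using Cons.hyps [OF s(2) r(1)] rules_gen [OF mod rules s(1) M.foldr_T_V [OF s(2) m]] by simp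
    finally show ?case by simp
  qed
  have b: "act' (bvec w) m = M.hact (bvec w) m" if "w \<in> carrier W" for w
    using w [of "M.kword w"] M.kword [of w] that by (simp add: M.hact_bvec M.Tw_def)
  have l: "slin_on (carrier W) (\<lambda>p. p) (\<lambda>h. act' h m)"
    using mod m unfolding is_hmodule_def Mcar_eq vadd_eq slin_on_def heckeH_eq by blast
  have l': "slin_on (carrier W) (\<lambda>p. p) (\<lambda>h. M.hact h m)"
    using M.hact_lin_left [of m] by (simp add: slin_on_def slin_def)
  show ?thesis
    using slin_on_expansion [OF finite_carrier l] slin_on_expansion [OF finite_carrier l'] h b
    by (simp add: heckeH_eq)
qed

section \<open>The bar operator\<close>

text \<open>The element \<open>z'\<close> of the closed form. It is the conjugate of
  \<open>z\<close> by \<open>y^-1\<close>, so it stays in the class of \<open>z\<close>.\<close>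

definition star :: "'a \<times> ('a \<Rightarrow> 'a) \<Rightarrow> 'a \<times> ('a \<Rightarrow> 'a)" where "star z = (inv (fst z), snd z)"

definition bar0 where "bar0 \<tau> = M.Uw (fst \<tau> \<otimes> fst (snd \<tau>)) (bvec (\<one>, star (snd \<tau>)))"

lemma IJ_fst: "z \<in> IJ \<Longrightarrow> fst z \<in> WJJ"
  by (auto simp: perfect_invs_def)

lemma star_closed: "z \<in> IJ \<Longrightarrow> star z \<in> IJ"
proof -
  assume z: "z \<in> IJ"
  interpret z: perfect_inv W S J "fst z" "snd z" by (rule perfect_invD [OF z])
  have "wact W (inv (fst z)) z = star z"
    by (simp add: wact_def star_def z.th_inv z.th_y)
  then show ?thesis using wact_closed [OF z, of "inv (fst z)"] by simp
qed

lemma one_WU: "\<one> \<in> WU"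
  by (simp add: WupJ_def)

lemma star_KK: "z \<in> IJ \<Longrightarrow> (\<one>, star z) \<in> KK"
  using star_closed one_WU by (simp add: KK_iff)

lemma star_V: "z \<in> IJ \<Longrightarrow> bvec (\<one>, star z) \<in> VM"
  using star_KK by (rule bvec_supp_in)

lemma bar0_V: "\<tau> \<in> KK \<Longrightarrow> bar0 \<tau> \<in> VM"
  unfolding bar0_def using star_V M.Uw_V IJ_fst WU_closed by (cases \<tau>) (auto simp: KK_iff)

lemma act_one_J: "s \<in> J \<Longrightarrow> act s (\<one>, z) = (\<one>, conjJ W s z)"
  using WU_mult_gen [OF one_WU, of s] by (simp add: act_conj)

lemma bar0_up:
  assumes s: "s \<in> S" and t: "\<tau> \<in> KK" and up: "ht W S J \<tau> < ht W S J (act s \<tau>)"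
  shows "bar0 (act s \<tau>) = M.U s (bar0 \<tau>)"
proof -
  obtain u z where uz: "\<tau> = (u, z)" "u \<in> WU" "z \<in> IJ" using t by (cases \<tau>) (auto simp: KK_iff)
  let ?y = "fst z" and ?e = "bvec (\<one>, star z)"
  interpret z: perfect_inv W S J "fst z" "snd z" by (rule perfect_invD [OF uz(3)])
  have c: "u \<in> carrier W" using uz WU_closed by simp
  have eV: "?e \<in> VM" using star_V [OF uz(3)] .
  have luy: "len (u \<otimes> ?y) = len u + len ?y" using len_WU_mult [OF uz(2)] by simp
  show ?thesis
  proof (cases "s \<otimes> u \<in> WU")
    case True
    have "len u < len (s \<otimes> u)" using up True uz by (simp add: act_move ht_move)
    moreover have "len (s \<otimes> u \<otimes> ?y) = len (s \<otimes> u) + len ?y" using len_WU_mult [OF True] by simp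
    ultimately have "\<not> linv (u \<otimes> ?y) s" using luy c s by (simp add: m_assoc)
    then show ?thesis
      using True uz M.U_Uw [OF s _ _ eV, of "u \<otimes> ?y"] c s by (simp add: bar0_def act_move m_assoc)
  next
    case False
    let ?a = "cg u s"
    have a: "?a \<in> J" using WU_mult_gen [OF uz(2) s] False by simp
    let ?b = "snd z ?a"
    have b: "?b \<in> J" using a by simp
    have at: "act s \<tau> = (u, conjJ W ?a z)" using False uz by (simp add: act_conj)
    have zup: "zlen W J z < zlen W J (conjJ W ?a z)" using up at uz a ht_conj by simp
    have cI: "conjJ W ?a z \<in> IJ" using conjJ_closed [OF uz(3)] a by simp
    have "len ?y < len (?a \<otimes> ?y \<otimes> ?b)"
      using zup zlen_eq [OF uz(3)] zlen_eq [OF cI] by (simp add: conjJ_eq)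
    then have p: "z.psi ?a \<noteq> ?a" "\<not> linv ?y ?a" using z.len_conj_greater_iff [of ?a] a by auto
    have l2: "len (?a \<otimes> ?y \<otimes> ?b) = len ?y + 2" using z.len_conj_gen [OF a p] .
    have y1: "fst (conjJ W ?a z) = ?a \<otimes> ?y \<otimes> ?b" by (simp add: conjJ_eq)
    \<comment> \<open>The ascent multiplies \<open>u y\<close> by \<open>s\<close> on the left and
      by \<open>b\<close> on the right. The length grows by two, so each letter lengthens by one and
      both can be split off \<open>Uw\<close>.\<close>
    have e1: "u \<otimes> (?a \<otimes> ?y \<otimes> ?b) = s \<otimes> (u \<otimes> ?y) \<otimes> ?b"
      using c s b by (simp add: m_assoc)
    have lall: "len (s \<otimes> (u \<otimes> ?y) \<otimes> ?b) = len (u \<otimes> ?y) + 2"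
      using len_WU_mult [OF uz(2), of "?a \<otimes> ?y \<otimes> ?b"] a b luy l2 unfolding e1 [symmetric] by simp
    have bS: "?b \<in> S" "?b \<in> carrier W" using b by simp_all
    have cs: "s \<otimes> (u \<otimes> ?y) \<in> carrier W" "u \<otimes> ?y \<in> carrier W" using c s by simp_all
    have "len (s \<otimes> (u \<otimes> ?y) \<otimes> ?b) \<le> len (s \<otimes> (u \<otimes> ?y)) + 1" "len (s \<otimes> (u \<otimes> ?y)) \<le> len (u \<otimes> ?y) + 1"
      using len_mult_le [OF cs(1) bS(2)] len_mult_le [of s "u \<otimes> ?y"] s cs bS by simp_all
    then have l3: "len (s \<otimes> (u \<otimes> ?y)) = len (u \<otimes> ?y) + 1" using lall by linarith
    have up1: "zlen W J (star z) < zlen W J (conjJ W ?b (star z))"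
      and st1: "conjJ W ?b (star z) = star (conjJ W ?a z)"
    proof -
      show st1: "conjJ W ?b (star z) = star (conjJ W ?a z)"
        using a b refl_inv [of ?b] by (simp add: conjJ_eq star_def inv_mult_group m_assoc)
      show "zlen W J (star z) < zlen W J (conjJ W ?b (star z))"
        unfolding st1 using zlen_eq [OF star_closed [OF uz(3)]] zlen_eq [OF star_closed [OF cI]] zup
          zlen_eq [OF uz(3)] zlen_eq [OF cI] IJ_fst [OF cI] by (simp add: star_def)
    qed
    have "TM ?b ?e = bvec (\<one>, star (conjJ W ?a z))"
      using TM_bvec(2) [OF bS(1) star_KK [OF uz(3)]] act_one_J [OF b] up1 st1
        ht_conj(2) [OF star_closed [OF uz(3)] b] by simp
    \<comment> \<open>The right letter is absorbed here: \<open>U b\<close> undoes the ascent from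
      \<open>star z\<close>.\<close>
    then have Ub: "M.U ?b (bvec (\<one>, star (conjJ W ?a z))) = ?e"
      using M.U_T [OF bS(1) eV] by simp
    have "bar0 (act s \<tau>) = M.Uw (s \<otimes> (u \<otimes> ?y) \<otimes> ?b) (bvec (\<one>, star (conjJ W ?a z)))"
      unfolding at bar0_def fst_conv snd_conv y1 e1 ..
    also have "\<dots> = M.Uw (s \<otimes> (u \<otimes> ?y)) ?e"
      using M.Uw_U [OF bS(1), of "s \<otimes> (u \<otimes> ?y)", OF _ _ star_V [OF cI]] cs lall l3 Ub by simp
    also have "\<dots> = M.U s (M.Uw (u \<otimes> ?y) ?e)"
      using M.U_Uw [OF s, of "u \<otimes> ?y", OF _ _ eV] cs l3 by simp
    finally show ?thesis using uz by (simp add: bar0_def)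
  qed
qed

text \<open>The bar of an eigenvalue of \<open>T s\<close> is the corresponding eigenvalue of its
  inverse \<open>U s\<close>.\<close>

lemma barL_lam: "barL (lam u) = lam u - qL"
  by (simp add: lam_def barL_uminus)

text \<open>Being fixed means \<open>a y = y b\<close>, so \<open>s\<close> passes through
  \<open>u y\<close> as \<open>b\<close>. This \<open>b\<close> fixes \<open>star z\<close>, and its
  eigenvalue is that of the conjugate generator \<open>a\<close>.\<close>

lemma bar0_fixed:
  assumes s: "s \<in> S" and t: "\<tau> \<in> KK" and fx: "act s \<tau> = \<tau>"
  shows "M.U s (bar0 \<tau>) = sc (barL (lam (cg (fst \<tau>) s))) (bar0 \<tau>)"
proof -
  obtain u z where uz: "\<tau> = (u, z)" "u \<in> WU" "z \<in> IJ" using t by (cases \<tau>) (auto simp: KK_iff)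
  let ?y = "fst z" and ?e = "bvec (\<one>, star z)" and ?a = "cg u s"
  interpret z: perfect_inv W S J "fst z" "snd z" by (rule perfect_invD [OF uz(3)])
  have c: "u \<in> carrier W" using uz WU_closed by simp
  have eV: "?e \<in> VM" using star_V [OF uz(3)] .
  have a: "?a \<in> J" "conjJ W ?a z = z" using act_fixed_cg [OF s, of u z] t fx uz by auto
  let ?b = "snd z ?a"
  have b: "?b \<in> J" "?b \<in> S" using a by simp_all
  have "z.psi ?a = ?a" using z.conj_fixed [of ?a] a by (simp add: conjJ_eq prod_eq_iff)
  then have ay: "?a \<otimes> ?y = ?y \<otimes> ?b" using z.psi_mult_y [of ?a] a by simp
  have com: "s \<otimes> (u \<otimes> ?y) = (u \<otimes> ?y) \<otimes> ?b"
  proof -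
    have "s \<otimes> (u \<otimes> ?y) = u \<otimes> (?a \<otimes> ?y)" using c s by (simp add: m_assoc)
    also have "\<dots> = (u \<otimes> ?y) \<otimes> ?b" unfolding ay using c b by (simp add: m_assoc)
    finally show ?thesis .
  qed
  have "?b = inv ?y \<otimes> ?a \<otimes> inv (inv ?y)"
  proof -
    have "inv ?y \<otimes> (?a \<otimes> ?y) = ?b" unfolding ay using b by simp
    then show ?thesis using a by (simp add: m_assoc)
  qed
  then have lb: "lam ?b = lam ?a" using sigma_conj [of ?a "inv ?y"] a by (simp add: lam_def)
  have "conjJ W ?b (star z) = star (conjJ W ?a z)"
    using a(1) b refl_inv [of ?b] by (simp add: conjJ_eq star_def inv_mult_group m_assoc)
  then have "act ?b (\<one>, star z) = (\<one>, star z)" using act_one_J [OF b(1)] a by simp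
  then have "TM ?b ?e = sc (lam ?b) ?e"
    using TM_bvec(1) [OF b(2) star_KK [OF uz(3)]] b by simp
  then have Ue: "M.U ?b ?e = sc (barL (lam ?a)) ?e"
    by (simp add: M.U_def barL_lam lb sc_minus_left)
  have "M.U s (M.Uw (u \<otimes> ?y) ?e) = M.Uw (u \<otimes> ?y) (M.U ?b ?e)"
    using M.U_Uw_commute [OF s b(2) _ com eV] c by simp
  also have "\<dots> = sc (barL (lam ?a)) (M.Uw (u \<otimes> ?y) ?e)"
    unfolding Ue using slin_sc [OF M.Uw_lin, of "u \<otimes> ?y"] c by simp
  finally show ?thesis using uz by (simp add: bar0_def)
qed

text \<open>Only meaningful for minimal \<open>z\<close>, where \<open>bar0 (\<one>, z)\<close> is a unit multiple of \<open>bvec (\<one>, z)\<close>.\<close>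
definition norm_const where "norm_const z = (SOME c. sc c (bar0 (\<one>, z)) = bvec (\<one>, z))"

text \<open>The unit is read off at the minimal element of the class, so it is constant along the
  action and does not disturb compatibility with \<open>U s\<close>.\<close>

definition bar_basis where "bar_basis \<tau> = sc (norm_const (zmin W J (snd \<tau>))) (bar0 \<tau>)"

definition barM where "barM m = (\<Sum>\<tau>\<in>KK. sc (barL (m \<tau>)) (bar_basis \<tau>))"

lemma barM_alin: "alin barM"
  unfolding slin_def
  by (simp only: barM_def plus_fun_apply barL_add sc_add_left sum.distrib sc_apply barL_mult sc_sum sc_sc simp_thms)

lemma barM_bvec: "\<tau> \<in> KK \<Longrightarrow> barM (bvec \<tau>) = bar_basis \<tau>"
proof -
  assume t: "\<tau> \<in> KK"
  have "barM (bvec \<tau>) = (\<Sum>\<upsilon>\<in>KK. if \<upsilon> = \<tau> then bar_basis \<upsilon> else 0)"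
    unfolding barM_def by (rule sum.cong) (auto simp: bvec_def)
  then show ?thesis using t finite_KK by simp
qed

lemma bar_basis_V: "\<tau> \<in> KK \<Longrightarrow> bar_basis \<tau> \<in> VM"
  unfolding bar_basis_def by (intro supp_in_sc bar0_V)

lemma barM_V: "barM m \<in> VM"
  unfolding barM_def by (intro supp_in_sum supp_in_sc bar_basis_V)

lemma zmin_act: "\<lbrakk>s \<in> S; \<tau> \<in> KK\<rbrakk> \<Longrightarrow> zmin W J (snd (act s \<tau>)) = zmin W J (snd \<tau>)"
proof -
  assume s: "s \<in> S" and t: "\<tau> \<in> KK"
  obtain u z where uz: "\<tau> = (u, z)" "u \<in> WU" "z \<in> IJ" using t by (cases \<tau>) (auto simp: KK_iff)
  show ?thesis
  proof (cases "s \<otimes> u \<in> WU")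
    case False
    then have "cg u s \<in> J" using WU_mult_gen [OF uz(2) s] by simp
    then show ?thesis using False uz zmin_conjJ [OF uz(3)] by (simp add: act_conj)
  qed (simp add: uz act_move)
qed

lemma bar_basis_up:
  assumes "s \<in> S" "\<tau> \<in> KK" "ht W S J \<tau> < ht W S J (act s \<tau>)"
  shows "bar_basis (act s \<tau>) = M.U s (bar_basis \<tau>)"
  using bar0_up [OF assms] zmin_act [OF assms(1,2)] slin_sc [OF M.U_lin [OF assms(1)]]
  by (simp add: bar_basis_def)

lemma barM_TM:
  assumes s: "s \<in> S" and m: "m \<in> VM"
  shows "barM (TM s m) = M.U s (barM m)"
proof (rule slin_eq_on [OF finite_KK _ _ _ m])
  show "alin (\<lambda>m. barM (TM s m))" using slin_comp [OF barM_alin TM_lin] .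
  show "alin (\<lambda>m. M.U s (barM m))" using slin_comp [OF M.U_lin [OF s] barM_alin] .
  fix \<tau> assume t: "\<tau> \<in> KK"
  let ?r = "act s \<tau>"
  have r: "?r \<in> KK" "act s ?r = \<tau>" using act_KK act_invol s t by auto
  consider "act s \<tau> = \<tau>" | "ht W S J \<tau> < ht W S J ?r" | "ht W S J ?r < ht W S J \<tau>"
    using act_fixed [OF s t] by linarith
  then show "barM (TM s (bvec \<tau>)) = M.U s (barM (bvec \<tau>))"
  proof cases
    case 1
    have "barM (TM s (bvec \<tau>)) = sc (barL (lam (cg (fst \<tau>) s))) (bar_basis \<tau>)"
      using TM_bvec(1) [OF s t 1] slin_sc [OF barM_alin] barM_bvec [OF t] by simp
    also have "\<dots> = M.U s (bar_basis \<tau>)"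
      using bar0_fixed [OF s t 1] slin_sc [OF M.U_lin [OF s]] by (simp add: bar_basis_def mult.commute)
    finally show ?thesis using barM_bvec [OF t] by simp
  next
    case 2
    then show ?thesis
      using TM_bvec(2) [OF s t] barM_bvec [OF r(1)] barM_bvec [OF t] bar_basis_up [OF s t] by simp
  next
    case 3
    \<comment> \<open>A descent is the ascent out of \<open>act s \<tau>\<close> read backwards;
      \<open>TM s\<close> inverts \<open>U s\<close>.\<close>
    have u: "bar_basis \<tau> = M.U s (bar_basis ?r)" using bar_basis_up [OF s r(1)] r(2) 3 by simp
    have "barM (sc qL (bvec \<tau>)) = - sc qL (bar_basis \<tau>)"
      using slin_sc [OF barM_alin, of qL "bvec \<tau>"] barM_bvec [OF t] by (simp only: barL_qL sc_uminus)
    then have "barM (TM s (bvec \<tau>)) = bar_basis ?r - sc qL (bar_basis \<tau>)"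
      using TM_bvec(3) [OF s t 3] slin_add [OF barM_alin, of "bvec ?r" "sc qL (bvec \<tau>)"]
        barM_bvec [OF r(1)]
      by simp
    also have "bar_basis ?r = TM s (bar_basis \<tau>)"
      unfolding u using M.T_U [OF s bar_basis_V [OF r(1)]] by simp
    finally show ?thesis using barM_bvec [OF t] by (simp only: M.U_def)
  qed
qed

lemma barM_Tw:
  assumes w: "w \<in> carrier W" and m: "m \<in> VM"
  shows "barM (M.Tw w m) = M.Uw w (barM m)"
proof -
  have "barM (foldr TM ws m) = foldr M.U ws (barM m)" if "set ws \<subseteq> S" for ws
    using that
  proof (induct ws)
    case (Cons s ws)
    then show ?case using barM_TM [of s "foldr TM ws m"] M.foldr_T_V [of ws m] m by simp
  qed simp
  then show ?thesis using M.kword [of w] w by (simp add: M.Tw_def M.Uw_def)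
qed

lemma barM_hact:
  assumes m: "m \<in> VM" shows "barM (M.hact h m) = M.hact (barH W S h) (barM m)"
proof -
  have "barM (M.hact h m) = (\<Sum>w\<in>carrier W. sc (barL (h w)) (barM (M.Tw w m)))"
    unfolding M.hact_def by (rule slin_sum_sc [OF barM_alin])
  then show ?thesis using M.hact_barH [OF barM_V] barM_Tw [OF _ m] by simp
qed

lemma compat_barM: "compat_bar W S J M.hact barM"
  unfolding compat_bar_def Mcar_eq vadd_eq
  using barM_V slin_add [OF barM_alin] slin_sc [OF barM_alin] barM_hact by simp

section \<open>Minimal elements and the normalising unit\<close>

lemma minimal_unique:
  assumes z: "z \<in> IJ" "minimalJ W J z" and v: "v \<in> WJJ" "minimalJ W J (wact W v z)"
  shows "wact W v z = z"
proof -
  interpret q: generated_qpset IJ TJ J "conjJ W" "\<lambda>s r. s \<otimes> r \<otimes> s" "zlen W J"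
    by (rule perfect_qpset) simp
  obtain y ws where y: "q.orbit_min y" "set ws \<subseteq> J" "z = foldr (conjJ W) ws y"
    by (rule q.orbit_min_exists [OF z(1)])
  have zy: "z = y"
    unfolding y(3) by (rule q.local_min_unique [OF y(1,2)]) (use z(2) y(3) in \<open>auto simp: minimalJ_def\<close>)
  obtain vs where vs: "set vs \<subseteq> J" "wprod W vs = v" using WJ_word [OF JS v(1)] by blast
  have e: "wact W v z = foldr (conjJ W) vs y" using foldr_conjJ [OF z(1) vs(1)] vs(2) zy by simp
  have "foldr (conjJ W) vs y = y"
    by (rule q.local_min_unique [OF y(1) vs(1)]) (use v(2) e in \<open>auto simp: minimalJ_def\<close>)
  then show ?thesis using e zy by simp
qed

text \<open>Uniqueness of the minimal element in its class determines the \<open>THE\<close> in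
  \<open>zmin\<close>.\<close>

lemma zmin_minimal:
  assumes z: "z \<in> IJ" "minimalJ W J z" shows "zmin W J z = z"
  unfolding zmin_def
proof (rule the_equality)
  show "(\<exists>v\<in>WJJ. z = wact W v z) \<and> minimalJ W J z"
    using z wact_one [OF z(1)] by (auto intro: bexI [of _ \<one>])
  show "z' = z" if "(\<exists>v\<in>WJJ. z' = wact W v z) \<and> minimalJ W J z'" for z'
    using that minimal_unique [OF z] by blast
qed

lemma lam_barL: "lam u * barL (lam u) = 1"
  by (simp add: lam_def barL_uminus)

text \<open>Here \<open>star z = z\<close>, and a reduced word of \<open>y\<close> uses only
  generators fixing \<open>z\<close>. Each acts on the basis vector by a unit; \<open>c\<close> is
  the inverse of their product.\<close>

lemma bar0_minimal:
  assumes z: "z \<in> IJ" "minimalJ W J z"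
  shows "\<exists>c. sc c (bar0 (\<one>, z)) = bvec (\<one>, z)"
proof -
  interpret z: perfect_inv W S J "fst z" "snd z" by (rule perfect_invD [OF z(1)])
  let ?y = "fst z" and ?K = "{s \<in> J. linv (fst z) s}" and ?e = "bvec (\<one>, z)"
  have psi: "z.psi s = s" if s: "s \<in> J" "linv ?y s" for s
  proof (rule ccontr)
    assume "z.psi s \<noteq> s"
    then have "len (s \<otimes> ?y \<otimes> snd z s) < len ?y" using z.len_conj_less [of s] s by simp
    then have "zlen W J (conjJ W s z) < zlen W J z"
      using zlen_eq [OF z(1)] zlen_eq [OF conjJ_closed [OF z(1), of s]] s by (simp add: conjJ_eq)
    then show False using z(2) s unfolding minimalJ_def by fastforce
  qed
  note ms = z.minimal_structure [OF psi]
  have K: "?K \<subseteq> S" by auto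
  have k: "(\<one>, z) \<in> KK" using z one_WU by (simp add: KK_iff)
  have eV: "?e \<in> VM" using bvec_supp_in [OF k] .
  have st: "star z = z" using ms(2) by (simp add: star_def prod_eq_iff)
  obtain ws where ws: "set ws \<subseteq> ?K" "length ws = len ?y" "wprod W ws = ?y"
    using reduced_WJ_word [OF K ms(1)] by blast
  have wsS: "set ws \<subseteq> S" using ws K by blast
  have bar: "bar0 (\<one>, z) = foldr M.U ws ?e"
    using M.Uw_word [OF wsS _ eV] ws st by (simp add: bar0_def)
  have "\<exists>c. sc c (foldr M.U us ?e) = ?e" if "set us \<subseteq> ?K" for us
    using that
  proof (induct us rule: rev_induct)
    case Nil
    then show ?case by (intro exI [of _ 1]) simp
  next
    case (snoc s us)
    then have s: "s \<in> J" "s \<in> S" "linv ?y s" "set us \<subseteq> ?K" by auto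
    obtain c where c: "sc c (foldr M.U us ?e) = ?e" using snoc s by blast
    have "conjJ W s z = z" using z.conj_fixed [of s] psi [OF s(1,3)] s by (simp add: conjJ_eq prod_eq_iff)
    then have "TM s ?e = sc (lam s) ?e"
      using TM_bvec(1) [OF s(2) k] act_one_J [OF s(1)] s by simp
    then have Ue: "M.U s ?e = sc (barL (lam s)) ?e" by (simp add: M.U_def barL_lam sc_minus_left)
    have usS: "set us \<subseteq> S" using s by auto
    have "foldr M.U (us @ [s]) ?e = sc (barL (lam s)) (foldr M.U us ?e)"
      using slin_sc [OF M.foldr_U_lin [OF usS]] Ue by simp
    then have "sc (c * lam s) (foldr M.U (us @ [s]) ?e) = sc (c * (lam s * barL (lam s))) (foldr M.U us ?e)"
      by (simp add: mult.assoc)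
    then show ?case using c lam_barL [of s] by (intro exI [of _ "c * lam s"]) simp
  qed
  then show ?thesis using bar ws(1) by simp
qed

lemma DesL_empty:
  assumes t: "(u, z) \<in> KK" and d: "DesL W S J (u, z) = {}"
  shows "u = \<one>" "minimalJ W J z"
proof -
  have uz: "u \<in> WU" "z \<in> IJ" using t by (auto simp: KK_iff)
  have c: "u \<in> carrier W" using WU_closed [OF uz(1)] .
  show u1: "u = \<one>"
  proof (rule ccontr)
    assume "u \<noteq> \<one>"
    then obtain s where s: "s \<in> S" "linv u s" using descent_exists [of S u] c by auto
    then have "s \<otimes> u \<in> WU" using WU_descend [OF uz(1)] by simp
    then have "s \<in> DesL W S J (u, z)" using s by (simp add: DesL_def act_move ht_move)
    then show False using d by simp
  qed
  show "minimalJ W J z"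
    unfolding minimalJ_def
  proof (intro ballI leI notI)
    fix s assume s: "s \<in> J" "zlen W J (conjJ W s z) < zlen W J z"
    then have "s \<in> DesL W S J (u, z)"
      using u1 act_one_J [OF s(1)] ht_conj(1) [OF uz(2) s(1)] by (simp add: DesL_def)
    then show False using d by simp
  qed
qed

lemma barM_minimal:
  assumes t: "\<tau> \<in> KK" and d: "DesL W S J \<tau> = {}"
  shows "barM (bvec \<tau>) = bvec \<tau>"
proof -
  obtain u z where uz: "\<tau> = (u, z)" by (cases \<tau>)
  have u: "u = \<one>" "minimalJ W J z" using DesL_empty t d unfolding uz by auto
  have z: "z \<in> IJ" using t uz by (simp add: KK_iff)
  have "sc (norm_const z) (bar0 (\<one>, z)) = bvec (\<one>, z)"
    unfolding norm_const_def by (rule someI_ex [OF bar0_minimal [OF z u(2)]])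
  then show ?thesis
    using barM_bvec [OF t] zmin_minimal [OF z u(2)] uz u by (simp add: bar_basis_def)
qed

end

section \<open>Canonical bases\<close>

lemma bvec_apply: "bvec j i = (if i = j then 1 else 0)"
  by (simp add: bvec_def)

text \<open>\<open>g\<close> is the part of negative degree; the constant term of \<open>p\<close>
  equals its own negative and vanishes.\<close>

lemma antisymmetric_split:
  assumes "barL p = - p"
  shows "\<exists>g. Poly_Mapping.keys g \<subseteq> {n. n < 0} \<and> p = g - barL g"
proof -
  define g where "g = (\<Sum>n\<in>{n\<in>Poly_Mapping.keys p. n < 0}. Poly_Mapping.single n (Poly_Mapping.lookup p n))"
  have l: "Poly_Mapping.lookup g n = (if n < 0 then Poly_Mapping.lookup p n else 0)" for n
  proof -
    have "Poly_Mapping.lookup g n =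
        (\<Sum>k\<in>{k\<in>Poly_Mapping.keys p. k < 0}. if k = n then Poly_Mapping.lookup p k else 0)"
      by (simp add: g_def lookup_sum lookup_single when_def)
    also have "\<dots> = (if n < 0 then Poly_Mapping.lookup p n else 0)"
      by (auto simp: sum.delta' Poly_Mapping.in_keys_iff)
    finally show ?thesis .
  qed
  have a: "Poly_Mapping.lookup p (- n) = - Poly_Mapping.lookup p n" for n
    using lookup_barL [of p n] assms by simp
  have "p = g - barL g"
  proof (rule poly_mapping_eqI)
    fix n
    show "Poly_Mapping.lookup p n = Poly_Mapping.lookup (g - barL g) n"
      using a [of n] a [of 0] by (simp add: lookup_minus lookup_barL l)
  qed
  moreover have "Poly_Mapping.keys g \<subseteq> {n. n < 0}"
    by (auto simp: Poly_Mapping.in_keys_iff l split: if_splits)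
  ultimately show ?thesis by blast
qed

lemma symmetric_negative_zero:
  assumes "barL p = p" "Poly_Mapping.keys p \<subseteq> {n. n < 0}"
  shows "p = 0"
proof (rule poly_mapping_eqI)
  fix n
  have "Poly_Mapping.lookup p n = Poly_Mapping.lookup p (- n)" using lookup_barL [of p n] assms by simp
  moreover have "n \<notin> Poly_Mapping.keys p \<or> - n \<notin> Poly_Mapping.keys p" using subsetD [OF assms(2), of n] subsetD [OF assms(2), of "- n"] by auto
  ultimately show "Poly_Mapping.lookup p n = Poly_Mapping.lookup 0 n"
    by (auto simp: Poly_Mapping.in_keys_iff)
qed

lemma finite_max_rank:
  fixes rank :: "'i \<Rightarrow> real"
  assumes "finite F" "F \<noteq> {}"
  obtains i where "i \<in> F" "\<forall>k\<in>F. rank k \<le> rank i"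
proof -
  have "Max (rank ` F) \<in> rank ` F" using assms by simp
  then obtain i where i: "i \<in> F" "rank i = Max (rank ` F)" by auto
  then have "rank k \<le> rank i" if "k \<in> F" for k using assms that by simp
  then show ?thesis using that i by blast
qed

text \<open>Coefficients in \<open>x^-1 Z[x^-1]\<close>.\<close>

definition neg_supp :: "'i set \<Rightarrow> ('i \<Rightarrow> laurent) set" where
  "neg_supp D = {m \<in> supp_in D. \<forall>i. Poly_Mapping.keys (m i) \<subseteq> {n. n < 0}}"

text \<open>The setting of the Kazhdan-Lusztig lemma. \<open>rank\<close> serves to pick maximal
  elements; it is real-valued because \<open>ht\<close> is.\<close>

locale triangular_bar =
  fixes X :: "'i set" and lt :: "'i \<Rightarrow> 'i \<Rightarrow> bool" and rank :: "'i \<Rightarrow> real"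
    and \<phi> :: "('i \<Rightarrow> laurent) \<Rightarrow> ('i \<Rightarrow> laurent)"
  assumes finX: "finite X"
    and lt_X: "lt i j \<Longrightarrow> i \<in> X"
    and lt_trans: "\<lbrakk>lt i j; lt j k\<rbrakk> \<Longrightarrow> lt i k"
    and lt_rank: "lt i j \<Longrightarrow> rank i < rank j"
    and alin: "alin \<phi>"
    and invol: "m \<in> supp_in X \<Longrightarrow> \<phi> (\<phi> m) = m"
    and tri: "j \<in> X \<Longrightarrow> \<phi> (bvec j) - bvec j \<in> supp_in {i. lt i j}"
begin

lemma irrefl: "\<not> lt i i"
  using lt_rank by blast

lemma bar_bvec_coeff: "j \<in> X \<Longrightarrow> \<not> lt i j \<Longrightarrow> \<phi> (bvec j) i = bvec j i"
  using tri [of j] by (simp add: supp_in_def)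

text \<open>With nothing in the support above \<open>i\<close>, unitriangularity leaves only the
  diagonal term.\<close>

lemma top_coeff:
  assumes m: "m \<in> supp_in X" and i: "i \<in> X" and top: "\<And>k. m k \<noteq> 0 \<Longrightarrow> \<not> lt i k"
  shows "\<phi> m i = barL (m i)"
proof -
  have e: "m = (\<Sum>k\<in>X. sc (m k) (bvec k))" by (rule basis_expansion [OF finX m])
  have "\<phi> m = (\<Sum>k\<in>X. sc (barL (m k)) (\<phi> (bvec k)))"
    by (subst e, rule slin_sum_sc [OF alin])
  then have "\<phi> m i = (\<Sum>k\<in>X. barL (m k) * \<phi> (bvec k) i)"
    by (simp only: sum_fun_apply sc_apply)
  also have "\<dots> = (\<Sum>k\<in>X. if k = i then barL (m k) else 0)"
  proof (rule sum.cong)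
    fix k assume k: "k \<in> X"
    show "barL (m k) * \<phi> (bvec k) i = (if k = i then barL (m k) else 0)"
      using bar_bvec_coeff [OF k, of i] top [of k] by (cases "m k = 0") (auto simp: bvec_apply)
  qed simp
  also have "\<dots> = barL (m i)" using i finX by simp
  finally show ?thesis .
qed

text \<open>Induction on the down-closed set \<open>D\<close>. At an element of top rank the
  coefficient of \<open>m\<close> is antisymmetric under \<open>barL\<close> and splits; subtracting
  \<open>?x - \<phi> ?x\<close> removes that element from the support.\<close>

lemma split_antisymmetric:
  assumes "finite D" "D \<subseteq> X" "\<And>i j. \<lbrakk>j \<in> D; lt i j\<rbrakk> \<Longrightarrow> i \<in> D" "m \<in> supp_in D" "\<phi> m = - m"
  shows "\<exists>g\<in>neg_supp D. m = g - \<phi> g"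
  using assms
proof (induct D arbitrary: m rule: finite_psubset_induct)
  case (psubset D m)
  show ?case
  proof (cases "D = {}")
    case True
    then have "m = 0" using psubset.prems by (simp add: supp_in_def fun_eq_iff)
    then have "m = 0 - \<phi> 0" unfolding slin_zero [OF alin] by (simp only: diff_zero)
    moreover have "0 \<in> neg_supp D" by (simp add: neg_supp_def zero_supp_in)
    ultimately show ?thesis by blast
  next
    case False
    obtain i where i: "i \<in> D" "\<forall>k\<in>D. rank k \<le> rank i"
      by (rule finite_max_rank [OF psubset.hyps(1) False, of rank])
    have top: "\<not> lt i k" if "k \<in> D" for k using bspec [OF i(2) that] lt_rank [of i k] by linarith
    have iX: "i \<in> X" using i psubset.prems by blast
    have mX: "m \<in> supp_in X" using psubset.prems(1,3) by (auto simp: supp_in_def)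
    have "\<phi> m i = barL (m i)"
      by (rule top_coeff [OF mX iX]) (use top psubset.prems(3) in \<open>auto simp: supp_in_def\<close>)
    then have "barL (m i) = - m i" using psubset.prems(4) by simp
    then obtain g0 where g0: "Poly_Mapping.keys g0 \<subseteq> {n. n < 0}" "m i = g0 - barL g0"
      using antisymmetric_split by blast
    let ?x = "sc g0 (bvec i)"
    have xX: "?x \<in> supp_in X" using bvec_supp_in [OF iX] by (rule supp_in_sc)
    define m' where "m' = m - (?x - \<phi> ?x)"
    have px: "\<phi> ?x = sc (barL g0) (\<phi> (bvec i))" by (rule slin_sc [OF alin])
    have "\<phi> m' = \<phi> m - (\<phi> ?x - \<phi> (\<phi> ?x))"
      unfolding m'_def slin_minus [OF alin] ..
    then have "\<phi> m' = - m'" unfolding invol [OF xX] psubset.prems(4) m'_def by simp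
    moreover have "m' k = 0" if "k \<notin> D - {i}" for k
    proof (cases "k = i")
      case True
      have "\<phi> (bvec i) i = 1" using bar_bvec_coeff [OF iX irrefl] by (simp add: bvec_apply)
      then show ?thesis using True g0(2) by (simp add: m'_def px sc_apply bvec_apply)
    next
      case False
      then have kD: "k \<notin> D" using that by simp
      then have "\<not> lt k i" using psubset.prems(2) i(1) by blast
      then have "\<phi> (bvec i) k = 0" using bar_bvec_coeff [OF iX, of k] False by (simp add: bvec_apply)
      then show ?thesis
        using False kD psubset.prems(3) by (simp add: m'_def px sc_apply bvec_apply supp_in_def)
    qed
    then have "m' \<in> supp_in (D - {i})" by (simp add: supp_in_def)
    moreover have "k \<in> D - {i}" if "j \<in> D - {i}" "lt k j" for k j
      using that psubset.prems(2) top by blast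
    ultimately obtain g' where g': "g' \<in> neg_supp (D - {i})" "m' = g' - \<phi> g'"
      using psubset.hyps(2) [of "D - {i}" m'] i(1) psubset.prems(1) by blast
    have "m = (g' + ?x) - \<phi> (g' + ?x)"
      using g'(2) slin_add [OF alin, of g' ?x] by (simp add: m'_def algebra_simps)
    moreover have "g' + ?x \<in> neg_supp D"
    proof -
      have "g' i = 0" "g' \<in> supp_in D" using g'(1) by (auto simp: neg_supp_def supp_in_def)
      then have "Poly_Mapping.keys ((g' + ?x) k) \<subseteq> {n. n < 0}" for k
        using g'(1) g0(1) by (auto simp: neg_supp_def sc_apply bvec_apply)
      moreover have "g' + ?x \<in> supp_in D"
        using \<open>g' \<in> supp_in D\<close> bvec_supp_in [OF i(1)] by (intro supp_in_add supp_in_sc)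
      ultimately show ?thesis by (simp add: neg_supp_def)
    qed
    ultimately show ?thesis by blast
  qed
qed

text \<open>A coefficient of top rank would be bar-invariant with negative exponents only.\<close>

lemma bar_invariant_negative_zero:
  assumes d: "d \<in> neg_supp X" and inv: "\<phi> d = d"
  shows "d = 0"
proof (rule ccontr)
  assume "d \<noteq> 0"
  let ?F = "{i. d i \<noteq> 0}"
  have dX: "d \<in> supp_in X" using d by (simp add: neg_supp_def)
  have FX: "?F \<subseteq> X" using dX by (auto simp: supp_in_def)
  have ne: "?F \<noteq> {}" using \<open>d \<noteq> 0\<close> by (auto simp: fun_eq_iff)
  obtain i where i: "i \<in> ?F" "\<forall>k\<in>?F. rank k \<le> rank i"
    by (rule finite_max_rank [OF finite_subset [OF FX finX] ne, of rank])
  have "\<phi> d i = barL (d i)"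
  proof (rule top_coeff [OF dX])
    show "i \<in> X" using i(1) FX by blast
    fix k assume "d k \<noteq> 0"
    then have "rank k \<le> rank i" using i(2) by simp
    then show "\<not> lt i k" using lt_rank by fastforce
  qed
  then have "barL (d i) = d i" using inv by simp
  then have "d i = 0"
    using symmetric_negative_zero [of "d i"] d by (simp add: neg_supp_def)
  then show False using i(1) by simp
qed

text \<open>\<open>\<phi> (bvec j) - bvec j\<close> is antisymmetric, hence of the form
  \<open>g - \<phi> g\<close>; then \<open>bvec j + g\<close> is fixed.\<close>

lemma canonical_exists:
  assumes j: "j \<in> X"
  shows "\<exists>C. \<phi> C = C \<and> C - bvec j \<in> neg_supp {i. lt i j}"
proof -
  let ?D = "{i. lt i j}"
  have D: "?D \<subseteq> X" using lt_X by blast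
  let ?m = "\<phi> (bvec j) - bvec j"
  have "\<phi> ?m = - ?m"
    using slin_minus [OF alin, of "\<phi> (bvec j)" "bvec j"] invol [OF bvec_supp_in [OF j]] by simp
  then obtain g where g: "g \<in> neg_supp ?D" "?m = g - \<phi> g"
    using split_antisymmetric [OF finite_subset [OF D finX] D _ tri [OF j]] lt_trans by blast
  have "\<phi> (bvec j + g) = \<phi> (bvec j) + \<phi> g" by (rule slin_add [OF alin])
  also have "\<dots> = bvec j + g" using g(2) by (simp add: algebra_simps)
  finally have "\<phi> (bvec j + g) = bvec j + g" .
  moreover have "bvec j + g - bvec j \<in> neg_supp ?D" using g(1) by simp
  ultimately show ?thesis by blast
qed

lemma canonical_unique:
  assumes j: "j \<in> X" and C: "\<phi> C = C" "C - bvec j \<in> neg_supp {i. lt i j}"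
    and C': "\<phi> C' = C'" "C' - bvec j \<in> neg_supp {i. lt i j}"
  shows "C' = C"
proof -
  let ?d = "C' - C"
  have "?d \<in> neg_supp X"
  proof -
    have "?d k = 0" if "k \<notin> X" for k
    proof -
      have "\<not> lt k j" using that lt_X by blast
      then have "(C' - bvec j) k = 0" "(C - bvec j) k = 0"
        using C(2) C'(2) unfolding neg_supp_def supp_in_def by blast+
      then show ?thesis by simp
    qed
    moreover have "Poly_Mapping.keys (?d k) \<subseteq> {n. n < 0}" for k
    proof -
      have "Poly_Mapping.keys ((C' - bvec j) k - (C - bvec j) k) \<subseteq>
          Poly_Mapping.keys ((C' - bvec j) k) \<union> Poly_Mapping.keys ((C - bvec j) k)"
        by (rule keys_diff)
      also have "\<dots> \<subseteq> {n. n < 0}" using C(2) C'(2) unfolding neg_supp_def by blast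
      finally show ?thesis by simp
    qed
    ultimately show ?thesis by (simp add: neg_supp_def supp_in_def)
  qed
  moreover have "\<phi> ?d = ?d" using slin_minus [OF alin, of C' C] C(1) C'(1) by simp
  ultimately have "?d = 0" by (rule bar_invariant_negative_zero)
  then show ?thesis by simp
qed

text \<open>Back substitution: the top-ranked coefficient of \<open>m\<close> is cleared by a
  multiple of \<open>C i\<close>, which only affects lower elements.\<close>

lemma unitriangular_span:
  assumes C: "\<And>j. j \<in> X \<Longrightarrow> C j - bvec j \<in> supp_in {i. lt i j}"
    and "finite D" "D \<subseteq> X" "\<And>i j. \<lbrakk>j \<in> D; lt i j\<rbrakk> \<Longrightarrow> i \<in> D" "m \<in> supp_in D"
  shows "\<exists>c\<in>supp_in X. m = (\<Sum>j\<in>X. sc (c j) (C j))"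
  using assms(2-)
proof (induct D arbitrary: m rule: finite_psubset_induct)
  case (psubset D m)
  show ?case
  proof (cases "D = {}")
    case True
    then have m0: "m = 0" using psubset.prems by (simp add: supp_in_def fun_eq_iff)
    have "(\<Sum>j\<in>X. sc ((0::'i \<Rightarrow> laurent) j) (C j)) = 0"
      by (rule sum.neutral) (simp add: zero_fun_def [symmetric])
    then show ?thesis unfolding m0 using zero_supp_in by (intro bexI [of _ 0]) simp_all
  next
    case False
    obtain i where i: "i \<in> D" "\<forall>k\<in>D. rank k \<le> rank i"
      by (rule finite_max_rank [OF psubset.hyps(1) False, of rank])
    have top: "\<not> lt i k" if "k \<in> D" for k using bspec [OF i(2) that] lt_rank [of i k] by linarith
    have iX: "i \<in> X" using i psubset.prems by blast
    define m' where "m' = m - sc (m i) (C i)"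
    have Ci: "C i k = bvec i k" if "\<not> lt k i" for k using C [OF iX] that by (simp add: supp_in_def)
    have "m' k = 0" if "k \<notin> D - {i}" for k
    proof (cases "k = i")
      case True
      then show ?thesis using Ci [of i] irrefl by (simp add: m'_def sc_apply bvec_apply)
    next
      case False
      then have kD: "k \<notin> D" using that by simp
      then have "\<not> lt k i" using psubset.prems(2) i(1) by blast
      then show ?thesis
        using Ci [of k] False kD psubset.prems(3) by (simp add: m'_def sc_apply bvec_apply supp_in_def)
    qed
    then have "m' \<in> supp_in (D - {i})" by (simp add: supp_in_def)
    moreover have "k \<in> D - {i}" if "j \<in> D - {i}" "lt k j" for k j
      using that psubset.prems(2) top by blast
    ultimately obtain c where c: "c \<in> supp_in X" "m' = (\<Sum>j\<in>X. sc (c j) (C j))"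
      using psubset.hyps(2) [of "D - {i}" m'] i(1) psubset.prems(1) by blast
    let ?c = "c + sc (m i) (bvec i)"
    have "(\<Sum>j\<in>X. sc (?c j) (C j)) = (\<Sum>j\<in>X. sc (c j) (C j)) + (\<Sum>j\<in>X. sc (sc (m i) (bvec i) j) (C j))"
      by (simp only: plus_fun_apply sc_add_left sum.distrib)
    also have "(\<Sum>j\<in>X. sc (sc (m i) (bvec i) j) (C j)) = (\<Sum>j\<in>X. if j = i then sc (m i) (C j) else 0)"
      by (rule sum.cong) (auto simp: sc_apply bvec_apply)
    also have "\<dots> = sc (m i) (C i)" using iX finX by simp
    finally have "(\<Sum>j\<in>X. sc (?c j) (C j)) = m' + sc (m i) (C i)" unfolding c(2) .
    then have "m = (\<Sum>j\<in>X. sc (?c j) (C j))" by (simp only: m'_def diff_add_cancel)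
    moreover have "?c \<in> supp_in X" using c(1) bvec_supp_in [OF iX] by (intro supp_in_add supp_in_sc)
    ultimately show ?thesis by blast
  qed
qed

lemma unitriangular_independent:
  assumes C: "\<And>j. j \<in> X \<Longrightarrow> C j - bvec j \<in> supp_in {i. lt i j}"
    and c: "c \<in> supp_in X" and z: "(\<Sum>j\<in>X. sc (c j) (C j)) = 0"
  shows "c = 0"
proof (rule ccontr)
  assume "c \<noteq> 0"
  let ?F = "{i. c i \<noteq> 0}"
  have FX: "?F \<subseteq> X" using c by (auto simp: supp_in_def)
  have ne: "?F \<noteq> {}" using \<open>c \<noteq> 0\<close> by (auto simp: fun_eq_iff)
  obtain i where i: "i \<in> ?F" "\<forall>k\<in>?F. rank k \<le> rank i"
    by (rule finite_max_rank [OF finite_subset [OF FX finX] ne, of rank])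
  have iX: "i \<in> X" using i(1) FX by blast
  have "0 = (\<Sum>j\<in>X. sc (c j) (C j)) i" using z by simp
  also have "\<dots> = (\<Sum>j\<in>X. c j * C j i)" by (simp only: sum_fun_apply sc_apply)
  also have "\<dots> = (\<Sum>j\<in>X. if j = i then c j else 0)"
  proof (rule sum.cong)
    fix j assume j: "j \<in> X"
    show "c j * C j i = (if j = i then c j else 0)"
    proof (cases "c j = 0")
      case False
      then have "rank j \<le> rank i" using i(2) by simp
      then have "\<not> lt i j" using lt_rank by fastforce
      then have "C j i = bvec j i" using C [OF j] by (simp add: supp_in_def)
      then show ?thesis by (auto simp: bvec_apply)
    qed auto
  qed simp
  also have "\<dots> = c i" using iX finX by simp
  finally show False using i(1) by simp
qed

end

section \<open>Bruhat orders, heights and triangularity\<close>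

context coxeter
begin

text \<open>If \<open>s\<close> reverses \<open>x < r x\<close>, the cocycle makes
  \<open>s r s\<close> an inversion of \<open>s\<close>, so \<open>r = s\<close>.\<close>

lemma bruhat_qpset: "qpset (carrier W) refls S (\<lambda>t w. t \<otimes> w) (\<lambda>s r. s \<otimes> r \<otimes> s) len"
proof unfold_locales
  show "S \<subseteq> refls" by auto
  show "r \<otimes> x \<in> carrier W" if "r \<in> refls" "x \<in> carrier W" for r x using that by simp
  show "r \<otimes> (r \<otimes> x) = x" if "r \<in> refls" "x \<in> carrier W" for r x using that by simp
  show cl: "s \<otimes> r \<otimes> s \<in> refls" if "s \<in> S" "r \<in> refls" for s r
    using refl_conj [of r s] that by simp
  show "s \<otimes> (r \<otimes> x) = s \<otimes> r \<otimes> s \<otimes> (s \<otimes> x)" if "s \<in> S" "r \<in> refls" "x \<in> carrier W" for s r x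
    using that by (simp add: m_assoc)
  show "r \<otimes> x = x" if "r \<in> refls" "x \<in> carrier W" "len (r \<otimes> x) = len x" for r x
    using len_refl_neq that by blast
  show "r \<otimes> x = s \<otimes> x"
    if r: "r \<in> refls" and s: "s \<in> S" and x: "x \<in> carrier W" and up: "len x < len (r \<otimes> x)"
      and down: "len (s \<otimes> (r \<otimes> x)) < len (s \<otimes> x)" for r s x
  proof -
    let ?r = "s \<otimes> r \<otimes> s"
    have r1: "?r \<in> refls" using cl r s by simp
    have "linv (s \<otimes> x) ?r" using down r s x by (simp add: m_assoc)
    moreover have "inv s \<otimes> ?r \<otimes> s = r" using r s by (simp add: m_assoc)
    ultimately have "linv s ?r" using linv_mult [OF r1, of s x] s x up by auto
    then have "?r = s" using linv_gen [OF r1 s] by simp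
    then have "s \<otimes> ?r \<otimes> s = s \<otimes> s \<otimes> s" by simp
    then have "r = s" using r s by (simp add: m_assoc)
    then show ?thesis by simp
  qed
qed

sublocale B: qpset "carrier W" refls S "\<lambda>t w. t \<otimes> w" "\<lambda>s r. s \<otimes> r \<otimes> s" len
  by (rule bruhat_qpset)

text \<open>The definition multiplies by reflections on the right, the lifting property on the left;
  \<open>x t = (x t x^-1) x\<close> identifies the steps.\<close>

lemma bruhat_less_iff: "bruhat_less W S u w \<longleftrightarrow> (u, w) \<in> B.step\<^sup>+"
proof -
  have "{(v, v \<otimes> t) | v t. v \<in> carrier W \<and> t \<in> refls \<and> len v < len (v \<otimes> t)} = B.step" (is "?L = _")
  proof (intro equalityI subrelI)
    fix x y assume "(x, y) \<in> ?L"
    then obtain t where t: "x \<in> carrier W" "t \<in> refls" "len x < len (x \<otimes> t)" "y = x \<otimes> t" by blast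
    have "(x \<otimes> t \<otimes> inv x) \<otimes> x = x \<otimes> t" using t(1,2) by (simp add: m_assoc)
    then show "(x, y) \<in> B.step"
      using B.stepI [of x "x \<otimes> t \<otimes> inv x"] refl_conj [OF t(2,1)] t by simp
  next
    fix x y assume "(x, y) \<in> B.step"
    then obtain t where t: "x \<in> carrier W" "t \<in> refls" "len x < len (t \<otimes> x)" "y = t \<otimes> x"
      unfolding B.step_def by blast
    have e: "x \<otimes> (inv x \<otimes> t \<otimes> x) = t \<otimes> x" using t(1,2) by (simp add: m_assoc)
    have "(x, x \<otimes> (inv x \<otimes> t \<otimes> x)) \<in> ?L"
      using t refl_conj' [OF t(2,1)] e by (intro CollectI exI [of _ x] exI [of _ "inv x \<otimes> t \<otimes> x"]) simp
    then show "(x, y) \<in> ?L" unfolding e t(4) .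
  qed
  then show ?thesis by (simp only: bruhat_less_def)
qed

lemma bruhat_less_trans: "\<lbrakk>bruhat_less W S u v; bruhat_less W S v w\<rbrakk> \<Longrightarrow> bruhat_less W S u w"
  unfolding bruhat_less_iff by (rule trancl_trans)

lemma bruhat_less_gen:
  assumes "s \<in> S" "u \<in> carrier W" "len u < len (s \<otimes> u)" shows "bruhat_less W S u (s \<otimes> u)"
  unfolding bruhat_less_iff using assms B.stepI [of u s] by (simp add: r_into_trancl)

lemma bruhat_less_lift:
  "\<lbrakk>bruhat_less W S u w; s \<in> S; len w < len (s \<otimes> w)\<rbrakk> \<Longrightarrow> bruhat_less W S (s \<otimes> u) (s \<otimes> w)"
  unfolding bruhat_less_iff by (rule B.lifting)

lemma bruhat_less_len: "bruhat_less W S u w \<Longrightarrow> len u < len w"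
  unfolding bruhat_less_iff using B.trancl_step_less by blast

end

context sigma_parabolic
begin

text \<open>Descends in \<open>u\<close> until \<open>u = 1\<close> and only then in
  \<open>z\<close>. The disjunction in \<open>step\<close> confines conjugation steps to
  \<open>u = 1\<close>, below which \<open>W\<close> has no element; \<open>precK_lift\<close>
  depends on this.\<close>

lemma KK_induct [consumes 1]:
  assumes t: "\<tau> \<in> KK"
    and base: "\<And>\<tau>. \<lbrakk>\<tau> \<in> KK; DesL W S J \<tau> = {}\<rbrakk> \<Longrightarrow> P \<tau>"
    and step: "\<And>s u z. \<lbrakk>s \<in> S; (u, z) \<in> KK; ht W S J (u, z) < ht W S J (act s (u, z));
      s \<otimes> u \<in> WU \<or> u = \<one>; P (u, z)\<rbrakk> \<Longrightarrow> P (act s (u, z))"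
  shows "P \<tau>"
  using t
proof (induct "len (fst \<tau>) + zlen W J (snd \<tau>)" arbitrary: \<tau> rule: less_induct)
  case less
  obtain u z where uz: "\<tau> = (u, z)" "u \<in> WU" "z \<in> IJ" using less.prems by (cases \<tau>) (auto simp: KK_iff)
  have c: "u \<in> carrier W" using WU_closed [OF uz(2)] .
  show ?case
  proof (cases "u = \<one>")
    case False
    then obtain s where s: "s \<in> S" "linv u s" using descent_exists [of S u] c by auto
    have su: "s \<otimes> u \<in> WU" using WU_descend [OF uz(2) s] .
    have k: "(s \<otimes> u, z) \<in> KK" using su uz by (simp add: KK_iff)
    have a: "act s (s \<otimes> u, z) = \<tau>" using uz c s by (simp add: act_move)
    have "P (act s (s \<otimes> u, z))"
    proof (rule step [OF s(1) k])
      show "ht W S J (s \<otimes> u, z) < ht W S J (act s (s \<otimes> u, z))"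
        unfolding a uz(1) using s by (simp add: ht_move)
      show "s \<otimes> (s \<otimes> u) \<in> WU \<or> s \<otimes> u = \<one>" using uz c s by simp
      show "P (s \<otimes> u, z)" by (rule less.hyps [OF _ k]) (use s uz in simp)
    qed
    then show ?thesis unfolding a .
  next
    case u1: True
    show ?thesis
    proof (cases "minimalJ W J z")
      case True
      have "\<not> ht W S J (act s \<tau>) < ht W S J \<tau>" if s: "s \<in> S" for s
      proof (cases "s \<otimes> u \<in> WU")
        case True
        then show ?thesis using uz u1 by (simp add: act_move ht_move)
      next
        case False
        then have "s \<in> J" using WU_mult_gen [OF uz(2) s] u1 s by simp
        then show ?thesis
          using \<open>minimalJ W J z\<close> uz u1 ht_conj(1) [OF uz(3)] by (auto simp: act_one_J minimalJ_def not_less)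
      qed
      then have "DesL W S J \<tau> = {}" by (auto simp: DesL_def)
      then show ?thesis by (rule base [OF less.prems])
    next
      case False
      then obtain s where s: "s \<in> J" "zlen W J (conjJ W s z) < zlen W J z"
        unfolding minimalJ_def by (auto simp: not_le)
      have k: "(\<one>, conjJ W s z) \<in> KK" using conjJ_closed [OF uz(3)] s one_WU by (simp add: KK_iff)
      have a: "act s (\<one>, conjJ W s z) = \<tau>"
        using act_one_J [OF s(1)] conjJ_invol [OF s(1) uz(3)] uz u1 by simp
      have "P (act s (\<one>, conjJ W s z))"
      proof (rule step [OF _ k])
        show "s \<in> S" using s by simp
        show "ht W S J (\<one>, conjJ W s z) < ht W S J (act s (\<one>, conjJ W s z))"
          unfolding a uz(1) u1 using s ht_conj(1) [OF uz(3) s(1)] by simp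
        show "s \<otimes> \<one> \<in> WU \<or> \<one> = \<one>" by simp
        show "P (\<one>, conjJ W s z)" by (rule less.hyps [OF _ k]) (use s uz u1 in simp)
      qed
      then show ?thesis unfolding a .
    qed
  qed
qed

text \<open>Along an ascent \<open>M_(s\<tau>) = H_s M_\<tau>\<close>, so compatibility propagates
  agreement from the elements without strict descent.\<close>

lemma barM_unique:
  assumes comp: "compat_bar W S J M.hact \<phi>'" and fx: "fixes_minimal W S J \<phi>'" and m: "m \<in> VM"
  shows "\<phi>' m = barM m"
proof -
  have l: "slin_on KK barL \<phi>'"
    using comp unfolding compat_bar_def Mcar_eq vadd_eq slin_on_def by blast
  have l': "slin_on KK barL barM"
    using barM_alin by (simp add: slin_on_def slin_def)
  have "\<phi>' (bvec \<tau>) = barM (bvec \<tau>)" if "\<tau> \<in> KK" for \<tau>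
    using that
  proof (induct rule: KK_induct)
    case (1 \<tau>)
    then show ?case using fx barM_minimal [of \<tau>] by (simp add: fixes_minimal_def)
  next
    case (2 s u z)
    let ?v = "(u, z)"
    have vV: "bvec ?v \<in> VM" using bvec_supp_in [OF 2(2)] .
    have sH: "bvec s \<in> heckeH W" using 2(1) by (simp add: heckeH_eq bvec_supp_in)
    have e: "bvec (act s ?v) = M.hact (bvec s) (bvec ?v)"
      using TM_bvec(2) [OF 2(1-3)] hact_gen [OF 2(1) vV] by simp
    have "\<phi>' (bvec (act s ?v)) = M.hact (barH W S (bvec s)) (\<phi>' (bvec ?v))"
      unfolding e using comp sH vV unfolding compat_bar_def Mcar_eq by blast
    then show ?case unfolding 2(5) e barM_hact [OF vV] .
  qed
  then show ?thesis
    using slin_on_expansion [OF finite_KK l m] slin_on_expansion [OF finite_KK l' m] by simp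
qed

text \<open>\<open>barM\<close> exchanges \<open>TM s\<close> with its inverse \<open>U s\<close>,
  so its square commutes with \<open>TM s\<close>.\<close>

lemma barM_invol:
  assumes m: "m \<in> VM" shows "barM (barM m) = m"
proof (rule slin_eq_on [OF finite_KK _ lin_id _ m])
  show "lin (\<lambda>m. barM (barM m))" using slin_comp [OF barM_alin barM_alin] by simp
  fix \<tau> assume "\<tau> \<in> KK"
  then show "barM (barM (bvec \<tau>)) = bvec \<tau>"
  proof (induct rule: KK_induct)
    case (1 \<tau>)
    then show ?case using barM_minimal [of \<tau>] by simp
  next
    case (2 s u z)
    let ?v = "bvec (u, z)"
    have vV: "?v \<in> VM" using bvec_supp_in [OF 2(2)] .
    have e: "bvec (act s (u, z)) = TM s ?v" using TM_bvec(2) [OF 2(1-3)] by simp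
    let ?x = "barM ?v"
    have "barM (barM (TM s ?v)) = barM (TM s ?x - sc qL ?x)"
      using barM_TM [OF 2(1) vV] by (simp only: M.U_def)
    also have "\<dots> = barM (TM s ?x) - barM (sc qL ?x)" by (rule slin_minus [OF barM_alin])
    also have "barM (sc qL ?x) = - sc qL (barM ?x)"
      using slin_sc [OF barM_alin, of qL ?x] by (simp only: barL_qL sc_uminus)
    also have "barM (TM s ?x) = TM s (barM ?x) - sc qL (barM ?x)"
      using barM_TM [OF 2(1) barM_V] by (simp only: M.U_def)
    finally show ?case unfolding e 2(5) by simp
  qed
qed

lemma qp_less_iff: "qp_less W J z z' \<longleftrightarrow> (z, z') \<in> (qpset.step IJ TJ (conjJ W) (zlen W J))\<^sup>+"
proof -
  interpret q: generated_qpset IJ TJ J "conjJ W" "\<lambda>s r. s \<otimes> r \<otimes> s" "zlen W J"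
    by (rule perfect_qpset) simp
  show ?thesis by (simp only: qp_less_def q.step_def)
qed

lemma qp_less_trans: "\<lbrakk>qp_less W J x y; qp_less W J y z\<rbrakk> \<Longrightarrow> qp_less W J x z"
  unfolding qp_less_def by (rule trancl_trans)

lemma qp_less_gen:
  assumes "s \<in> J" "z \<in> IJ" "zlen W J z < zlen W J (conjJ W s z)"
  shows "qp_less W J z (conjJ W s z)"
proof -
  interpret q: generated_qpset IJ TJ J "conjJ W" "\<lambda>s r. s \<otimes> r \<otimes> s" "zlen W J"
    by (rule perfect_qpset) simp
  show ?thesis unfolding qp_less_iff using q.stepI [of z s] assms by (simp add: r_into_trancl)
qed

lemma qp_less_lift:
  assumes "qp_less W J x z" "s \<in> J" "zlen W J z < zlen W J (conjJ W s z)"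
  shows "qp_less W J (conjJ W s x) (conjJ W s z)"
proof -
  interpret q: generated_qpset IJ TJ J "conjJ W" "\<lambda>s r. s \<otimes> r \<otimes> s" "zlen W J"
    by (rule perfect_qpset) simp
  show ?thesis using q.lifting assms unfolding qp_less_iff by blast
qed

lemma same_orbit_act: "\<lbrakk>s \<in> S; \<tau> \<in> KK\<rbrakk> \<Longrightarrow> same_orbit W S J \<tau> (act s \<tau>)"
  unfolding same_orbit_def by (rule r_into_rtrancl) blast

lemma same_orbit_trans: "\<lbrakk>same_orbit W S J x y; same_orbit W S J y z\<rbrakk> \<Longrightarrow> same_orbit W S J x z"
  unfolding same_orbit_def by (rule rtrancl_trans)

lemma precK_trans:
  assumes xy: "precK W S J x y" and yz: "precK W S J y z" shows "precK W S J x z"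
proof -
  have "bruhat_less W S (fst x) (fst y) \<or> fst x = fst y \<and> qp_less W J (snd x) (snd y)"
    "bruhat_less W S (fst y) (fst z) \<or> fst y = fst z \<and> qp_less W J (snd y) (snd z)"
    using xy yz unfolding precK_def by blast+
  then have "bruhat_less W S (fst x) (fst z) \<or> fst x = fst z \<and> qp_less W J (snd x) (snd z)"
    using bruhat_less_trans [of "fst x" "fst y" "fst z"] qp_less_trans [of "snd x" "snd y" "snd z"] by auto
  moreover have "same_orbit W S J x z"
    using same_orbit_trans [of x y z] xy yz unfolding precK_def by blast
  ultimately show ?thesis using xy yz unfolding precK_def by linarith
qed

lemma ht_act_le:
  assumes s: "s \<in> S" and t: "\<tau> \<in> KK"
  shows "ht W S J (act s \<tau>) \<le> ht W S J \<tau> + 1"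
proof -
  obtain u z where uz: "\<tau> = (u, z)" "u \<in> WU" "z \<in> IJ" using t by (cases \<tau>) (auto simp: KK_iff)
  show ?thesis
  proof (cases "s \<otimes> u \<in> WU")
    case True
    have "len (s \<otimes> u) \<le> len u + 1" using len_mult_le [of s u] s WU_closed [OF uz(2)] by simp
    then show ?thesis using True uz by (simp add: act_move ht_def)
  next
    case False
    let ?a = "cg u s"
    interpret z: perfect_inv W S J "fst z" "snd z" by (rule perfect_invD [OF uz(3)])
    have a: "?a \<in> J" using WU_mult_gen [OF uz(2) s] False by simp
    have "len (?a \<otimes> fst z \<otimes> snd z ?a) \<le> len (?a \<otimes> fst z) + len (snd z ?a)"
      "len (?a \<otimes> fst z) \<le> len ?a + len (fst z)"
      using len_mult_le [of "?a \<otimes> fst z" "snd z ?a"] len_mult_le [of ?a "fst z"] a by simp_all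
    moreover have "len ?a = 1" "len (snd z ?a) = 1" using a by (simp_all del: One_nat_def)
    ultimately have "zlen W J (conjJ W ?a z) \<le> zlen W J z + 2"
      using zlen_eq [OF uz(3)] zlen_eq [OF conjJ_closed [OF uz(3), of ?a]] a by (simp add: conjJ_eq)
    then have r: "real (zlen W J (conjJ W ?a z)) \<le> real (zlen W J z) + 2" by linarith
    have "ht W S J (act s \<tau>) =
        real (len u) + (real (zlen W J (conjJ W ?a z)) - real (zlen W J (zmin W J z))) / 2"
      using False uz(1) zmin_conjJ [OF uz(3), of ?a] a by (simp add: act_conj ht_def)
    moreover have "ht W S J \<tau> = real (len u) + (real (zlen W J z) - real (zlen W J (zmin W J z))) / 2"
      using uz(1) by (simp add: ht_def)
    ultimately show ?thesis using r by argo
  qed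
qed

text \<open>A conjugation ascent lengthens \<open>z\<close> by exactly two, which the factor one
  half in \<open>ht\<close> turns into one. Together with \<open>ht_act_le\<close> this keeps the
  strict height inequality in \<open>precK_lift\<close>.\<close>

lemma ht_act_up:
  assumes s: "s \<in> S" and t: "\<tau> \<in> KK" and up: "ht W S J \<tau> < ht W S J (act s \<tau>)"
  shows "ht W S J (act s \<tau>) = ht W S J \<tau> + 1"
proof -
  obtain u z where uz: "\<tau> = (u, z)" "u \<in> WU" "z \<in> IJ" using t by (cases \<tau>) (auto simp: KK_iff)
  have "ht W S J \<tau> + 1 \<le> ht W S J (act s \<tau>)"
  proof (cases "s \<otimes> u \<in> WU")
    case True
    then show ?thesis using up uz by (simp add: act_move ht_def)
  next
    case False
    let ?a = "cg u s"
    interpret z: perfect_inv W S J "fst z" "snd z" by (rule perfect_invD [OF uz(3)])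
    have a: "?a \<in> J" using WU_mult_gen [OF uz(2) s] False by simp
    have cI: "conjJ W ?a z \<in> IJ" using conjJ_closed [OF uz(3)] a by simp
    have "zlen W J z < zlen W J (conjJ W ?a z)" using up uz False a ht_conj(2) [OF uz(3) a] by (simp add: act_conj)
    then have "len (fst z) < len (?a \<otimes> fst z \<otimes> snd z ?a)"
      using zlen_eq [OF uz(3)] zlen_eq [OF cI] by (simp add: conjJ_eq)
    then have "z.psi ?a \<noteq> ?a" "\<not> linv (fst z) ?a" using z.len_conj_greater_iff [of ?a] a by auto
    then have "len (?a \<otimes> fst z \<otimes> snd z ?a) = len (fst z) + 2" using z.len_conj_gen [OF a] by simp
    then have "zlen W J (conjJ W ?a z) = zlen W J z + 2"
      using zlen_eq [OF uz(3)] zlen_eq [OF cI] by (simp add: conjJ_eq)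
    then show ?thesis using False uz zmin_conjJ [OF uz(3), of ?a] a by (simp add: act_conj ht_def)
  qed
  then show ?thesis using ht_act_le [OF s t] by simp
qed

lemma precK_up:
  assumes s: "s \<in> S" and t: "(u, z) \<in> KK" and up: "ht W S J (u, z) < ht W S J (act s (u, z))"
  shows "precK W S J (u, z) (act s (u, z))"
proof -
  have uz: "u \<in> WU" "z \<in> IJ" using t by (auto simp: KK_iff)
  have "bruhat_less W S u (fst (act s (u, z))) \<or>
     u = fst (act s (u, z)) \<and> qp_less W J z (snd (act s (u, z)))"
  proof (cases "s \<otimes> u \<in> WU")
    case True
    then have "len u < len (s \<otimes> u)" using up by (simp add: act_move ht_move)
    then show ?thesis using True bruhat_less_gen [OF s WU_closed [OF uz(1)]] by (simp add: act_move)
  next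
    case False
    have a: "cg u s \<in> J" using WU_mult_gen [OF uz(1) s] False by simp
    then have "zlen W J z < zlen W J (conjJ W (cg u s) z)"
      using up False ht_conj(2) [OF uz(2)] by (simp add: act_conj)
    then show ?thesis using False qp_less_gen [OF a uz(2)] by (simp add: act_conj)
  qed
  then show ?thesis
    using act_KK [OF s t] same_orbit_act [OF s t] t up by (simp add: precK_def)
qed

text \<open>Bruhat lifting while \<open>u\<close> moves, lifting for involutions at
  \<open>u = 1\<close>. If \<open>u' < u\<close> and \<open>s\<close> only conjugates over
  \<open>u'\<close>, then \<open>u' < u < s u\<close> is enough.\<close>

lemma precK_lift:
  assumes s: "s \<in> S" and t: "(u, z) \<in> KK" and up: "ht W S J (u, z) < ht W S J (act s (u, z))"
    and u1: "s \<otimes> u \<in> WU \<or> u = \<one>" and p: "precK W S J \<upsilon> (u, z)"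
  shows "precK W S J (act s \<upsilon>) (act s (u, z))"
proof -
  have uz: "u \<in> WU" "z \<in> IJ" using t by (auto simp: KK_iff)
  have k: "\<upsilon> \<in> KK" using p by (simp add: precK_def)
  then obtain u' z' where v: "\<upsilon> = (u', z')" "u' \<in> WU" "z' \<in> IJ" by (cases \<upsilon>) (auto simp: KK_iff)
  have ord: "bruhat_less W S u' u \<or> (u' = u \<and> qp_less W J z' z)" using p v(1) by (simp add: precK_def)
  have "same_orbit W S J (act s \<upsilon>) \<upsilon>"
    using same_orbit_act [OF s act_KK [OF s k]] act_invol [OF s k] by simp
  moreover have "same_orbit W S J \<upsilon> (u, z)" using p by (simp add: precK_def)
  ultimately have orb: "same_orbit W S J (act s \<upsilon>) (act s (u, z))"
    using same_orbit_act [OF s t] same_orbit_trans by blast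
  have "ht W S J (act s \<upsilon>) \<le> ht W S J \<upsilon> + 1" by (rule ht_act_le [OF s k])
  also have "\<dots> < ht W S J (u, z) + 1" using p by (simp add: precK_def)
  also have "\<dots> = ht W S J (act s (u, z))" using ht_act_up [OF s t up] by simp
  finally have h: "ht W S J (act s \<upsilon>) < ht W S J (act s (u, z))" .
  have "bruhat_less W S (fst (act s \<upsilon>)) (fst (act s (u, z))) \<or>
     fst (act s \<upsilon>) = fst (act s (u, z)) \<and> qp_less W J (snd (act s \<upsilon>)) (snd (act s (u, z)))"
  proof (cases "s \<otimes> u \<in> WU")
    case True
    have l: "len u < len (s \<otimes> u)" using up True by (simp add: act_move ht_move)
    have b: "bruhat_less W S u (s \<otimes> u)" using bruhat_less_gen [OF s WU_closed [OF uz(1)] l] .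
    from ord show ?thesis
    proof
      assume lt: "bruhat_less W S u' u"
      show ?thesis
      proof (cases "s \<otimes> u' \<in> WU")
        case True
        then show ?thesis using bruhat_less_lift [OF lt s l] \<open>s \<otimes> u \<in> WU\<close> v by (simp add: act_move)
      next
        case False
        then show ?thesis using bruhat_less_trans [OF lt b] \<open>s \<otimes> u \<in> WU\<close> v by (simp add: act_move act_conj)
      qed
    next
      assume "u' = u \<and> qp_less W J z' z"
      then show ?thesis using True v by (simp add: act_move)
    qed
  next
    case False
    then have u: "u = \<one>" using u1 by simp
    then have "\<not> bruhat_less W S u' u" using bruhat_less_len [of u' u] by auto
    then have e: "u' = \<one>" "qp_less W J z' z" using ord u by auto
    have sJ: "s \<in> J" using WU_mult_gen [OF uz(1) s] False u s by simp
    have "zlen W J z < zlen W J (conjJ W s z)"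
      using up u act_one_J [OF sJ] ht_conj(2) [OF uz(2) sJ] by simp
    then show ?thesis using qp_less_lift [OF e(2) sJ] act_one_J [OF sJ] u e(1) v by simp
  qed
  then show ?thesis
    using orb h act_KK [OF s k] act_KK [OF s t] by (simp add: precK_def)
qed

lemma U_bvec_supp:
  assumes s: "s \<in> S" and k: "\<upsilon> \<in> KK" "\<upsilon> \<in> D" "act s \<upsilon> \<in> D"
  shows "M.U s (bvec \<upsilon>) \<in> supp_in D"
proof -
  consider "act s \<upsilon> = \<upsilon>" | "ht W S J \<upsilon> < ht W S J (act s \<upsilon>)" | "ht W S J (act s \<upsilon>) < ht W S J \<upsilon>"
    using act_fixed [OF s k(1)] by linarith
  then have "TM s (bvec \<upsilon>) \<in> supp_in D"
  proof cases
    case 1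
    then show ?thesis using TM_bvec(1) [OF s k(1)] supp_in_sc [OF bvec_supp_in [OF k(2)]] by simp
  next
    case 2
    then show ?thesis using TM_bvec(2) [OF s k(1)] bvec_supp_in [OF k(3)] by simp
  next
    case 3
    then show ?thesis
      using TM_bvec(3) [OF s k(1)] supp_in_add [OF bvec_supp_in [OF k(3)] supp_in_sc [OF bvec_supp_in [OF k(2)]]]
      by simp
  qed
  then show ?thesis unfolding M.U_def using supp_in_diff supp_in_sc [OF bvec_supp_in [OF k(2)]] by blast
qed

text \<open>For an ascent from \<open>v\<close> to \<open>t\<close>,
  \<open>bar M_t = U_s (M_v + r)\<close> with \<open>r\<close> supported below \<open>v\<close>.
  Here \<open>U_s M_v = M_t - (x - x^-1) M_v\<close>, and \<open>U_s r\<close> stays below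
  \<open>t\<close> because \<open>\<upsilon>\<close> and \<open>s\<upsilon>\<close> do, by
  \<open>precK_up\<close> and \<open>precK_lift\<close>.\<close>

lemma barM_triangular:
  assumes "\<tau> \<in> KK"
  shows "barM (bvec \<tau>) - bvec \<tau> \<in> supp_in {\<upsilon>. precK W S J \<upsilon> \<tau>}"
  using assms
proof (induct rule: KK_induct)
  case (1 \<tau>)
  show ?case unfolding barM_minimal [OF 1] diff_self by (rule zero_supp_in)
next
  case (2 s u z)
  let ?v = "(u, z)" and ?t = "act s (u, z)"
  let ?D = "{\<upsilon>. precK W S J \<upsilon> ?t}"
  have vV: "bvec ?v \<in> VM" using bvec_supp_in [OF 2(2)] .
  have vD: "?v \<in> ?D" using precK_up [OF 2(1-3)] by simp
  have e: "bvec ?t = TM s (bvec ?v)" using TM_bvec(2) [OF 2(1-3)] by simp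
  define r where "r = barM (bvec ?v) - bvec ?v"
  have r0: "r \<upsilon> = 0" if "\<not> precK W S J \<upsilon> ?v" for \<upsilon> using 2(5) that unfolding r_def supp_in_def by blast
  have "r \<in> VM" using r0 by (auto simp: supp_in_def precK_def)
  then have re: "r = (\<Sum>\<upsilon>\<in>KK. sc (r \<upsilon>) (bvec \<upsilon>))" by (rule basis_expansion [OF finite_KK])
  have "M.U s r = (\<Sum>\<upsilon>\<in>KK. sc (r \<upsilon>) (M.U s (bvec \<upsilon>)))"
    by (subst re, rule slin_sum_sc [OF M.U_lin [OF 2(1)]])
  also have "\<dots> \<in> supp_in ?D"
  proof (rule supp_in_sum)
    fix \<upsilon> assume k: "\<upsilon> \<in> KK"
    show "sc (r \<upsilon>) (M.U s (bvec \<upsilon>)) \<in> supp_in ?D"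
    proof (cases "precK W S J \<upsilon> ?v")
      case True
      then have "\<upsilon> \<in> ?D" "act s \<upsilon> \<in> ?D"
        using precK_trans [OF True] precK_up [OF 2(1-3)] precK_lift [OF 2(1-4) True] by auto
      then show ?thesis by (intro supp_in_sc U_bvec_supp [OF 2(1) k])
    next
      case False
      then show ?thesis using r0 [OF False] zero_supp_in by simp
    qed
  qed
  finally have Ur: "M.U s r \<in> supp_in ?D" .
  have "barM (bvec ?t) = M.U s (barM (bvec ?v))" unfolding e by (rule barM_TM [OF 2(1) vV])
  also have "\<dots> = M.U s (bvec ?v) + M.U s r"
    using slin_add [OF M.U_lin [OF 2(1)], of "bvec ?v" r] by (simp add: r_def)
  also have "M.U s (bvec ?v) = bvec ?t - sc qL (bvec ?v)" unfolding e M.U_def ..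
  finally have b: "barM (bvec ?t) = bvec ?t - sc qL (bvec ?v) + M.U s r" .
  have "bvec ?t - sc qL (bvec ?v) + M.U s r - bvec ?t = M.U s r - sc qL (bvec ?v)" by simp
  then show ?case unfolding b
    using supp_in_diff [OF Ur supp_in_sc [OF bvec_supp_in [OF vD]]] by (simp only:)
qed

section \<open>The canonical basis\<close>

lemma triangular_barM: "triangular_bar KK (precK W S J) (ht W S J) barM"
proof unfold_locales
  show "finite KK" by (rule finite_KK)
  show "i \<in> KK" if "precK W S J i j" for i j using that by (simp add: precK_def)
  show "precK W S J i k" if "precK W S J i j" "precK W S J j k" for i j k using precK_trans that .
  show "ht W S J i < ht W S J j" if "precK W S J i j" for i j using that by (simp add: precK_def)
  show "alin barM" by (rule barM_alin)
  show "barM (barM m) = m" if "m \<in> VM" for m using barM_invol that .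
  show "barM (bvec j) - bvec j \<in> supp_in {i. precK W S J i j}" if "j \<in> KK" for j
    using barM_triangular that .
qed

sublocale C: triangular_bar KK "precK W S J" "ht W S J" barM
  by (rule triangular_barM)

lemma canonical_iff:
  "canonical W S J barM C \<longleftrightarrow>
    (\<forall>\<tau>\<in>KK. barM (C \<tau>) = C \<tau> \<and> C \<tau> - bvec \<tau> \<in> neg_supp {\<upsilon>. precK W S J \<upsilon> \<tau>})"
proof -
  have "(C \<tau> \<tau> = 1 \<and> (\<forall>\<upsilon>. \<upsilon> \<noteq> \<tau> \<and> C \<tau> \<upsilon> \<noteq> 0 \<longrightarrow> precK W S J \<upsilon> \<tau> \<and> Poly_Mapping.keys (C \<tau> \<upsilon>) \<subseteq> {n. n < 0}))
     \<longleftrightarrow> C \<tau> - bvec \<tau> \<in> neg_supp {\<upsilon>. precK W S J \<upsilon> \<tau>}" (is "?L \<longleftrightarrow> ?R") for \<tau>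
  proof
    assume L: ?L
    have d: "(C \<tau> - bvec \<tau>) \<upsilon> = (if \<upsilon> = \<tau> then 0 else C \<tau> \<upsilon>)" for \<upsilon>
      using L by (simp add: bvec_apply)
    have "(C \<tau> - bvec \<tau>) \<upsilon> = 0" if "\<not> precK W S J \<upsilon> \<tau>" for \<upsilon>
    proof (cases "\<upsilon> = \<tau>")
      case False
      then have "C \<tau> \<upsilon> = 0" using L that by blast
      then show ?thesis unfolding d by simp
    next
      case True
      then show ?thesis unfolding d by simp
    qed
    moreover have "Poly_Mapping.keys ((C \<tau> - bvec \<tau>) \<upsilon>) \<subseteq> {n. n < 0}" for \<upsilon>
    proof (cases "\<upsilon> \<noteq> \<tau> \<and> C \<tau> \<upsilon> \<noteq> 0")
      case True
      then have "Poly_Mapping.keys (C \<tau> \<upsilon>) \<subseteq> {n. n < 0}" using L by blast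
      then show ?thesis unfolding d using True by simp
    next
      case False
      then have "(C \<tau> - bvec \<tau>) \<upsilon> = 0" unfolding d by auto
      then show ?thesis by simp
    qed
    ultimately show ?R unfolding neg_supp_def supp_in_def by blast
  next
    assume R: ?R
    have d: "C \<tau> \<upsilon> = (C \<tau> - bvec \<tau>) \<upsilon> + (if \<upsilon> = \<tau> then 1 else 0)" for \<upsilon>
      by (simp add: bvec_apply)
    have z: "(C \<tau> - bvec \<tau>) \<upsilon> = 0" if "\<not> precK W S J \<upsilon> \<tau>" for \<upsilon>
      using R that unfolding neg_supp_def supp_in_def by blast
    have n: "Poly_Mapping.keys ((C \<tau> - bvec \<tau>) \<upsilon>) \<subseteq> {n. n < 0}" for \<upsilon>
      using R unfolding neg_supp_def by blast
    have "C \<tau> \<tau> = 1" using d [of \<tau>] z [of \<tau>] C.irrefl by simp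
    moreover have "precK W S J \<upsilon> \<tau> \<and> Poly_Mapping.keys (C \<tau> \<upsilon>) \<subseteq> {n. n < 0}"
      if u: "\<upsilon> \<noteq> \<tau>" "C \<tau> \<upsilon> \<noteq> 0" for \<upsilon>
    proof -
      have c: "C \<tau> \<upsilon> = (C \<tau> - bvec \<tau>) \<upsilon>" using d [of \<upsilon>] u(1) by simp
      then have "precK W S J \<upsilon> \<tau>" using z [of \<upsilon>] u(2) by argo
      then show ?thesis unfolding c using n [of \<upsilon>] by blast
    qed
    ultimately show ?L by blast
  qed
  then show ?thesis unfolding canonical_def by blast
qed

text \<open>Unitriangularity over a finite index set gives spanning and independence.\<close>

lemma canonical_basis:
  assumes "canonical W S J barM C" shows "is_basis W S J C"
  unfolding is_basis_def Mcar_eq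
proof (intro conjI ballI)
  have u: "C \<tau> - bvec \<tau> \<in> supp_in {\<upsilon>. precK W S J \<upsilon> \<tau>}" if "\<tau> \<in> KK" for \<tau>
    using assms that unfolding canonical_iff neg_supp_def by blast
  show "C \<tau> \<in> VM" if t: "\<tau> \<in> KK" for \<tau>
  proof -
    have "C \<tau> - bvec \<tau> \<in> VM" using u [OF t] by (auto simp: supp_in_def precK_def)
    from supp_in_add [OF this bvec_supp_in [OF t]] show ?thesis by simp
  qed
  fix m assume m: "m \<in> VM"
  have sum_eq: "(\<lambda>\<upsilon>. \<Sum>\<tau>\<in>KK. c \<tau> * C \<tau> \<upsilon>) = (\<Sum>\<tau>\<in>KK. sc (c \<tau>) (C \<tau>))" for c
    by (rule ext) (simp only: sum_fun_apply sc_apply)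
  have mem: "(\<forall>\<tau>. \<tau> \<notin> KK \<longrightarrow> c \<tau> = 0) \<longleftrightarrow> c \<in> VM" for c :: "'a kelt \<Rightarrow> laurent"
    by (simp add: supp_in_def)
  obtain c where c: "c \<in> VM" "m = (\<Sum>\<tau>\<in>KK. sc (c \<tau>) (C \<tau>))"
    using C.unitriangular_span [OF u finite_KK subset_refl _ m] by (auto simp: precK_def)
  have "c' = c" if c': "c' \<in> VM" "m = (\<Sum>\<tau>\<in>KK. sc (c' \<tau>) (C \<tau>))" for c'
  proof -
    have "(\<Sum>\<tau>\<in>KK. sc ((c' - c) \<tau>) (C \<tau>)) = (\<Sum>\<tau>\<in>KK. sc (c' \<tau>) (C \<tau>)) - (\<Sum>\<tau>\<in>KK. sc (c \<tau>) (C \<tau>))"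
      by (simp only: minus_apply sc_minus_left sum_subtractf)
    also have "\<dots> = 0" using c(2) c'(2) by simp
    finally have z: "(\<Sum>\<tau>\<in>KK. sc ((c' - c) \<tau>) (C \<tau>)) = 0" .
    have "c' - c = 0"
      by (rule C.unitriangular_independent [OF _ supp_in_diff [OF c'(1) c(1)] z]) (rule u)
    then show ?thesis by simp
  qed
  then show "\<exists>!c. (\<forall>\<tau>. \<tau> \<notin> KK \<longrightarrow> c \<tau> = 0) \<and> m = (\<lambda>\<upsilon>. \<Sum>\<tau>\<in>KK. c \<tau> * C \<tau> \<upsilon>)"
    unfolding mem sum_eq using c by blast
qed

lemma canonical_ex: "\<exists>C. canonical W S J barM C"
proof -
  have "\<exists>C. \<forall>\<tau>\<in>KK. barM (C \<tau>) = C \<tau> \<and> C \<tau> - bvec \<tau> \<in> neg_supp {\<upsilon>. precK W S J \<upsilon> \<tau>}"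
    by (rule bchoice) (use C.canonical_exists in blast)
  then show ?thesis unfolding canonical_iff .
qed

lemma canonical_uniq:
  "\<lbrakk>canonical W S J barM C; canonical W S J barM C'; \<tau> \<in> KK\<rbrakk> \<Longrightarrow> C' \<tau> = C \<tau>"
  unfolding canonical_iff using C.canonical_unique by blast

lemma barM_coeffs:
  assumes t: "\<tau> \<in> KK"
  shows "barM (bvec \<tau>) \<tau> = 1" "\<lbrakk>\<upsilon> \<noteq> \<tau>; barM (bvec \<tau>) \<upsilon> \<noteq> 0\<rbrakk> \<Longrightarrow> precK W S J \<upsilon> \<tau>"
  using C.bar_bvec_coeff [OF t, of \<tau>] C.irrefl C.bar_bvec_coeff [OF t, of \<upsilon>]
  by (auto simp: bvec_apply)

end

theorem mainTheorem11:
  fixes W :: "'a monoid" and S J :: "'a set" and \<sigma> :: "'a \<Rightarrow> int"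
  assumes cox: "coxeter_system W S"
    and fin: "finite (carrier W)"
    and JS: "J \<subseteq> S"
    and sigma_pm: "\<forall>u\<in>WJ W J. \<sigma> u \<in> {1, -1}"
    and sigma_hom: "\<forall>u\<in>WJ W J. \<forall>v\<in>WJ W J. \<sigma> (u \<otimes>\<^bsub>W\<^esub> v) = \<sigma> u * \<sigma> v"
  shows "\<exists>act. is_hmodule W S J act \<and> action_rules W S J \<sigma> act
     \<and> (\<forall>act'. is_hmodule W S J act' \<and> action_rules W S J \<sigma> act' \<longrightarrow>
           (\<forall>h\<in>heckeH W. \<forall>m\<in>Mcar W S J. act' h m = act h m))
     \<and> (\<exists>\<phi>. compat_bar W S J act \<phi> \<and> fixes_minimal W S J \<phi>
          \<and> (\<forall>\<phi>'. compat_bar W S J act \<phi>' \<and> fixes_minimal W S J \<phi>' \<longrightarrow>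
                 (\<forall>m\<in>Mcar W S J. \<phi>' m = \<phi> m))
          \<and> (\<forall>m\<in>Mcar W S J. \<phi> (\<phi> m) = m)
          \<and> (\<forall>\<tau>\<in>KJ W S J. \<phi> (bvec \<tau>) \<tau> = 1
               \<and> (\<forall>\<upsilon>. \<upsilon> \<noteq> \<tau> \<and> \<phi> (bvec \<tau>) \<upsilon> \<noteq> 0 \<longrightarrow> precK W S J \<upsilon> \<tau>))
          \<and> (\<exists>C. is_basis W S J C \<and> canonical W S J \<phi> C
               \<and> (\<forall>C'. is_basis W S J C' \<and> canonical W S J \<phi> C' \<longrightarrow>
                      (\<forall>\<tau>\<in>KJ W S J. C' \<tau> = C \<tau>))))"
proof -
  interpret sigma_parabolic W S J \<sigma>
    by unfold_locales (fact cox fin JS sigma_pm sigma_hom)+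
  obtain C where C: "canonical W S J barM C" using canonical_ex by blast
  have "is_basis W S J C \<and> canonical W S J barM C
      \<and> (\<forall>C'. is_basis W S J C' \<and> canonical W S J barM C' \<longrightarrow> (\<forall>\<tau>\<in>KJ W S J. C' \<tau> = C \<tau>))"
    using canonical_basis [OF C] C canonical_uniq [OF C] by blast
  moreover have "fixes_minimal W S J barM"
    using barM_minimal by (simp add: fixes_minimal_def)
  moreover have "\<forall>\<phi>'. compat_bar W S J M.hact \<phi>' \<and> fixes_minimal W S J \<phi>' \<longrightarrow>
      (\<forall>m\<in>Mcar W S J. \<phi>' m = barM m)"
    unfolding Mcar_eq using barM_unique by blast
  moreover have "\<forall>m\<in>Mcar W S J. barM (barM m) = m"
    unfolding Mcar_eq using barM_invol by blast
  moreover have "\<forall>\<tau>\<in>KJ W S J. barM (bvec \<tau>) \<tau> = 1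
      \<and> (\<forall>\<upsilon>. \<upsilon> \<noteq> \<tau> \<and> barM (bvec \<tau>) \<upsilon> \<noteq> 0 \<longrightarrow> precK W S J \<upsilon> \<tau>)"
    using barM_coeffs by blast
  moreover have "\<forall>act'. is_hmodule W S J act' \<and> action_rules W S J \<sigma> act' \<longrightarrow>
      (\<forall>h\<in>heckeH W. \<forall>m\<in>Mcar W S J. act' h m = M.hact h m)"
    unfolding Mcar_eq using hmodule_unique by blast
  ultimately show ?thesis
    using hmodule_M rules_M compat_barM
    by (intro exI [of _ M.hact] conjI exI [of _ barM]) (assumption | blast)+
qed

end
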